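(* Assume: (F) $F_0$ has bounded support $\mathcal{S}_0=[0,M_0]$ and is strictly increasing on $\mathcal{S}_0$ with density $f_0$, strictly staying away from zero on $\mathcal{S}_0$; (G) $G$ has support $[0,\infty)$, is strictly increasing on $\mathcal{S}_0$ with density $g$ staying away from zero on $\mathcal{S}_0$, and $g'$ is bounded on $\mathcal{S}_0$. Fix $t>0$ such that $f_0''$ is continuous at $t$ and $f_0''(t)\ne0$. Let $h=cn^{-1/7}$ ($c>0$) be the bandwidth used in the definition of $\hat f_n^{\mathrm{SM}}$. Then, as $n\to\infty$, $$n^{2/7}\big(\hat f_n^{\mathrm{SM}}(t)-f_0(t)\big)\rightsquigarrow\mathcal{N}(\mu_{f,\mathrm{SM}},\sigma^2_{f,\mathrm{SM}}),$$ where $$\mu_{f,\mathrm{SM}}=\tfrac12c^2m_2(k)f_0''(t),\qquad\sigma^2_{f,\mathrm{SM}}=\frac{F_0(t)(1-F_0(t))}{c^3g(t)}\int k'(u)^2\,du.$$ For fixed $t$, the aMSE-optimal value of $h$ for estimating with $\hat f_n^{\mathrm{SM}}(t)$ is $h_{n,f,\mathrm{SM}}=c_{f,\mathrm{SM}}n^{-1/7}$, where $$c_{f,\mathrm{SM}}=\Big\{3\frac{F_0(t)(1-F_0(t))}{g(t)}\int k'(u)^2\,du\Big\}^{1/7}\{m_2^2(k)f_0''(t)^2\}^{-1/7};$$ that is, $c_{f,\mathrm{SM}}$ minimizes the asymptotic mean squared error $\mu_{f,\mathrm{SM}}^2+\sigma_{f,\mathrm{SM}}^2$ over $c>0$.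
   Context: Current status model: $X_1,X_2,\dots$ are i.i.d. with distribution function $F_0$ on $[0,\infty)$, and, independently, $T_1,T_2,\dots$ are i.i.d. with distribution function $G$ on $[0,\infty)$ having Lebesgue density $g$. One observes $(T_i,\Delta_i)$, $1\le i\le n$, with $\Delta_i=1_{\{X_i\le T_i\}}$. The (nonparametric) maximum likelihood estimator $\hat F_n$ maximizes $\frac1n\sum_{i=1}^n\{\Delta_i\log F(T_i)+(1-\Delta_i)\log(1-F(T_i))\}$ over all distribution functions $F$. Explicitly: let $T_{(1)}<\dots<T_{(n)}$ be the ordered $T_i$ and $\Delta_{(i)}$ the indicator associated with $T_{(i)}$; let $P_0=(0,0)$, $P_i=(i/n,\frac1n\sum_{j\le i}\Delta_{(j)})$. Then $\hat F_n(T_{(i)})$ is the left derivative at $P_i$ of the greatest convex minorant of the points $P_0,\dots,P_n$; elsewhere $\hat F_n$ is the right-continuous step function determined by these values (equal to $0$ on $[0,T_{(1)})$). Kernel: $k$ is a probability density with support $[-1,1]$, symmetric and twice continuously differentiable on $\mathbb{R}$; $m_2(k)=\int u^2k(u)\,du$; $k_h(u)=h^{-1}k(u/h)$. The smoothed maximum likelihood estimator (SMLE) of $f_0$ is $\hat f_n^{\mathrm{SM}}(t)=\int k_h(t-u)\,d\hat F_n(u)$. The symbol $\rightsquigarrow$ denotes convergence in distribution. *)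

theory Defs
  imports "HOL-Probability.Probability"
begin

section \<open>Distribution functions on the real line\<close>

definition topological_support :: "'a::topological_space measure \<Rightarrow> 'a set" where
  "topological_support \<mu> = {x. \<forall>U. open U \<longrightarrow> x \<in> U \<longrightarrow> 0 < emeasure \<mu> U}"

definition df_support :: "(real \<Rightarrow> real) \<Rightarrow> real set" where
  "df_support F = topological_support (interval_measure F)"

definition has_density :: "(real \<Rightarrow> real) \<Rightarrow> (real \<Rightarrow> real) \<Rightarrow> bool" where
  "has_density F f \<longleftrightarrow> f \<in> borel_measurable borel \<and> (\<forall>x. 0 \<le> f x) \<and>
     interval_measure F = density lborel (\<lambda>x. ennreal (f x))"

definition conv_in_distr :: "'a measure \<Rightarrow> (nat \<Rightarrow> 'a \<Rightarrow> real) \<Rightarrow> real measure \<Rightarrow> bool" where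
  "conv_in_distr M Z \<nu> \<longleftrightarrow>
     (\<forall>n. Z n \<in> borel_measurable M) \<and> weak_conv_m (\<lambda>n. distr M borel (Z n)) \<nu>"

text \<open>\<^const>\<open>normal_density\<close> is parametrised by the standard deviation; here \<open>v\<close> is the variance.\<close>

definition normal_law :: "real \<Rightarrow> real \<Rightarrow> real measure" where
  "normal_law m v = density lborel (\<lambda>x. ennreal (normal_density m (sqrt v) x))"

section \<open>The current status model\<close>

text \<open>The sequences are indexed from 0: the variables \<open>X\<^sub>1, X\<^sub>2, \<dots>\<close> are \<open>X 0, X 1, \<dots>\<close>, and a sample
  of size \<open>n\<close> consists of the indices below \<open>n\<close>.\<close>

definition current_status_model ::
  "'a measure \<Rightarrow> (nat \<Rightarrow> 'a \<Rightarrow> real) \<Rightarrow> (nat \<Rightarrow> 'a \<Rightarrow> real) \<Rightarrow> (real \<Rightarrow> real) \<Rightarrow> (real \<Rightarrow> real) \<Rightarrow> bool" where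
  "current_status_model M X T F0 G \<longleftrightarrow>
     prob_space M \<and>
     prob_space.indep_vars M (\<lambda>_. borel) X UNIV \<and>
     prob_space.indep_vars M (\<lambda>_. borel) T UNIV \<and>
     prob_space.indep_var M (Pi\<^sub>M UNIV (\<lambda>_. borel)) (\<lambda>\<omega> i. X i \<omega>)
                            (Pi\<^sub>M UNIV (\<lambda>_. borel)) (\<lambda>\<omega> i. T i \<omega>) \<and>
     (\<forall>i. cdf (distr M borel (X i)) = F0) \<and> (\<forall>i. cdf (distr M borel (T i)) = G) \<and>
     (\<forall>x<0. F0 x = 0) \<and> (\<forall>x<0. G x = 0)"

definition status :: "(nat \<Rightarrow> 'a \<Rightarrow> real) \<Rightarrow> (nat \<Rightarrow> 'a \<Rightarrow> real) \<Rightarrow> 'a \<Rightarrow> nat \<Rightarrow> real" where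
  "status X T \<omega> i = of_bool (X i \<omega> \<le> T i \<omega>)"

section \<open>The maximum likelihood estimator\<close>

text \<open>Below, \<open>ts\<close> and \<open>ds\<close> are the observed times and indicators of one realisation. Ties among the
  times, which have probability zero in the model, are broken by the index (\<^const>\<open>sort_key\<close> is
  stable).\<close>

definition ordered_indicator :: "(nat \<Rightarrow> real) \<Rightarrow> (nat \<Rightarrow> real) \<Rightarrow> nat \<Rightarrow> nat \<Rightarrow> real" where
  "ordered_indicator ts ds n j = ds (sort_key ts [0..<n] ! (j - 1))"

definition cusum_points :: "(nat \<Rightarrow> real) \<Rightarrow> (nat \<Rightarrow> real) \<Rightarrow> nat \<Rightarrow> (real \<times> real) set" where
  "cusum_points ts ds n =
     (\<lambda>i. (real i / real n, (\<Sum>j = 1..i. ordered_indicator ts ds n j) / real n)) ` {0..n}"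

definition greatest_convex_minorant :: "real set \<Rightarrow> (real \<times> real) set \<Rightarrow> real \<Rightarrow> real" where
  "greatest_convex_minorant I P x =
     (SUP \<phi>\<in>{\<phi>. convex_on I \<phi> \<and> (\<forall>(a, b)\<in>P. \<phi> a \<le> b)}. \<phi> x)"

definition left_derivative :: "(real \<Rightarrow> real) \<Rightarrow> real \<Rightarrow> real" where
  "left_derivative \<phi> x = (THE D. (\<phi> has_real_derivative D) (at_left x))"

text \<open>The number \<open>i\<close> of observation times in \<open>(-\<infinity>, x]\<close> is the largest index with
  \<open>T\<^sub>(\<^sub>i\<^sub>) \<le> x\<close>, so the value below is that of the right-continuous step function jumping at the
  order statistics only.\<close>

definition npmle :: "(nat \<Rightarrow> real) \<Rightarrow> (nat \<Rightarrow> real) \<Rightarrow> nat \<Rightarrow> real \<Rightarrow> real" where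
  "npmle ts ds n x =
     (let i = card {j. j < n \<and> ts j \<le> x}
      in if i = 0 then 0
         else left_derivative (greatest_convex_minorant {0..1} (cusum_points ts ds n))
                (real i / real n))"

section \<open>The smoothed maximum likelihood estimator of the density\<close>

definition smooth_kernel :: "(real \<Rightarrow> real) \<Rightarrow> bool" where
  "smooth_kernel k \<longleftrightarrow>
     (\<forall>u. 0 \<le> k u) \<and> (k has_integral 1) UNIV \<and>
     closure {u. k u \<noteq> 0} = {-1..1} \<and> (\<forall>u. k (- u) = k u) \<and>
     (\<forall>u. k differentiable (at u)) \<and> (\<forall>u. deriv k differentiable (at u)) \<and>
     continuous_on UNIV (deriv (deriv k))"

definition rescaled_kernel :: "(real \<Rightarrow> real) \<Rightarrow> real \<Rightarrow> real \<Rightarrow> real" where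
  "rescaled_kernel k h u = k (u / h) / h"

definition smle_density ::
  "(real \<Rightarrow> real) \<Rightarrow> real \<Rightarrow> (nat \<Rightarrow> real) \<Rightarrow> (nat \<Rightarrow> real) \<Rightarrow> nat \<Rightarrow> real \<Rightarrow> real" where
  "smle_density k h ts ds n t =
     (LINT u|interval_measure (npmle ts ds n). rescaled_kernel k h (t - u))"

section \<open>Asymptotic bias, variance and optimal bandwidth constant\<close>

definition second_moment :: "(real \<Rightarrow> real) \<Rightarrow> real" where
  "second_moment k = (LINT u|lborel. u\<^sup>2 * k u)"

definition smle_mean :: "(real \<Rightarrow> real) \<Rightarrow> (real \<Rightarrow> real) \<Rightarrow> real \<Rightarrow> real \<Rightarrow> real" where
  "smle_mean k f0 t c = 1 / 2 * c\<^sup>2 * second_moment k * deriv (deriv f0) t"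

definition smle_var ::
  "(real \<Rightarrow> real) \<Rightarrow> (real \<Rightarrow> real) \<Rightarrow> (real \<Rightarrow> real) \<Rightarrow> real \<Rightarrow> real \<Rightarrow> real" where
  "smle_var k F0 g t c =
     F0 t * (1 - F0 t) / (c ^ 3 * g t) * (LINT u|lborel. (deriv k u)\<^sup>2)"

definition smle_amse ::
  "(real \<Rightarrow> real) \<Rightarrow> (real \<Rightarrow> real) \<Rightarrow> (real \<Rightarrow> real) \<Rightarrow> (real \<Rightarrow> real) \<Rightarrow> real \<Rightarrow> real \<Rightarrow> real" where
  "smle_amse k F0 f0 g t c = (smle_mean k f0 t c)\<^sup>2 + smle_var k F0 g t c"

definition smle_opt_const ::
  "(real \<Rightarrow> real) \<Rightarrow> (real \<Rightarrow> real) \<Rightarrow> (real \<Rightarrow> real) \<Rightarrow> (real \<Rightarrow> real) \<Rightarrow> real \<Rightarrow> real" where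
  "smle_opt_const k F0 f0 g t =
     (3 * (F0 t * (1 - F0 t) / g t) * (LINT u|lborel. (deriv k u)\<^sup>2)) powr (1 / 7) *
     ((second_moment k)\<^sup>2 * (deriv (deriv f0) t)\<^sup>2) powr (- (1 / 7))"

end

theory Submission
  imports Defs "HOL-Real_Asymp.Real_Asymp"
begin

text \<open>
  Integration by parts turns the estimator into \<open>\<integral> \<psi> F\<close>, where \<open>F\<close> is the maximum likelihood
  estimator of the distribution function, \<open>\<psi>(u) = k'((t - u)/h)/h\<^sup>2\<close>, and the integral is with respect to
  Lebesgue measure. The same identity for \<open>F0\<close> gives the kernel smoothed density
  \<open>\<integral> k\<^sub>h(t - u) f0(u) du\<close>; its Taylor expansion at \<open>t\<close> produces the asymptotic mean
  (\<open>kernel_bias_tendsto\<close>). What remains is \<open>\<integral> \<psi> (F - F0)\<close>. With \<open>\<phi> = \<psi>/g\<close> this is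
  \<open>\<integral> \<phi> (F - F0) dG\<close>, and the claim is that it equals the average of
  \<open>\<phi>(T\<^sub>i) (\<Delta>\<^sub>i - F0(T\<^sub>i))\<close> up to an error that is \<open>o(n\<^bsup>-2/7\<^esup>)\<close> in probability. That
  average is a sum of independent, centred, uniformly small variables, so the central limit theorem for
  triangular arrays applies to it (\<open>triangular_array_char_tendsto\<close>) and yields the asymptotic variance.

  The error has two sources. First, \<open>G\<close> is replaced by the empirical distribution \<open>G\<^sub>n\<close> of the times.
  Both \<open>F - F0(t)\<close> and \<open>F0 - F0(t)\<close> are monotone and of size \<open>O(h)\<close> on \<open>[t - h, t + h]\<close>, and
  \<open>\<phi>\<close> has total variation \<open>O(h\<^sup>-\<^sup>2)\<close>. Hence the products with \<open>\<phi>\<close> have variation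
  \<open>O(h\<^sup>-\<^sup>1)\<close>, and the replacement costs at most that times the uniform distance of \<open>G\<^sub>n\<close> and
  \<open>G\<close>, which is \<open>n\<^bsup>-1/2\<^esup>\<close> up to a logarithm (\<open>window_times_monotone_integral_diff\<close>).

  Second, \<open>F\<close> is replaced by the indicators. Since \<open>F\<close> is the slope of the greatest convex minorant of the
  cumulative sum diagram, \<open>\<integral> \<phi> F dG\<^sub>n\<close> is a Stieltjes integral of \<open>\<phi>\<close> against the minorant, while
  the average of \<open>\<phi>(T\<^sub>i) \<Delta>\<^sub>i\<close> is one against the diagram itself. Summation by parts bounds the difference
  by the variation \<open>O(h\<^sup>-\<^sup>2)\<close> of \<open>\<phi>\<close> times the vertical distance of diagram and minorant
  (\<open>minorant_summation_by_parts\<close>). That distance is only \<open>n\<^bsup>-2/3\<^esup>\<close> up to logarithms: the mean of the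
  diagram is strictly convex because \<open>F0\<close> increases at a positive rate, the deviation of the diagram from its
  mean over a stretch of \<open>m\<close> observations is at most \<open>\<surd>m\<close> up to a logarithm, and the convexity gap, of order
  \<open>m\<^sup>2/n\<close>, exceeds this once \<open>m\<close> is larger than \<open>n\<^bsup>2/3\<^esup>\<close>. So a line with slope \<open>F0(u)\<close>, lowered
  by the fluctuation over the first \<open>n\<^bsup>2/3\<^esup>\<close> observations, stays below the whole diagram
  (\<open>cusum_above_line\<close>).

  With \<open>h\<close> of order \<open>n\<^bsup>-1/7\<^esup>\<close> the two errors have orders \<open>n\<^bsup>-5/14\<^esup>\<close> and \<open>n\<^bsup>-8/21\<^esup>\<close>, up to
  logarithms. Both deviation bounds follow from Hoeffding's inequality and a union bound; for the diagram it is
  applied conditionally on the times, which fixes the order of the indicators (\<open>windows_deviation\<close>,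
  \<open>grid_deviation\<close>).

  The asymptotic mean squared error is of the form \<open>A c\<^sup>4 + B/c\<^sup>3\<close> with positive \<open>A\<close> and \<open>B\<close>, whose unique
  minimum is at \<open>c\<^sup>7 = 3B/(4A)\<close> (\<open>power_sum_unique_minimum\<close>).
\<close>

section \<open>Greatest convex minorants of cumulative sum diagrams\<close>

definition cusum :: "(nat \<Rightarrow> real) \<Rightarrow> nat \<Rightarrow> (real \<times> real) set" where
  "cusum s n = (\<lambda>i. (real i / real n, s i / real n)) ` {0..n}"

abbreviation gcm :: "(nat \<Rightarrow> real) \<Rightarrow> nat \<Rightarrow> real \<Rightarrow> real" where
  "gcm s n \<equiv> greatest_convex_minorant {0..1} (cusum s n)"

text \<open>Multiplying by \<open>n\<close> undoes the scaling of \<^const>\<open>cusum\<close>, so that these values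
  compare directly with \<open>s\<close>.\<close>

definition gcm_node :: "(nat \<Rightarrow> real) \<Rightarrow> nat \<Rightarrow> nat \<Rightarrow> real" where
  "gcm_node s n i = real n * gcm s n (real i / real n)"

lemma convex_on_below_chord_endpoints:
  fixes \<phi> :: "real \<Rightarrow> real"
  assumes "convex_on {0..1} \<phi>" "0 \<le> x" "x \<le> 1"
  shows "\<phi> x \<le> (1 - x) * \<phi> 0 + x * \<phi> 1"
  using convex_onD[OF assms(1), of x 0 1] assms by simp

lemma cusum_minorant_bdd_above:
  assumes "0 < n" "0 \<le> x" "x \<le> 1"
  shows "bdd_above ((\<lambda>\<phi>. \<phi> x) ` {\<phi>. convex_on {0..1} \<phi> \<and> (\<forall>(a, b)\<in>cusum s n. \<phi> a \<le> b)})"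
proof (rule bdd_aboveI2)
  fix \<phi> assume "\<phi> \<in> {\<phi>. convex_on {0..1} \<phi> \<and> (\<forall>(a, b)\<in>cusum s n. \<phi> a \<le> b)}"
  then have c: "convex_on {0..1} \<phi>" and m: "\<forall>i\<in>{0..n}. \<phi> (real i / real n) \<le> s i / n"
    by (auto simp: cusum_def)
  have "\<phi> 0 \<le> s 0 / n" "\<phi> 1 \<le> s n / n" using m[rule_format, of 0] m[rule_format, of n] assms by auto
  then have "(1 - x) * \<phi> 0 + x * \<phi> 1 \<le> (1 - x) * (s 0 / n) + x * (s n / n)"
    using assms by (intro add_mono mult_left_mono) auto
  then show "\<phi> x \<le> (1 - x) * (s 0 / n) + x * (s n / n)"
    using convex_on_below_chord_endpoints[OF c assms(2,3)] by linarith
qed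

lemma convex_on_affine: "convex_on {0..1::real} (\<lambda>x. a + b * x)"
  by (intro convex_onI) (auto simp: algebra_simps)

text \<open>Every lower bound on the minorant below rests on this: a line below all points is itself a competitor in
  the supremum.\<close>

lemma affine_minorant_le_gcm:
  assumes "0 < n" "0 \<le> x" "x \<le> 1" "\<And>i. i \<le> n \<Longrightarrow> a + b * (real i / real n) \<le> s i / n"
  shows "a + b * x \<le> gcm s n x"
proof -
  have "(\<lambda>x. a + b * x) \<in> {\<phi>. convex_on {0..1} \<phi> \<and> (\<forall>(a, b)\<in>cusum s n. \<phi> a \<le> b)}"
    using assms(4) convex_on_affine by (auto simp: cusum_def)
  from cSUP_upper[OF this cusum_minorant_bdd_above[OF assms(1-3)]]
  show ?thesis unfolding greatest_convex_minorant_def by simp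
qed

lemma cusum_minorants_nonempty:
  assumes "0 < n"
  shows "{\<phi>. convex_on {0..1} \<phi> \<and> (\<forall>(a, b)\<in>cusum s n. \<phi> a \<le> b)} \<noteq> {}"
proof -
  define m where "m = Min ((\<lambda>i. s i / n) ` {0..n})"
  have "(\<lambda>x. m + 0 * x) \<in> {\<phi>. convex_on {0..1} \<phi> \<and> (\<forall>(a, b)\<in>cusum s n. \<phi> a \<le> b)}"
    unfolding mem_Collect_eq
  proof
    have "m \<le> s i / n" if "i \<le> n" for i unfolding m_def using that by (intro Min_le) auto
    then show "\<forall>(a, b)\<in>cusum s n. m + 0 * a \<le> b" by (auto simp: cusum_def)
  qed (rule convex_on_affine)
  then show ?thesis by blast
qed

lemma gcm_convex:
  assumes n: "0 < n"
  shows "convex_on {0..1} (gcm s n)"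
proof (intro convex_onI)
  fix u x y :: real
  assume u: "0 < u" "u < 1" and x: "x \<in> {0..1}" and y: "y \<in> {0..1}"
  let ?S = "{\<phi>. convex_on {0..1} \<phi> \<and> (\<forall>(a, b)\<in>cusum s n. \<phi> a \<le> b)}"
  show "gcm s n ((1 - u) *\<^sub>R x + u *\<^sub>R y) \<le> (1 - u) * gcm s n x + u * gcm s n y"
    unfolding greatest_convex_minorant_def
  proof (rule cSUP_least)
    show "?S \<noteq> {}" by (rule cusum_minorants_nonempty[OF n])
    fix \<phi> assume \<phi>: "\<phi> \<in> ?S"
    have "\<phi> ((1 - u) *\<^sub>R x + u *\<^sub>R y) \<le> (1 - u) * \<phi> x + u * \<phi> y"
      using \<phi> u x y convex_onD[of "{0..1}" \<phi> u x y] by auto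
    also have "\<dots> \<le> (1 - u) * (SUP \<phi>\<in>?S. \<phi> x) + u * (SUP \<phi>\<in>?S. \<phi> y)"
      using u x y by (intro add_mono mult_left_mono cSUP_upper \<phi> cusum_minorant_bdd_above n) auto
    finally show "\<phi> ((1 - u) *\<^sub>R x + u *\<^sub>R y) \<le>
        (1 - u) * (SUP \<phi>\<in>?S. \<phi> x) + u * (SUP \<phi>\<in>?S. \<phi> y)" .
  qed
qed simp

lemma gcm_node_le:
  assumes "0 < n" "i \<le> n"
  shows "gcm_node s n i \<le> s i"
proof -
  have "gcm s n (real i / n) \<le> s i / n"
    unfolding greatest_convex_minorant_def
    by (rule cSUP_least[OF cusum_minorants_nonempty[OF assms(1)]]) (use assms in \<open>auto simp: cusum_def\<close>)
  then show ?thesis using assms by (simp add: gcm_node_def field_simps)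
qed

lemma line_le_gcm_node:
  assumes "0 < n" "i \<le> n" "\<And>j. j \<le> n \<Longrightarrow> a + b * real j \<le> s j"
  shows "a + b * real i \<le> gcm_node s n i"
proof -
  have "a / n + b * (real i / n) \<le> gcm s n (real i / n)"
  proof (intro affine_minorant_le_gcm)
    fix j assume "j \<le> n"
    from divide_right_mono[OF assms(3)[OF this], of "real n"]
    show "a / n + b * (real j / n) \<le> s j / n" by (simp add: add_divide_distrib)
  qed (use assms in auto)
  then show ?thesis using assms by (simp add: gcm_node_def field_simps)
qed

text \<open>Cleared of denominators, convexity at three grid points also makes sense when two of them
  coincide.\<close>

lemma gcm_node_three_points:
  assumes n: "0 < n" and "i \<le> j" "j \<le> k" "k \<le> n"
  shows "real (k - i) * gcm_node s n j \<le> real (k - j) * gcm_node s n i + real (j - i) * gcm_node s n k"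
proof (cases "i = k")
  case False
  then have ik: "i < k" using assms by auto
  define u where "u = real (j - i) / real (k - i)"
  have u: "0 \<le> u" "u \<le> 1" using assms ik by (auto simp: u_def)
  have uk: "u * (real k - real i) = real j - real i"
    using assms ik by (simp add: u_def of_nat_diff)
  have "(1 - u) * (real i / n) + u * (real k / n) = (real i + u * (real k - real i)) / n"
    by (simp add: ring_distribs add_divide_distrib diff_divide_distrib)
  then have eq: "(1 - u) * (real i / n) + u * (real k / n) = real j / n" unfolding uk by simp
  have "gcm s n (real j / n) \<le> (1 - u) * gcm s n (real i / n) + u * gcm s n (real k / n)"
    using convex_onD[OF gcm_convex[OF n, of s] u, of "real i / n" "real k / n"] assms eq
    by (simp add: field_simps)
  then have "real n * gcm s n (real j / n) \<le> real n * ((1 - u) * gcm s n (real i / n) + u * gcm s n (real k / n))"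
    using n by simp
  then have "gcm_node s n j \<le> (1 - u) * gcm_node s n i + u * gcm_node s n k"
    by (simp add: gcm_node_def algebra_simps)
  then have "real (k - i) * gcm_node s n j \<le> real (k - i) * ((1 - u) * gcm_node s n i + u * gcm_node s n k)"
    using ik by (intro mult_left_mono) auto
  also have "\<dots> = real (k - j) * gcm_node s n i + real (j - i) * gcm_node s n k"
  proof -
    have "real (k - i) * u = real (j - i)" using ik by (simp add: u_def)
    moreover have "real (k - i) * (1 - u) = real (k - j)"
      using calculation assms by (simp add: algebra_simps of_nat_diff)
    moreover have "real (k - i) * ((1 - u) * gcm_node s n i + u * gcm_node s n k) =
        (real (k - i) * (1 - u)) * gcm_node s n i + (real (k - i) * u) * gcm_node s n k"
      by (simp only: distrib_left mult.assoc)
    ultimately show ?thesis by simp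
  qed
  finally show ?thesis .
qed (use assms in auto)

definition gcm_slope :: "(nat \<Rightarrow> real) \<Rightarrow> nat \<Rightarrow> nat \<Rightarrow> real" where
  "gcm_slope s n i = gcm_node s n i - gcm_node s n (i - 1)"

lemma gcm_slope_le_right_chord:
  assumes "0 < n" "1 \<le> i" "i \<le> k" "k \<le> n"
  shows "real (k - i) * gcm_slope s n i \<le> gcm_node s n k - gcm_node s n i"
  using gcm_node_three_points[of n "i - 1" i k s] assms
  by (simp add: gcm_slope_def of_nat_diff algebra_simps)

lemma gcm_slope_ge_left_chord:
  assumes "0 < n" "1 \<le> i" "k \<le> i" "i \<le> n"
  shows "gcm_node s n i - gcm_node s n k \<le> real (i - k) * gcm_slope s n i"
proof (cases "k = i")
  case False
  then show ?thesis
  using gcm_node_three_points[of n k "i - 1" i s] assms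
  by (simp add: gcm_slope_def of_nat_diff algebra_simps)
qed simp

lemma gcm_slope_Suc_mono:
  assumes "0 < n" "1 \<le> i" "Suc i \<le> n"
  shows "gcm_slope s n i \<le> gcm_slope s n (Suc i)"
  using gcm_slope_le_right_chord[of n i "Suc i" s] assms by (simp add: gcm_slope_def)

lemma gcm_slope_mono:
  assumes "0 < n" "1 \<le> i" "i \<le> j" "j \<le> n"
  shows "gcm_slope s n i \<le> gcm_slope s n j"
  using assms(3,4)
proof (induction j rule: dec_induct)
  case (step m)
  then show ?case using gcm_slope_Suc_mono[of n m s] assms by simp
qed simp

lemma line_through_adjacent_nodes_le:
  assumes "0 < n" "1 \<le> i" "i \<le> n" "j \<le> n"
  shows "gcm_node s n i + gcm_slope s n i * (real j - real i) \<le> gcm_node s n j"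
proof (cases "j \<le> i")
  case True
  then show ?thesis using gcm_slope_ge_left_chord[of n i j s] assms
    by (simp add: of_nat_diff algebra_simps)
next
  case False
  then show ?thesis using gcm_slope_le_right_chord[of n i j s] assms
    by (simp add: of_nat_diff algebra_simps)
qed

text \<open>The minorant is linear between neighbouring grid points: convexity puts it below the chord, and the line
  through the chord lies below all points, hence below the minorant.\<close>

lemma gcm_left_derivative:
  assumes n: "0 < n" and i: "1 \<le> i" "i \<le> n"
  shows "left_derivative (gcm s n) (real i / n) = gcm_slope s n i"
proof -
  let ?x = "real i / n" and ?y = "real (i - 1) / n"
  define L where "L x = gcm s n ?x + gcm_slope s n i * (x - ?x)" for x
  have yx: "?y < ?x" using n i by (simp add: divide_strict_right_mono)
  have dif: "?x - ?y = 1 / n" using n i by (simp add: field_simps of_nat_diff)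
  have Ly: "L ?y = gcm s n ?y"
  proof -
    have "L ?y = gcm s n ?x - gcm_slope s n i * (1 / n)" using dif by (simp add: L_def algebra_simps)
    also have "\<dots> = gcm s n ?y" using n by (simp add: gcm_slope_def gcm_node_def field_simps)
    finally show ?thesis .
  qed
  \<comment> \<open>on the segment to the left of \<open>i/n\<close> the minorant coincides with the line \<open>L\<close>\<close>
  have eq: "gcm s n x = L x" if x: "?y \<le> x" "x \<le> ?x" for x
  proof (rule antisym)
    have x01: "0 \<le> x" "x \<le> 1"
    proof -
      have "0 \<le> ?y" by simp
      then show "0 \<le> x" using x by linarith
      have "?x \<le> 1" using i n by simp
      then show "x \<le> 1" using x by linarith
    qed
    define u where "u = (x - ?y) * n"
    have u: "0 \<le> u" "u \<le> 1"
    proof -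
      show "0 \<le> u" using x by (simp add: u_def)
      have "(x - ?y) * n \<le> (1 / n) * n" using x dif by (intro mult_right_mono) auto
      then show "u \<le> 1" using n by (simp add: u_def)
    qed
    have ux: "(1 - u) * ?y + u * ?x = x"
    proof -
      have "(1 - u) * ?y + u * ?x = ?y + u * (?x - ?y)"
        by (simp only: left_diff_distrib right_diff_distrib mult_1)
      also have "\<dots> = x" unfolding dif u_def using n by simp
      finally show ?thesis .
    qed
    have "gcm s n x \<le> (1 - u) * gcm s n ?y + u * gcm s n ?x"
      using convex_onD[OF gcm_convex[OF n, of s] u, of ?y ?x] n i ux by simp
    also have "\<dots> = (1 - u) * L ?y + u * L ?x" using Ly by (simp add: L_def)
    also have "\<dots> = L ((1 - u) * ?y + u * ?x)" unfolding L_def by algebra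
    finally show "gcm s n x \<le> L x" using ux by simp
    have "(gcm s n ?x - gcm_slope s n i * ?x) + gcm_slope s n i * x \<le> gcm s n x"
    proof (rule affine_minorant_le_gcm[OF n x01])
      fix j assume j: "j \<le> n"
      have "gcm_node s n i + gcm_slope s n i * (real j - real i) \<le> s j"
        using line_through_adjacent_nodes_le[OF n i j, of s] gcm_node_le[OF n j, of s] by linarith
      then have "(gcm_node s n i + gcm_slope s n i * (real j - real i)) / n \<le> s j / n"
        using n by (intro divide_right_mono) auto
      then show "(gcm s n ?x - gcm_slope s n i * ?x) + gcm_slope s n i * (real j / n) \<le> s j / n"
        using n by (simp add: gcm_node_def field_simps)
    qed
    then show "L x \<le> gcm s n x" by (simp add: L_def algebra_simps)
  qed
  have "(L has_real_derivative gcm_slope s n i) (at_left ?x)"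
    unfolding L_def[abs_def] by (auto intro!: derivative_eq_intros)
  moreover have ev: "\<forall>\<^sub>F x in at_left ?x. L x = gcm s n x"
    using eventually_at_left_real[OF yx] by eventually_elim (use eq in auto)
  ultimately have D: "(gcm s n has_real_derivative gcm_slope s n i) (at_left ?x)"
    using has_field_derivative_cong_eventually[OF ev] eq[of ?x] yx by simp
  show ?thesis unfolding left_derivative_def
  proof (rule the_equality)
    show "(gcm s n has_real_derivative gcm_slope s n i) (at_left (real i / n))" by (rule D)
  next
    fix E assume "(gcm s n has_real_derivative E) (at_left ?x)"
    then show "E = gcm_slope s n i"
      using D unfolding has_field_derivative_iff
      by (rule tendsto_unique[OF trivial_limit_at_left_real])
  qed
qed

lemma gcm_node_0:
  assumes "0 < n" "s 0 = 0" "\<And>i. i \<le> n \<Longrightarrow> 0 \<le> s i"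
  shows "gcm_node s n 0 = 0"
  using gcm_node_le[of n 0 s] line_le_gcm_node[of n 0 0 0 s] assms by force

lemma gcm_slope_nonneg:
  assumes "0 < n" "s 0 = 0" "\<And>i. i \<le> n \<Longrightarrow> 0 \<le> s i" "1 \<le> i" "i \<le> n"
  shows "0 \<le> gcm_slope s n i"
proof -
  have "0 \<le> gcm_node s n 1" using line_le_gcm_node[of n 1 0 0 s] assms by simp
  then have "0 \<le> gcm_slope s n 1" using gcm_node_0[of n s] assms by (simp add: gcm_slope_def)
  then show ?thesis using gcm_slope_mono[of n 1 i s] assms by simp
qed

section \<open>The maximum likelihood estimator as a step function\<close>

definition obs_count :: "(nat \<Rightarrow> real) \<Rightarrow> nat \<Rightarrow> real \<Rightarrow> nat" where
  "obs_count ts n x = card {j. j < n \<and> ts j \<le> x}"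

text \<open>Positions count from 0, whereas \<^const>\<open>ordered_indicator\<close> counts from 1.\<close>

definition sorted_index :: "(nat \<Rightarrow> real) \<Rightarrow> nat \<Rightarrow> nat \<Rightarrow> nat" where
  "sorted_index ts n l = sort_key ts [0..<n] ! l"

definition status_sum :: "(nat \<Rightarrow> real) \<Rightarrow> (nat \<Rightarrow> real) \<Rightarrow> nat \<Rightarrow> nat \<Rightarrow> real" where
  "status_sum ts ds n i = (\<Sum>l<i. ds (sorted_index ts n l))"

lemma cusum_points_eq_cusum: "cusum_points ts ds n = cusum (status_sum ts ds n) n"
proof -
  have "(\<Sum>j = 1..i. ordered_indicator ts ds n j) = status_sum ts ds n i" for i
    unfolding status_sum_def ordered_indicator_def sorted_index_def
    by (rule sum.reindex_bij_witness[of _ Suc "\<lambda>j. j - 1"]) auto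
  then show ?thesis by (simp add: cusum_points_def cusum_def)
qed

lemma obs_count_le: "obs_count ts n x \<le> n"
  unfolding obs_count_def using card_mono[of "{..<n}" "{j. j < n \<and> ts j \<le> x}"] by auto

lemma obs_count_mono: "x \<le> y \<Longrightarrow> obs_count ts n x \<le> obs_count ts n y"
  unfolding obs_count_def by (intro card_mono) auto

text \<open>From here on the estimator is treated as a function of the number of observations up to \<open>x\<close>;
  suprema over convex functions and left derivatives do not occur again.\<close>

lemma npmle_eq_gcm_slope:
  "npmle ts ds n x = (if obs_count ts n x = 0 then 0 else gcm_slope (status_sum ts ds n) n (obs_count ts n x))"
proof -
  have npmle: "npmle ts ds n x = (if obs_count ts n x = 0 then 0
      else left_derivative (gcm (status_sum ts ds n) n) (real (obs_count ts n x) / n))"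
    unfolding npmle_def Let_def cusum_points_eq_cusum obs_count_def ..
  show ?thesis
  proof (cases "obs_count ts n x = 0")
    case False
    then have "0 < n" "1 \<le> obs_count ts n x" using obs_count_le[of ts n x] by auto
    from False gcm_left_derivative[OF this obs_count_le] show ?thesis unfolding npmle by simp
  qed (simp add: npmle)
qed

lemma sorted_index_bij: "bij_betw (sorted_index ts n) {..<n} {..<n}"
proof -
  have "bij_betw (\<lambda>l. sort_key ts [0..<n] ! l) {..<length (sort_key ts [0..<n])} (set (sort_key ts [0..<n]))"
    by (rule bij_betw_nth) (auto simp: distinct_sort)
  moreover have "set (sort_key ts [0..<n]) = {..<n}" "length (sort_key ts [0..<n]) = n" by auto
  ultimately show ?thesis unfolding sorted_index_def[abs_def] by simp
qed

lemma sorted_index_less: "l < n \<Longrightarrow> sorted_index ts n l < n"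
  using bij_betwE[OF sorted_index_bij[of ts n]] by auto

lemma sum_sorted_index: "(\<Sum>l<n. f (sorted_index ts n l)) = (\<Sum>i<n. f i)"
  using sum.reindex_bij_betw[OF sorted_index_bij] .

lemma sorted_times_mono:
  assumes "l \<le> l'" "l' < n"
  shows "ts (sorted_index ts n l) \<le> ts (sorted_index ts n l')"
  using sorted_nth_mono[OF sorted_sort_key[of ts "[0..<n]"], of l l'] assms
  by (simp add: sorted_index_def)

lemma sorted_times_strict_mono:
  assumes "l < l'" "l' < n" "inj_on ts {..<n}"
  shows "ts (sorted_index ts n l) < ts (sorted_index ts n l')"
proof -
  have "sorted_index ts n l \<noteq> sorted_index ts n l'"
    using inj_on_eq_iff[OF bij_betw_imp_inj_on[OF sorted_index_bij[of ts n]], of l l'] assms by auto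
  then have "ts (sorted_index ts n l) \<noteq> ts (sorted_index ts n l')"
    using inj_on_eq_iff[OF assms(3), of "sorted_index ts n l" "sorted_index ts n l'"] assms
      sorted_index_less[of l n ts] sorted_index_less[of l' n ts] by auto
  then show ?thesis using sorted_times_mono[of l l' n ts] assms by simp
qed

text \<open>The positions with observation time at most \<open>x\<close> form an initial segment, so counting them and
  comparing positions are the same thing.\<close>

lemma less_obs_count_iff:
  assumes "l < n"
  shows "l < obs_count ts n x \<longleftrightarrow> ts (sorted_index ts n l) \<le> x"
proof -
  let ?A = "{l. l < n \<and> ts (sorted_index ts n l) \<le> x}"
  have "bij_betw (sorted_index ts n) ?A {j. j < n \<and> ts j \<le> x}"
  proof (rule bij_betw_imageI)
    show "inj_on (sorted_index ts n) ?A"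
      by (rule inj_on_subset[OF bij_betw_imp_inj_on[OF sorted_index_bij[of ts n]]]) auto
    show "sorted_index ts n ` ?A = {j. j < n \<and> ts j \<le> x}"
    proof (intro equalityI subsetI)
      fix j assume "j \<in> {j. j < n \<and> ts j \<le> x}"
      moreover from this obtain l where "l < n" "j = sorted_index ts n l"
        using bij_betw_imp_surj_on[OF sorted_index_bij[of ts n]] by blast
      ultimately show "j \<in> sorted_index ts n ` ?A" by blast
    qed (use sorted_index_less in auto)
  qed
  then have c: "obs_count ts n x = card ?A" unfolding obs_count_def by (simp add: bij_betw_same_card)
  show ?thesis
  proof
    assume le: "ts (sorted_index ts n l) \<le> x"
    have "{..l} \<subseteq> ?A"
    proof
      fix m assume "m \<in> {..l}"
      then show "m \<in> ?A" using assms le sorted_times_mono[of m l n ts] by auto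
    qed
    from card_mono[OF _ this] show "l < obs_count ts n x" using c by simp
  next
    assume lt: "l < obs_count ts n x"
    show "ts (sorted_index ts n l) \<le> x"
    proof (rule ccontr)
      assume gt: "\<not> ?thesis"
      have "?A \<subseteq> {..<l}"
      proof
        fix m assume m: "m \<in> ?A"
        show "m \<in> {..<l}" using sorted_times_mono[of l m n ts] m gt by (cases "l \<le> m") auto
      qed
      from card_mono[OF _ this] lt c show False by simp
    qed
  qed
qed

lemma obs_count_sorted:
  assumes "inj_on ts {..<n}" "l < n"
  shows "obs_count ts n (ts (sorted_index ts n l)) = Suc l"
proof (rule antisym)
  show "Suc l \<le> obs_count ts n (ts (sorted_index ts n l))"
    using less_obs_count_iff[OF assms(2), of ts "ts (sorted_index ts n l)"] by simp
  show "obs_count ts n (ts (sorted_index ts n l)) \<le> Suc l"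
  proof (rule ccontr)
    assume "\<not> ?thesis"
    then have "Suc l < obs_count ts n (ts (sorted_index ts n l))" by simp
    moreover from this have "Suc l < n" by (rule less_le_trans[OF _ obs_count_le])
    ultimately show False
      using less_obs_count_iff[of "Suc l" n ts "ts (sorted_index ts n l)"]
        sorted_times_strict_mono[of l "Suc l" n ts] assms by simp
  qed
qed

lemma obs_count_at_right: "\<forall>\<^sub>F y in at_right x. obs_count ts n y = obs_count ts n x"
proof -
  have "\<forall>\<^sub>F y in at_right x. \<forall>j\<in>{..<n}. x < ts j \<longrightarrow> y < ts j"
  proof (rule eventually_ball_finite)
    show "\<forall>j\<in>{..<n}. \<forall>\<^sub>F y in at_right x. x < ts j \<longrightarrow> y < ts j"
    proof
      fix j
      show "\<forall>\<^sub>F y in at_right x. x < ts j \<longrightarrow> y < ts j"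
      proof (cases "x < ts j")
        case True
        show ?thesis using eventually_at_right_real[OF True] by eventually_elim auto
      qed simp
    qed
  qed simp
  moreover have "\<forall>\<^sub>F y in at_right x. x < y" by (rule eventually_at_right_less)
  ultimately show ?thesis
  proof eventually_elim
    case (elim y)
    have "ts j \<le> y \<longleftrightarrow> ts j \<le> x" if "j < n" for j
      using elim that by (cases "x < ts j") auto
    then have "{j. j < n \<and> ts j \<le> y} = {j. j < n \<and> ts j \<le> x}" by blast
    then show ?case by (simp add: obs_count_def)
  qed
qed

lemma obs_count_at_bot: "\<forall>\<^sub>F y in at_bot. obs_count ts n y = 0"
proof -
  have "\<forall>\<^sub>F y in at_bot. \<forall>j\<in>{..<n}. y < ts j"
    using eventually_gt_at_bot by (intro eventually_ball_finite) blast+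
  then show ?thesis
  proof eventually_elim
    case (elim y)
    then have "{j. j < n \<and> ts j \<le> y} = {}" by force
    then show ?case unfolding obs_count_def by simp
  qed
qed

lemma status_sum_nonneg: "(\<And>i. 0 \<le> ds i) \<Longrightarrow> 0 \<le> status_sum ts ds n i"
  by (simp add: status_sum_def sum_nonneg)

lemma status_sum_0 [simp]: "status_sum ts ds n 0 = 0"
  by (simp add: status_sum_def)

lemma npmle_mono:
  assumes "\<And>i. 0 \<le> ds i" "x \<le> y"
  shows "npmle ts ds n x \<le> npmle ts ds n y"
proof (cases "obs_count ts n x = 0")
  case True
  show ?thesis
  proof (cases "obs_count ts n y = 0")
    case False
    then have "0 \<le> gcm_slope (status_sum ts ds n) n (obs_count ts n y)"
      using obs_count_le[of ts n y] by (intro gcm_slope_nonneg) (auto intro: status_sum_nonneg assms)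
    then show ?thesis using True by (simp add: npmle_eq_gcm_slope)
  qed (simp add: npmle_eq_gcm_slope True)
next
  case False
  then show ?thesis
    using obs_count_le[of ts n y] obs_count_mono[OF assms(2), of ts n]
    by (auto simp: npmle_eq_gcm_slope intro!: gcm_slope_mono)
qed

lemma npmle_right_cont: "continuous (at_right x) (npmle ts ds n)"
proof -
  have "\<forall>\<^sub>F y in at_right x. npmle ts ds n y = npmle ts ds n x"
    using obs_count_at_right[of ts n x] by eventually_elim (simp add: npmle_eq_gcm_slope)
  then show ?thesis
    unfolding continuous_within by (rule tendsto_eventually)
qed

lemma npmle_at_bot: "(npmle ts ds n \<longlongrightarrow> 0) at_bot"
  by (rule tendsto_eventually, rule eventually_mono[OF obs_count_at_bot[of ts n]])
     (simp add: npmle_eq_gcm_slope)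

lemma npmle_bounded: "\<exists>B. \<forall>x. npmle ts ds n x \<le> B"
proof -
  have "finite (range (npmle ts ds n))"
  proof (rule finite_subset)
    show "range (npmle ts ds n) \<subseteq> (\<lambda>i. if i = 0 then 0 else gcm_slope (status_sum ts ds n) n i) ` {..n}"
      using obs_count_le[of ts n] by (auto simp: npmle_eq_gcm_slope image_iff)
  qed simp
  then show ?thesis using Max_ge[of "range (npmle ts ds n)"] by blast
qed

section \<open>The cumulative sum diagram lies close to its minorant\<close>

text \<open>A fixed realisation on which the deviation bounds hold. The parameter \<open>lam\<close> is the noise
  level of the cumulative sums, \<open>e\<close> the uniform distance of the empirical and the true distribution of
  the times, \<open>\<kappa>\<close> a lower bound for the increase of \<open>F0\<close> relative to \<open>G\<close>,
  and \<open>m0\<close> a number of observations beyond which the convexity gap exceeds the noise. The three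
  conditions on \<open>m0\<close> say exactly this (see \<open>noise_le_gap\<close>).\<close>

locale current_status_sample =
  fixes ts ds :: "nat \<Rightarrow> real" and n :: nat and F0 G :: "real \<Rightarrow> real" and M0 lam e \<kappa> m0 :: real
  assumes n_pos: "0 < n" and distinct: "inj_on ts {..<n}" and ds_nonneg: "\<And>i. 0 \<le> ds i"
    and windows: "\<And>a b. a \<le> b \<Longrightarrow> b \<le> n \<Longrightarrow>
      \<bar>\<Sum>l = a..<b. (ds (sorted_index ts n l) - F0 (ts (sorted_index ts n l)))\<bar> \<le> lam * sqrt (real (b - a))"
    and empirical: "\<And>x. 0 \<le> x \<Longrightarrow> x \<le> M0 \<Longrightarrow> \<bar>real (obs_count ts n x) / n - G x\<bar> \<le> e"
    and F0_mono: "\<And>x y. x \<le> y \<Longrightarrow> F0 x \<le> F0 y"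
    and F0_left: "\<And>x. x < 0 \<Longrightarrow> F0 x = 0" and F0_right: "\<And>x. M0 < x \<Longrightarrow> F0 x = 1"
    and slope: "\<And>x y. 0 \<le> x \<Longrightarrow> x \<le> y \<Longrightarrow> y \<le> M0 \<Longrightarrow> \<kappa> * (G y - G x) \<le> F0 y - F0 x"
    and \<kappa>_pos: "0 < \<kappa>" and lam_nonneg: "0 \<le> lam" and e_nonneg: "0 \<le> e"
    and m0_ge: "2 \<le> m0" "16 * real n * e \<le> m0" "8 * real n * lam \<le> \<kappa> * m0 * sqrt m0"
begin

abbreviation "x l \<equiv> ts (sorted_index ts n l)"
abbreviation "d l \<equiv> ds (sorted_index ts n l)"
abbreviation "N \<equiv> obs_count ts n"
abbreviation "s \<equiv> status_sum ts ds n"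
abbreviation "C \<equiv> gcm_node s n"

definition \<eta> where "\<eta> = lam * sqrt m0"

lemma \<eta>_nonneg: "0 \<le> \<eta>"
  using lam_nonneg m0_ge by (simp add: \<eta>_def)

lemma status_sum_diff:
  assumes "a \<le> b"
  shows "s b - s a = (\<Sum>l = a..<b. d l)"
proof -
  have "(\<Sum>l<b. d l) = (\<Sum>l<a. d l) + (\<Sum>l = a..<b. d l)"
    using sum.atLeastLessThan_concat[of 0 a b d] assms by (simp add: atLeast0LessThan)
  then show ?thesis by (simp add: status_sum_def)
qed

lemma sum_linear_gap: "(\<Sum>q<m. \<kappa> * (real q / n - 2 * e)) = \<kappa> * (real m * (real m - 1) / (2 * n) - 2 * e * m)"
proof (induction m)
  case (Suc m)
  have "real (Suc m) * (real (Suc m) - 1) / (2 * n) = real m * (real m - 1) / (2 * n) + real m / n"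
    using n_pos by (simp add: field_simps)
  then show ?case using Suc by (simp add: ring_distribs)
qed simp

text \<open>The right-hand side is the convexity gap accumulated over \<open>m\<close> observations
  (\<open>sum_linear_gap\<close>). The first two conditions on \<open>m0\<close> reduce it to \<open>\<kappa>
  m\<^sup>2/(8n)\<close>, and the third compares this with the noise.\<close>

lemma noise_le_gap:
  assumes "m0 < real m"
  shows "lam * sqrt m \<le> \<kappa> * (real m * (real m - 1) / (2 * n) - 2 * e * m)"
proof -
  have m: "0 < real m" "2 \<le> real m" using m0_ge assms by auto
  have "8 * real n * lam \<le> \<kappa> * m0 * sqrt m0" by (rule m0_ge)
  also have "\<dots> \<le> \<kappa> * real m * sqrt m" using assms \<kappa>_pos m0_ge by (intro mult_mono) auto
  finally have "8 * real n * lam * sqrt m \<le> \<kappa> * real m * sqrt m * sqrt m" by (rule mult_right_mono) simp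
  then have 1: "lam * sqrt m \<le> \<kappa> * (real m * real m) / (8 * real n)" using n_pos by (simp add: field_simps)
  have "16 * real n * e * real m \<le> real m * real m" using assms m0_ge m by (intro mult_right_mono) auto
  then have 2: "2 * e * real m \<le> real m * real m / (8 * real n)" using n_pos by (simp add: field_simps)
  have "real m * real m / 2 \<le> real m * (real m - 1)"
  proof -
    have "real m * (real m / 2) \<le> real m * (real m - 1)" using m by (intro mult_left_mono) auto
    then show ?thesis by simp
  qed
  then have "(real m * real m / 2) / (2 * n) \<le> real m * (real m - 1) / (2 * n)" by (rule divide_right_mono) simp
  with 2 have "real m * real m / (8 * real n) \<le> real m * (real m - 1) / (2 * n) - 2 * e * m" using n_pos by (simp add: field_simps)
  then have "\<kappa> * (real m * real m / (8 * real n)) \<le> \<kappa> * (real m * (real m - 1) / (2 * n) - 2 * e * m)"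
    using \<kappa>_pos by (intro mult_left_mono) auto
  with 1 show ?thesis by simp
qed

lemma gap_minus_noise:
  assumes "\<kappa> * (real m * (real m - 1) / (2 * n) - 2 * e * m) \<le> g" "0 \<le> g"
  shows "- \<eta> \<le> g - lam * sqrt (real m)"
proof (cases "real m \<le> m0")
  case True
  then have "lam * sqrt m \<le> \<eta>" using lam_nonneg unfolding \<eta>_def by (intro mult_left_mono) auto
  then show ?thesis using assms by linarith
next
  case False
  then show ?thesis using noise_le_gap[of m] assms \<eta>_nonneg by linarith
qed

text \<open>Moving away from position \<open>N u\<close>, every further observation contributes at least
  \<open>\<kappa> q/n - 2 \<kappa> e\<close> to the convexity gap of the mean of the diagram, while the noise over
  \<open>m\<close> observations is at most \<open>lam \<surd>m\<close>. Beyond the time range \<open>[0, M0]\<close>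
  the increase of \<open>G\<close> is not controlled, but there \<open>F0\<close> is 0 or 1 and differs from \<open>F0
  u\<close> by at least \<open>\<kappa>\<close>.\<close>

lemma cusum_above_line:
  assumes u: "0 \<le> u" "u \<le> M0" "\<kappa> \<le> F0 u" "F0 u \<le> 1 - \<kappa>" and j: "j \<le> n"
  shows "s (N u) - \<eta> + F0 u * (real j - real (N u)) \<le> s j"
proof (cases "N u \<le> j")
  case True
  define m where "m = j - N u"
  have gap: "max 0 (\<kappa> * (real q / n - 2 * e)) \<le> F0 (x (N u + q)) - F0 u" if q: "q < m" for q
  proof -
    let ?l = "N u + q"
    have l: "?l < n" using q j True by (simp add: m_def)
    have xu: "u < x ?l" using less_obs_count_iff[OF l, of ts u] by simp
    then have pos: "0 \<le> F0 (x ?l) - F0 u" using F0_mono[of u "x ?l"] by simp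
    have "\<kappa> * (real q / n - 2 * e) \<le> F0 (x ?l) - F0 u"
    proof (cases "x ?l \<le> M0")
      case True
      have "real (Suc ?l) / n - G (x ?l) \<le> e" "- e \<le> real (N u) / n - G u"
        using empirical[of "x ?l"] empirical[of u] obs_count_sorted[OF distinct l] u xu True
        by (auto simp: abs_le_iff)
      then have "real (Suc ?l) / n - real (N u) / n - 2 * e \<le> G (x ?l) - G u" by simp
      moreover have "real q / n \<le> real (Suc ?l) / n - real (N u) / n"
        using n_pos by (simp add: field_simps)
      ultimately have "\<kappa> * (real q / n - 2 * e) \<le> \<kappa> * (G (x ?l) - G u)"
        using \<kappa>_pos by (intro mult_left_mono) auto
      also have "\<dots> \<le> F0 (x ?l) - F0 u" using slope[of u "x ?l"] u xu True by simp
      finally show ?thesis .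
    next
      case False
      have "real q / n \<le> 1" using l n_pos by (simp add: field_simps)
      then have "real q / n - 2 * e \<le> 1" using e_nonneg by linarith
      then have "\<kappa> * (real q / n - 2 * e) \<le> \<kappa> * 1" using \<kappa>_pos by (intro mult_left_mono) auto
      then show ?thesis using F0_right[of "x ?l"] False u by simp
    qed
    with pos show ?thesis by simp
  qed
  define g where "g = (\<Sum>q<m. F0 (x (N u + q)) - F0 u)"
  have "(\<Sum>q<m. \<kappa> * (real q / n - 2 * e)) \<le> g" "0 \<le> g" unfolding g_def
    using gap by (auto intro!: sum_mono sum_nonneg)
  then have g: "- \<eta> \<le> g - lam * sqrt (real m)" by (intro gap_minus_noise) (simp_all add: sum_linear_gap)
  have sh: "(\<Sum>l = N u..<j. f l) = (\<Sum>q<m. f (N u + q))" for f :: "nat \<Rightarrow> real"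
    using sum.shift_bounds_nat_ivl[of f 0 "N u" m] True by (simp add: m_def atLeast0LessThan add.commute)
  have "s j - s (N u) = (\<Sum>l = N u..<j. d l - F0 (x l)) + (\<Sum>l = N u..<j. F0 (x l))"
    using status_sum_diff[OF True] by (simp add: sum_subtractf)
  moreover have "- (lam * sqrt (real m)) \<le> (\<Sum>l = N u..<j. d l - F0 (x l))"
    using windows[OF True j] by (simp add: m_def)
  moreover have "(\<Sum>l = N u..<j. F0 (x l)) = g + F0 u * real m"
    unfolding sh g_def by (simp add: sum_subtractf)
  ultimately have "- \<eta> + F0 u * real m \<le> s j - s (N u)" using g by simp
  then show ?thesis using True by (simp add: m_def of_nat_diff)
next
  case False
  define m where "m = N u - j"
  have Nn: "N u \<le> n" by (rule obs_count_le)
  have gap: "max 0 (\<kappa> * (real q / n - 2 * e)) \<le> F0 u - F0 (x (N u - Suc q))" if q: "q < m" for q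
  proof -
    let ?l = "N u - Suc q"
    have l: "?l < n" "?l < N u" using q Nn False by (simp_all add: m_def)
    have Suc_l: "real (Suc ?l) = real (N u) - real q" using q by (simp add: m_def of_nat_diff)
    have xu: "x ?l \<le> u" using less_obs_count_iff[OF l(1), of ts u] l by simp
    then have pos: "0 \<le> F0 u - F0 (x ?l)" using F0_mono by simp
    have "\<kappa> * (real q / n - 2 * e) \<le> F0 u - F0 (x ?l)"
    proof (cases "0 \<le> x ?l")
      case True
      have "- e \<le> real (Suc ?l) / n - G (x ?l)" "real (N u) / n - G u \<le> e"
        using empirical[of "x ?l"] empirical[of u] obs_count_sorted[OF distinct l(1)] u xu True
        by (auto simp: abs_le_iff)
      then have "real (N u) / n - real (Suc ?l) / n - 2 * e \<le> G u - G (x ?l)" by simp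
      moreover have "real q / n = real (N u) / n - real (Suc ?l) / n"
        unfolding Suc_l by (simp add: diff_divide_distrib)
      ultimately have "\<kappa> * (real q / n - 2 * e) \<le> \<kappa> * (G u - G (x ?l))"
        using \<kappa>_pos by (intro mult_left_mono) auto
      also have "\<dots> \<le> F0 u - F0 (x ?l)" using slope[of "x ?l" u] u xu True by simp
      finally show ?thesis .
    next
      case False
      have "real q \<le> real n" using q Nn by (simp add: m_def)
      then have "real q / n \<le> 1" using n_pos by (simp add: field_simps)
      then have "real q / n - 2 * e \<le> 1" using e_nonneg by linarith
      then have "\<kappa> * (real q / n - 2 * e) \<le> \<kappa> * 1" using \<kappa>_pos by (intro mult_left_mono) auto
      then show ?thesis using F0_left[of "x ?l"] False u by simp
    qed
    with pos show ?thesis by simp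
  qed
  define g where "g = (\<Sum>q<m. F0 u - F0 (x (N u - Suc q)))"
  have "(\<Sum>q<m. \<kappa> * (real q / n - 2 * e)) \<le> g" "0 \<le> g" unfolding g_def
    using gap by (auto intro!: sum_mono sum_nonneg)
  then have g: "- \<eta> \<le> g - lam * sqrt (real m)" by (intro gap_minus_noise) (simp_all add: sum_linear_gap)
  have sh: "(\<Sum>l = j..<N u. f l) = (\<Sum>q<m. f (N u - Suc q))" for f :: "nat \<Rightarrow> real"
    by (rule sum.reindex_bij_witness[of _ "\<lambda>q. N u - Suc q" "\<lambda>l. N u - Suc l"]) (auto simp: m_def)
  have le: "j \<le> N u" using False by simp
  have "s (N u) - s j = (\<Sum>l = j..<N u. d l - F0 (x l)) + (\<Sum>l = j..<N u. F0 (x l))"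
    using status_sum_diff[OF le] by (simp add: sum_subtractf)
  moreover have "(\<Sum>l = j..<N u. d l - F0 (x l)) \<le> lam * sqrt (real m)"
    using windows[OF le Nn] by (simp add: m_def)
  moreover have "(\<Sum>l = j..<N u. F0 (x l)) = F0 u * real m - g"
    unfolding sh g_def by (simp add: sum_subtractf)
  ultimately have "s (N u) - s j \<le> F0 u * real m + \<eta>" using g by simp
  then show ?thesis using le by (simp add: m_def of_nat_diff algebra_simps)
qed

text \<open>The line of \<open>cusum_above_line\<close> is an affine minorant, so the greatest convex minorant is
  above it at its own base point.\<close>

lemma gcm_node_close:
  assumes u: "0 \<le> u" "u \<le> M0" "\<kappa> \<le> F0 u" "F0 u \<le> 1 - \<kappa>"
  shows "s (N u) - \<eta> \<le> C (N u)" "C (N u) \<le> s (N u)"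
proof -
  have "s (N u) - \<eta> - F0 u * N u + F0 u * real (N u) \<le> C (N u)"
    using cusum_above_line[OF u] by (intro line_le_gcm_node n_pos obs_count_le) (simp add: algebra_simps)
  then show "s (N u) - \<eta> \<le> C (N u)" by simp
  show "C (N u) \<le> s (N u)" by (rule gcm_node_le[OF n_pos obs_count_le])
qed

text \<open>A slope of the minorant is at most any later average slope. Over the observations between \<open>u\<close>
  and \<open>w\<close>, of which there are at least \<open>b\<close>, that average is at most \<open>F0 w\<close> plus
  the noise and the distance to the diagram.\<close>

lemma npmle_le_at:
  assumes u: "0 \<le> u" "u \<le> M0" "\<kappa> \<le> F0 u" "F0 u \<le> 1 - \<kappa>"
    and w: "u \<le> w" "w \<le> M0" and b: "0 < b" "b \<le> n * (G w - G u - 2 * e)"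
  shows "npmle ts ds n u \<le> F0 w + lam / sqrt b + \<eta> / b"
proof (cases "N u = 0")
  case True
  have "0 \<le> F0 w" using F0_mono[of "-1" w] F0_left[of "-1"] u w by simp
  then show ?thesis using True b \<eta>_nonneg lam_nonneg by (simp add: npmle_eq_gcm_slope)
next
  case False
  define m where "m = N w - N u"
  have NN: "N u \<le> N w" by (rule obs_count_mono[OF w(1)])
  have "G w - e \<le> real (N w) / n" "real (N u) / n \<le> G u + e"
    using empirical[of u] empirical[of w] u w by (auto simp: abs_le_iff)
  then have "G w - G u - 2 * e \<le> (real (N w) - real (N u)) / n" by (simp add: diff_divide_distrib)
  then have bm: "b \<le> real m" using b n_pos NN by (simp add: m_def field_simps of_nat_diff)
  then have m: "0 < real m" using b by simp
  have "real m * gcm_slope s n (N u) \<le> C (N w) - C (N u)"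
    unfolding m_def using False NN by (intro gcm_slope_le_right_chord n_pos obs_count_le) auto
  also have "\<dots> \<le> s (N w) - s (N u) + \<eta>"
    using gcm_node_close(1)[OF u] gcm_node_le[OF n_pos obs_count_le, of s ts w] by linarith
  also have "\<dots> = (\<Sum>l = N u..<N w. d l - F0 (x l)) + (\<Sum>l = N u..<N w. F0 (x l)) + \<eta>"
    using status_sum_diff[OF NN] by (simp add: sum_subtractf)
  also have "\<dots> \<le> lam * sqrt m + (\<Sum>l = N u..<N w. F0 w) + \<eta>"
  proof (intro add_mono sum_mono order_refl)
    show "(\<Sum>l = N u..<N w. d l - F0 (x l)) \<le> lam * sqrt m"
      using windows[OF NN obs_count_le] by (simp add: m_def)
    fix l assume "l \<in> {N u..<N w}"
    then have "l < n" "x l \<le> w" using less_obs_count_iff[of l n ts w] obs_count_le[of ts n w] by auto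
    then show "F0 (x l) \<le> F0 w" by (intro F0_mono)
  qed
  also have "\<dots> = lam * sqrt m + m * F0 w + \<eta>" by (simp add: m_def)
  finally have "gcm_slope s n (N u) \<le> (lam * sqrt m + m * F0 w + \<eta>) / m"
    using m by (simp add: field_simps)
  also have "\<dots> = lam / sqrt m + F0 w + \<eta> / m"
  proof -
    have "lam * sqrt m / m = lam / sqrt m" using m by (simp add: real_div_sqrt field_simps)
    then show ?thesis using m by (simp add: add_divide_distrib)
  qed
  also have "\<dots> \<le> lam / sqrt b + F0 w + \<eta> / b"
    using bm b lam_nonneg \<eta>_nonneg by (intro add_mono divide_left_mono) auto
  finally show ?thesis using False by (simp add: npmle_eq_gcm_slope)
qed

lemma npmle_ge_at:
  assumes u: "0 \<le> u" "u \<le> M0" "\<kappa> \<le> F0 u" "F0 u \<le> 1 - \<kappa>"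
    and w: "w \<le> u" "0 \<le> w" and b: "0 < b" "b \<le> n * (G u - G w - 2 * e)"
  shows "F0 w - lam / sqrt b - \<eta> / b \<le> npmle ts ds n u"
proof -
  define m where "m = N u - N w"
  have NN: "N w \<le> N u" by (rule obs_count_mono[OF w(1)])
  have "G u - e \<le> real (N u) / n" "real (N w) / n \<le> G w + e"
    using empirical[of u] empirical[of w] u w by (auto simp: abs_le_iff)
  then have "G u - G w - 2 * e \<le> (real (N u) - real (N w)) / n" by (simp add: diff_divide_distrib)
  then have bm: "b \<le> real m" using b n_pos NN by (simp add: m_def field_simps of_nat_diff)
  then have m: "0 < real m" using b by simp
  then have Nu: "1 \<le> N u" by (simp add: m_def)
  have "m * F0 w - lam * sqrt m - \<eta> = (\<Sum>l = N w..<N u. F0 w) + - (lam * sqrt m) - \<eta>"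
    by (simp add: m_def)
  also have "\<dots> \<le> (\<Sum>l = N w..<N u. F0 (x l)) + (\<Sum>l = N w..<N u. d l - F0 (x l)) - \<eta>"
  proof (intro add_mono diff_mono sum_mono order_refl)
    show "- (lam * sqrt m) \<le> (\<Sum>l = N w..<N u. d l - F0 (x l))"
      using windows[OF NN obs_count_le] by (simp add: m_def)
    fix l assume l: "l \<in> {N w..<N u}"
    then have "l < n" using obs_count_le[of ts n u] by auto
    then have "w < x l" using l less_obs_count_iff[of l n ts w] by auto
    then show "F0 w \<le> F0 (x l)" by (intro F0_mono) simp
  qed
  also have "\<dots> = s (N u) - s (N w) - \<eta>"
    using status_sum_diff[OF NN] by (simp add: sum_subtractf)
  also have "\<dots> \<le> C (N u) - C (N w)"
    using gcm_node_close(1)[OF u] gcm_node_le[OF n_pos obs_count_le, of s ts w] by linarith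
  also have "\<dots> \<le> real m * gcm_slope s n (N u)"
    unfolding m_def using Nu NN by (intro gcm_slope_ge_left_chord n_pos obs_count_le) auto
  finally have "(m * F0 w - lam * sqrt m - \<eta>) / m \<le> gcm_slope s n (N u)"
    using m by (simp add: field_simps)
  moreover have "(m * F0 w - lam * sqrt m - \<eta>) / m = F0 w - lam / sqrt m - \<eta> / m"
  proof -
    have "lam * sqrt m / m = lam / sqrt m" using m by (simp add: real_div_sqrt field_simps)
    then show ?thesis using m by (simp add: diff_divide_distrib)
  qed
  moreover have "lam / sqrt m \<le> lam / sqrt b" "\<eta> / m \<le> \<eta> / b"
    using bm b lam_nonneg \<eta>_nonneg by (auto intro!: divide_left_mono)
  ultimately show ?thesis using Nu by (simp add: npmle_eq_gcm_slope)
qed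

text \<open>Both sums are Stieltjes sums of \<open>\<phi>\<close>, one against the minorant \<open>C\<close> and one
  against the diagram \<open>s\<close>. After summation by parts only the values of \<open>C - s\<close> at positions
  next to an observation in the window matter, and there it is at most \<open>\<eta>\<close>.\<close>

lemma minorant_summation_by_parts:
  fixes \<phi> :: "real \<Rightarrow> real"
  assumes pr: "0 \<le> p" "p \<le> r" "r \<le> M0" "\<kappa> \<le> F0 p" "F0 r \<le> 1 - \<kappa>"
    and \<phi>_out: "\<And>u. u \<notin> {p<..<r} \<Longrightarrow> \<phi> u = 0" and \<phi>_bd: "\<And>u. \<bar>\<phi> u\<bar> \<le> B"
    and \<phi>_lip: "\<And>u w. p \<le> u \<Longrightarrow> u \<le> w \<Longrightarrow> w \<le> r \<Longrightarrow> \<bar>\<phi> w - \<phi> u\<bar> \<le> L * (w - u)" and L: "0 \<le> L"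
  shows "\<bar>(\<Sum>i<n. \<phi> (ts i) * npmle ts ds n (ts i)) - (\<Sum>i<n. \<phi> (ts i) * ds i)\<bar> \<le> \<eta> * (B + L * (r - p))"
proof -
  define w where "w l = C l - s l" for l
  \<comment> \<open>\<open>\<phi>\<close> is unchanged by projecting its argument to the window, and the projected times telescope\<close>
  define c where "c u = max p (min r u)" for u
  have \<phi>c: "\<phi> (c u) = \<phi> u" for u
    using \<phi>_out[of u] \<phi>_out[of p] \<phi>_out[of r] pr by (auto simp: c_def max_def min_def)
  have c_mono: "c u \<le> c v" if "u \<le> v" for u v using that by (auto simp: c_def)
  have c_in: "p \<le> c u" "c u \<le> r" for u using pr by (auto simp: c_def)
  have w_small: "\<bar>w (N u)\<bar> \<le> \<eta>" if "p \<le> u" "u \<le> r" for u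
    using gcm_node_close[of u] that pr F0_mono[of p u] F0_mono[of u r] \<eta>_nonneg by (simp add: w_def)
  have w0: "w 0 = 0" using gcm_node_0[of n s] n_pos by (simp add: w_def status_sum_nonneg ds_nonneg)
  have "(\<Sum>i<n. \<phi> (ts i) * npmle ts ds n (ts i)) - (\<Sum>i<n. \<phi> (ts i) * ds i)
      = (\<Sum>i<n. \<phi> (ts i) * (npmle ts ds n (ts i) - ds i))"
    by (simp add: sum_subtractf right_diff_distrib)
  also have "\<dots> = (\<Sum>l<n. \<phi> (x l) * (npmle ts ds n (x l) - d l))"
    by (rule sum_sorted_index[symmetric])
  also have "\<dots> = (\<Sum>l<n. \<phi> (x l) * (w (Suc l) - w l))"
  proof (rule sum.cong[OF refl])
    fix l assume "l \<in> {..<n}"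
    then have "npmle ts ds n (x l) = C (Suc l) - C l"
      using obs_count_sorted[OF distinct, of l] by (simp add: npmle_eq_gcm_slope gcm_slope_def)
    then show "\<phi> (x l) * (npmle ts ds n (x l) - d l) = \<phi> (x l) * (w (Suc l) - w l)"
      by (simp add: w_def status_sum_def)
  qed
  also have "\<dots> = \<phi> (x (n - 1)) * w n - (\<Sum>l<n - 1. w (Suc l) * (\<phi> (x (Suc l)) - \<phi> (x l)))"
  proof -
    have "(\<Sum>l<Suc m. f l * (w (Suc l) - w l)) = f m * w (Suc m) - (\<Sum>l<m. w (Suc l) * (f (Suc l) - f l))"
      for m and f :: "nat \<Rightarrow> real"
      by (induction m) (simp_all add: w0 algebra_simps)
    from this[of "\<lambda>l. \<phi> (x l)" "n - 1"] show ?thesis using n_pos by simp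
  qed
  finally have eq: "(\<Sum>i<n. \<phi> (ts i) * npmle ts ds n (ts i)) - (\<Sum>i<n. \<phi> (ts i) * ds i) =
      \<phi> (x (n - 1)) * w n - (\<Sum>l<n - 1. w (Suc l) * (\<phi> (x (Suc l)) - \<phi> (x l)))" .
  have last: "\<bar>\<phi> (x (n - 1)) * w n\<bar> \<le> B * \<eta>"
  proof (cases "x (n - 1) \<in> {p<..<r}")
    case True
    have "N (x (n - 1)) = n" using obs_count_sorted[OF distinct, of "n - 1"] n_pos by simp
    then have "\<bar>w n\<bar> \<le> \<eta>" using w_small[of "x (n - 1)"] True by simp
    then show ?thesis using \<phi>_bd[of "x (n - 1)"] unfolding abs_mult by (intro mult_mono) auto
  next
    case False
    have "0 \<le> B" using \<phi>_bd[of 0] by linarith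
    then show ?thesis using \<phi>_out[OF False] \<eta>_nonneg by simp
  qed
  have "\<bar>w (Suc l) * (\<phi> (x (Suc l)) - \<phi> (x l))\<bar> \<le> \<eta> * L * (c (x (Suc l)) - c (x l))" if l: "l < n - 1" for l
  proof (cases "c (x l) = c (x (Suc l))")
    case True
    then have "\<phi> (x l) = \<phi> (x (Suc l))" by (metis \<phi>c)
    then show ?thesis using True by simp
  next
    case False
    have lt: "x l < x (Suc l)" using sorted_times_strict_mono[OF _ _ distinct, of l "Suc l"] l by simp
    then have cc: "c (x l) < c (x (Suc l))" using False c_mono[of "x l" "x (Suc l)"] by simp
    \<comment> \<open>a jump of \<open>\<phi>\<close> between neighbouring observations exhibits a point of the window with exactly \<open>l + 1\<close> observations before it\<close>
    then have "x l \<le> c (x l)" "c (x l) < x (Suc l)"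
      using pr lt by (auto simp: c_def max_def min_def split: if_splits)
    moreover have "Suc l < n" using l by simp
    ultimately have "N (c (x l)) = Suc l"
      using less_obs_count_iff[of l n ts "c (x l)"] less_obs_count_iff[of "Suc l" n ts "c (x l)"] by auto
    then have "\<bar>w (Suc l)\<bar> \<le> \<eta>" using w_small[OF c_in, of "x l"] by simp
    moreover have "\<bar>\<phi> (x (Suc l)) - \<phi> (x l)\<bar> \<le> L * (c (x (Suc l)) - c (x l))"
      using \<phi>_lip[of "c (x l)" "c (x (Suc l))"] c_in cc by (simp add: \<phi>c)
    ultimately show ?thesis unfolding abs_mult mult.assoc by (intro mult_mono) (auto simp: \<eta>_nonneg)
  qed
  then have "\<bar>\<Sum>l<n - 1. w (Suc l) * (\<phi> (x (Suc l)) - \<phi> (x l))\<bar> \<le> (\<Sum>l<n - 1. \<eta> * L * (c (x (Suc l)) - c (x l)))"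
    by (intro order_trans[OF sum_abs] sum_mono) auto
  also have "\<dots> = \<eta> * L * (c (x (n - 1)) - c (x 0))"
    unfolding sum_distrib_left[symmetric] sum_lessThan_telescope[of "\<lambda>l. c (x l)" "n - 1"] ..
  also have "\<dots> \<le> \<eta> * L * (r - p)"
    using c_in(2)[of "x (n - 1)"] c_in(1)[of "x 0"] \<eta>_nonneg L by (intro mult_left_mono) auto
  finally show ?thesis using eq last by (simp add: algebra_simps)
qed

end

section \<open>Integrals of functions of bounded variation\<close>

text \<open>Fubini's theorem for the region below the graph of \<open>f\<close>.\<close>

lemma finite_measure_layer_cake:
  fixes f :: "real \<Rightarrow> real"
  assumes "finite_measure \<mu>" and "sets \<mu> = sets borel" and [measurable]: "f \<in> borel_measurable borel"
    and bd: "\<And>u. 0 \<le> f u" "\<And>u. f u \<le> V"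
  shows "(LINT u|\<mu>. f u) = (LINT s|lborel. indicator {0..V} s * measure \<mu> {u. s < f u})"
    and "integrable lborel (\<lambda>s. indicator {0..V} s * measure \<mu> {u. s < f u})"
proof -
  interpret finite_measure \<mu> by fact
  interpret pair_sigma_finite \<mu> lborel ..
  have [simp]: "space \<mu> = UNIV" using sets_eq_imp_space_eq[OF assms(2)] by simp
  have f\<mu>: "f \<in> borel_measurable \<mu>"
    using assms(3) unfolding measurable_cong_sets[OF assms(2) refl] .
  have UN: "UNIV \<in> sets \<mu>" and lev: "{u. s < f u} \<in> sets \<mu>" for s
    unfolding assms(2) by simp_all
  define A where "A = {z :: real \<times> real. 0 \<le> snd z \<and> snd z < f (fst z)}"
  have Am: "A \<in> sets (\<mu> \<Otimes>\<^sub>M lborel)"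
  proof -
    have "A = {z \<in> space (\<mu> \<Otimes>\<^sub>M lborel). 0 \<le> snd z \<and> snd z < f (fst z)}"
      by (auto simp: A_def space_pair_measure)
    also have "\<dots> \<in> sets (\<mu> \<Otimes>\<^sub>M lborel)" using f\<mu> by measurable
    finally show ?thesis .
  qed
  have "emeasure (\<mu> \<Otimes>\<^sub>M lborel) A \<le> emeasure (\<mu> \<Otimes>\<^sub>M lborel) (UNIV \<times> {0..V})"
  proof (intro emeasure_mono subsetI)
    fix z assume "z \<in> A"
    then show "z \<in> UNIV \<times> {0..V}" using bd(2)[of "fst z"] by (cases z) (auto simp: A_def)
  qed (use UN in \<open>auto intro!: pair_measureI\<close>)
  also have "\<dots> = emeasure \<mu> UNIV * emeasure lborel {0..V}"
    using UN by (intro lborel.emeasure_pair_measure_Times) auto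
  also have "\<dots> < \<infinity>"
    using emeasure_finite[of UNIV]
    by (simp add: ennreal_mult_less_top less_top[symmetric] emeasure_lborel_Icc_eq ennreal_mult_eq_top_iff)
  finally have "emeasure (\<mu> \<Otimes>\<^sub>M lborel) A < \<infinity>" .
  then have "integrable (\<mu> \<Otimes>\<^sub>M lborel) (indicator A :: real \<times> real \<Rightarrow> real)"
    by (rule integrable_real_indicator[OF Am])
  then have int: "integrable (\<mu> \<Otimes>\<^sub>M lborel) (\<lambda>(u, s). indicator A (u, s) :: real)" by simp
  have inner: "(LINT s|lborel. indicator A (u, s)) = f u" for u
  proof -
    have "(LINT s|lborel. indicator A (u, s)) = (LINT s|lborel. indicator {0..<f u} s :: real)"
      by (intro Bochner_Integration.integral_cong) (auto simp: A_def indicator_def)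
    also have "\<dots> = f u" using bd(1)[of u] by simp
    finally show ?thesis .
  qed
  have outer: "(LINT u|\<mu>. indicator A (u, s)) = indicator {0..V} s * measure \<mu> {u. s < f u}" for s
  proof -
    have "(LINT u|\<mu>. indicator A (u, s)) = (LINT u|\<mu>. indicator {0..V} s * indicator {u. s < f u} u :: real)"
    proof (intro Bochner_Integration.integral_cong refl)
      fix u
      show "indicator A (u, s) = (indicator {0..V} s * indicator {u. s < f u} u :: real)"
        using bd(2)[of u] by (auto simp: A_def indicator_def)
    qed
    also have "\<dots> = indicator {0..V} s * measure \<mu> {u. s < f u}"
      using lev[of s] by simp
    finally show ?thesis .
  qed
  show "(LINT u|\<mu>. f u) = (LINT s|lborel. indicator {0..V} s * measure \<mu> {u. s < f u})"
    using Fubini_integral[OF int] by (simp add: inner outer)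
  show "integrable lborel (\<lambda>s. indicator {0..V} s * measure \<mu> {u. s < f u})"
    using integrable_snd[OF int] by (simp add: outer)
qed

lemma integral_diff_le_by_level_sets:
  fixes f :: "real \<Rightarrow> real"
  assumes "finite_measure \<mu>" "sets \<mu> = sets borel" "finite_measure \<nu>" "sets \<nu> = sets borel"
    and [measurable]: "f \<in> borel_measurable borel"
    and bd: "\<And>u. 0 \<le> f u" "\<And>u. f u \<le> V"
    and lev: "\<And>s. 0 \<le> s \<Longrightarrow> \<bar>measure \<mu> {u. s < f u} - measure \<nu> {u. s < f u}\<bar> \<le> \<epsilon>"
  shows "\<bar>(LINT u|\<mu>. f u) - (LINT u|\<nu>. f u)\<bar> \<le> \<epsilon> * V"
proof -
  have V: "0 \<le> V" using bd[of 0] by linarith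
  note M = finite_measure_layer_cake[OF assms(1,2,5) bd] and N = finite_measure_layer_cake[OF assms(3,4,5) bd]
  have diff: "(LINT u|\<mu>. f u) - (LINT u|\<nu>. f u) =
      (LINT s|lborel. indicator {0..V} s * measure \<mu> {u. s < f u} - indicator {0..V} s * measure \<nu> {u. s < f u})"
    unfolding M(1) N(1) by (rule Bochner_Integration.integral_diff[symmetric, OF M(2) N(2)])
  have "\<bar>(LINT u|\<mu>. f u) - (LINT u|\<nu>. f u)\<bar> \<le>
      (LINT s|lborel. \<bar>indicator {0..V} s * measure \<mu> {u. s < f u} - indicator {0..V} s * measure \<nu> {u. s < f u}\<bar>)"
    unfolding diff by (rule integral_abs_bound)
  also have "\<dots> \<le> (LINT s|lborel. \<epsilon> * indicator {0..V} s)"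
  proof (rule integral_mono)
    show "integrable lborel (\<lambda>s. \<bar>indicator {0..V} s * measure \<mu> {u. s < f u} - indicator {0..V} s * measure \<nu> {u. s < f u}\<bar>)"
      by (intro integrable_abs Bochner_Integration.integrable_diff M(2) N(2))
    fix s
    show "\<bar>indicator {0..V} s * measure \<mu> {u. s < f u} - indicator {0..V} s * measure \<nu> {u. s < f u}\<bar> \<le> \<epsilon> * indicator {0..V} s"
      using lev[of s] by (cases "s \<in> {0..V}") simp_all
  qed (auto intro!: integrable_mult_right integrable_real_indicator simp: emeasure_lborel_Icc_eq)
  also have "\<dots> = \<epsilon> * V" using V by simp
  finally show ?thesis .
qed

text \<open>The level sets of a monotone function are of this form, so the two distribution functions determine their
  masses.\<close>

lemma up_closed_real_cases:
  fixes S :: "real set"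
  assumes up: "\<And>u v. u \<in> S \<Longrightarrow> u \<le> v \<Longrightarrow> v \<in> S" and "S \<noteq> {}" "p \<notin> S"
  shows "\<exists>x\<ge>p. S = {x<..} \<or> S = {x..}"
proof -
  have low: "p < u" if "u \<in> S" for u using up[OF that, of p] assms(3) by force
  have bb: "bdd_below S" by (rule bdd_belowI[of _ p]) (rule less_imp_le[OF low])
  define x where "x = Inf S"
  have "p \<le> x" unfolding x_def by (rule cInf_greatest[OF assms(2)]) (rule less_imp_le[OF low])
  moreover have gt: "u \<in> S" if xu: "x < u" for u
  proof -
    obtain v where "v \<in> S" "v < u" using cInf_lessD[OF assms(2) xu[unfolded x_def]] by blast
    then show ?thesis using up[of v u] by simp
  qed
  moreover have le: "x \<le> u" if "u \<in> S" for u unfolding x_def by (rule cInf_lower[OF that bb])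
  ultimately show ?thesis
  proof (cases "x \<in> S")
    case True
    then have "S = {x..}" using le up by auto
    then show ?thesis using \<open>p \<le> x\<close> by blast
  next
    case False
    have "S = {x<..}" using le gt False by (auto simp: less_le)
    then show ?thesis using \<open>p \<le> x\<close> by blast
  qed
qed

text \<open>The function \<open>m\<close> dominates the variation of \<open>q\<close>, so \<open>q\<close> is the
  difference of the monotone functions \<open>(m + q)/2\<close> and \<open>(m - q)/2\<close>. By the layer cake
  formula each of them integrates differently against \<open>\<mu>\<close> and \<open>\<nu>\<close> only as far as the
  masses of half-lines differ. All these half-lines start in \<open>[p, r]\<close>, so it is enough to compare the
  distribution functions there.\<close>

lemma bounded_variation_integral_diff:
  fixes q m :: "real \<Rightarrow> real"
  assumes \<mu>: "prob_space \<mu>" "sets \<mu> = sets borel" and \<nu>: "prob_space \<nu>" "sets \<nu> = sets borel"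
    and var: "\<And>u v. u \<le> v \<Longrightarrow> \<bar>q v - q u\<bar> \<le> m v - m u"
    and left: "\<And>u. u \<le> p \<Longrightarrow> q u = 0 \<and> m u = 0" and right: "\<And>u. r \<le> u \<Longrightarrow> q u = 0 \<and> m u = V"
    and cdf: "\<And>x. p \<le> x \<Longrightarrow> x \<le> r \<Longrightarrow> \<bar>cdf \<mu> x - cdf \<nu> x\<bar> \<le> \<epsilon>" and pr: "p \<le> r"
  shows "\<bar>(LINT u|\<mu>. q u) - (LINT u|\<nu>. q u)\<bar> \<le> \<epsilon> * V"
proof -
  interpret \<mu>: prob_space \<mu> by fact
  interpret \<nu>: prob_space \<nu> by fact
  interpret \<mu>b: real_distribution \<mu> by unfold_locales (use \<mu> in \<open>simp_all\<close>)
  interpret \<nu>b: real_distribution \<nu> by unfold_locales (use \<nu> in \<open>simp_all\<close>)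
  have \<epsilon>: "0 \<le> \<epsilon>" using cdf[of p] pr by linarith
  have lower: "\<bar>measure \<mu> {..<x} - measure \<nu> {..<x}\<bar> \<le> \<epsilon>" if "p < x" "x \<le> r" for x
  proof -
    have "((\<lambda>y. \<bar>cdf \<mu> y - cdf \<nu> y\<bar>) \<longlongrightarrow> \<bar>measure \<mu> {..<x} - measure \<nu> {..<x}\<bar>) (at_left x)"
      by (intro tendsto_intros \<mu>b.cdf_at_left \<nu>b.cdf_at_left)
    then show ?thesis
    proof (rule tendsto_upperbound)
      show "\<forall>\<^sub>F y in at_left x. \<bar>cdf \<mu> y - cdf \<nu> y\<bar> \<le> \<epsilon>"
        using eventually_at_left_real[OF that(1)] by eventually_elim (use that cdf in auto)
    qed simp
  qed
  have compl: "measure M {x<..} = 1 - cdf M x" "measure M {x..} = 1 - measure M {..<x}"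
    if "real_distribution M" for M :: "real measure" and x
  proof -
    interpret real_distribution M by fact
    have "measure M (UNIV - {..x}) = 1 - measure M {..x}" "measure M (UNIV - {..<x}) = 1 - measure M {..<x}"
      using prob_compl[of "{..x}"] prob_compl[of "{..<x}"] by simp_all
    moreover have "UNIV - {..x} = {x<..}" "UNIV - {..<x} = {x..}" by auto
    ultimately show "measure M {x<..} = 1 - cdf M x" "measure M {x..} = 1 - measure M {..<x}"
      by (simp_all add: cdf_def)
  qed
  have half: "\<bar>(LINT u|\<mu>. f u) - (LINT u|\<nu>. f u)\<bar> \<le> \<epsilon> * (V / 2)" (is ?A) and int_half: "integrable \<mu> f" "integrable \<nu> f"
    if f: "mono f" "\<And>u. u \<le> p \<Longrightarrow> f u = 0" "\<And>u. r \<le> u \<Longrightarrow> f u = V / 2" for f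
  proof -
    have [measurable]: "f \<in> borel_measurable borel" using f(1) by (rule borel_measurable_mono)
    have nn: "0 \<le> f u" for u using f(2)[of "min u p"] monoD[OF f(1), of "min u p" u] by simp
    have ub: "f u \<le> V / 2" for u using f(3)[of "max u r"] monoD[OF f(1), of u "max u r"] by simp
    show ?A
    proof (rule integral_diff_le_by_level_sets)
      fix s :: real assume s: "0 \<le> s"
      let ?S = "{u. s < f u}"
      show "\<bar>measure \<mu> ?S - measure \<nu> ?S\<bar> \<le> \<epsilon>"
      proof (cases "?S = {}")
        case False
        have up: "v \<in> ?S" if "u \<in> ?S" "u \<le> v" for u v using that monoD[OF f(1), of u v] by auto
        have pS: "p \<notin> ?S" using f(2)[of p] s by simp
        have rS: "r \<in> ?S" using False less_le_trans[OF _ ub] f(3)[of r] by auto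
        obtain x where x: "p \<le> x" "?S = {x<..} \<or> ?S = {x..}"
        proof -
          have "\<exists>x\<ge>p. ?S = {x<..} \<or> ?S = {x..}"
            by (rule up_closed_real_cases[OF _ False pS]) (rule up)
          then show ?thesis using that by blast
        qed
        from x(2) show ?thesis
        proof
          assume eq: "?S = {x<..}"
          then have "x \<le> r" using rS by auto
          then show ?thesis unfolding eq compl(1)[OF \<mu>b.real_distribution_axioms] compl(1)[OF \<nu>b.real_distribution_axioms]
            using cdf[of x] x by (simp add: abs_minus_commute)
        next
          assume eq: "?S = {x..}"
          then have "x \<le> r" "p < x" using rS pS by auto
          then show ?thesis unfolding eq compl(2)[OF \<mu>b.real_distribution_axioms] compl(2)[OF \<nu>b.real_distribution_axioms]
            using lower[of x] x by (simp add: abs_minus_commute)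
        qed
      qed (use \<epsilon> in simp)
    qed (use nn ub \<mu> \<nu> in \<open>auto intro: \<mu>.finite_measure_axioms \<nu>.finite_measure_axioms\<close>)
    have bd: "norm (f u) \<le> V / 2" for u using nn ub by simp
    show "integrable \<mu> f" by (rule \<mu>.integrable_const_bound[of _ "V / 2"]) (use bd in auto)
    show "integrable \<nu> f" by (rule \<nu>.integrable_const_bound[of _ "V / 2"]) (use bd in auto)
  qed
  define f g where "f u = (m u + q u) / 2" and "g u = (m u - q u) / 2" for u
  have f: "mono f" "\<And>u. u \<le> p \<Longrightarrow> f u = 0" "\<And>u. r \<le> u \<Longrightarrow> f u = V / 2"
  proof -
    show "mono f"
    proof (rule monoI)
      fix u v :: real assume "u \<le> v"
      from var[OF this] show "f u \<le> f v" by (simp add: f_def)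
    qed
  qed (use left right in \<open>simp_all add: f_def\<close>)
  have g: "mono g" "\<And>u. u \<le> p \<Longrightarrow> g u = 0" "\<And>u. r \<le> u \<Longrightarrow> g u = V / 2"
  proof -
    show "mono g"
    proof (rule monoI)
      fix u v :: real assume "u \<le> v"
      from var[OF this] show "g u \<le> g v" by (simp add: g_def)
    qed
  qed (use left right in \<open>simp_all add: g_def\<close>)
  have "q = (\<lambda>u. f u - g u)" by (auto simp: f_def g_def fun_eq_iff field_simps)
  then have "(LINT u|\<mu>. q u) - (LINT u|\<nu>. q u) =
      ((LINT u|\<mu>. f u) - (LINT u|\<nu>. f u)) - ((LINT u|\<mu>. g u) - (LINT u|\<nu>. g u))"
    using int_half[OF f] int_half[OF g] by simp
  then have "\<bar>(LINT u|\<mu>. q u) - (LINT u|\<nu>. q u)\<bar> \<le> \<epsilon> * (V / 2) + \<epsilon> * (V / 2)"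
    using half[OF f] half[OF g] by linarith
  then show ?thesis by (simp add: field_simps)
qed

text \<open>The variation of the product is at most the Lipschitz constant of \<open>\<phi>\<close> times the size of
  \<open>A\<close>, plus the size of \<open>\<phi>\<close> times the increase of \<open>A\<close>.\<close>

lemma window_times_monotone_integral_diff:
  fixes \<phi> A :: "real \<Rightarrow> real"
  assumes \<mu>: "prob_space \<mu>" "sets \<mu> = sets borel" and \<nu>: "prob_space \<nu>" "sets \<nu> = sets borel"
    and cdf: "\<And>x. p \<le> x \<Longrightarrow> x \<le> r \<Longrightarrow> \<bar>cdf \<mu> x - cdf \<nu> x\<bar> \<le> \<epsilon>" and pr: "p \<le> r"
    and A_mono: "\<And>u v. p \<le> u \<Longrightarrow> u \<le> v \<Longrightarrow> v \<le> r \<Longrightarrow> A u \<le> A v"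
    and A_bd: "\<And>u. p \<le> u \<Longrightarrow> u \<le> r \<Longrightarrow> \<bar>A u\<bar> \<le> \<alpha>"
    and \<phi>_out: "\<And>u. u \<notin> {p<..<r} \<Longrightarrow> \<phi> u = 0" and \<phi>_bd: "\<And>u. \<bar>\<phi> u\<bar> \<le> B"
    and \<phi>_lip: "\<And>u w. p \<le> u \<Longrightarrow> u \<le> w \<Longrightarrow> w \<le> r \<Longrightarrow> \<bar>\<phi> w - \<phi> u\<bar> \<le> L * (w - u)" and L: "0 \<le> L"
  shows "\<bar>(LINT u|\<mu>. \<phi> u * A u) - (LINT u|\<nu>. \<phi> u * A u)\<bar> \<le> \<epsilon> * (\<alpha> * (2 * B + L * (r - p)))"
proof -
  define c where "c u = max p (min r u)" for u
  define m where "m u = L * \<alpha> * (c u - p) + B * (A (c u) - A p)" for u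
  have c_in: "p \<le> c u" "c u \<le> r" for u using pr by (auto simp: c_def)
  have c_mono: "c u \<le> c v" if "u \<le> v" for u v using that by (auto simp: c_def)
  have q: "\<phi> u * A u = \<phi> (c u) * A (c u)" for u
    using \<phi>_out[of u] \<phi>_out[of p] \<phi>_out[of r] pr by (auto simp: c_def max_def min_def)
  have B: "0 \<le> B" using \<phi>_bd[of 0] by linarith
  have \<alpha>: "0 \<le> \<alpha>" using A_bd[of p] pr by simp
  have \<epsilon>: "0 \<le> \<epsilon>" using cdf[of p] pr by linarith
  have "\<bar>(LINT u|\<mu>. \<phi> u * A u) - (LINT u|\<nu>. \<phi> u * A u)\<bar> \<le> \<epsilon> * m r"
  proof (rule bounded_variation_integral_diff[OF \<mu> \<nu> _ _ _ cdf pr, where m = m])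
    fix u v :: real assume uv: "u \<le> v"
    have "\<phi> v * A v - \<phi> u * A u = (\<phi> (c v) - \<phi> (c u)) * A (c v) + \<phi> (c u) * (A (c v) - A (c u))"
      unfolding q[of u] q[of v] by (simp add: algebra_simps)
    also have "\<bar>\<dots>\<bar> \<le> \<bar>\<phi> (c v) - \<phi> (c u)\<bar> * \<bar>A (c v)\<bar> + \<bar>\<phi> (c u)\<bar> * \<bar>A (c v) - A (c u)\<bar>"
      by (rule order_trans[OF abs_triangle_ineq]) (simp add: abs_mult)
    also have "\<dots> \<le> (L * (c v - c u)) * \<alpha> + B * (A (c v) - A (c u))"
    proof (intro add_mono mult_mono)
      show "\<bar>\<phi> (c v) - \<phi> (c u)\<bar> \<le> L * (c v - c u)" by (intro \<phi>_lip c_in c_mono uv)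
      show "\<bar>A (c v)\<bar> \<le> \<alpha>" by (intro A_bd c_in)
      show "\<bar>A (c v) - A (c u)\<bar> \<le> A (c v) - A (c u)" using A_mono[of "c u" "c v"] c_in c_mono[OF uv] by simp
      show "0 \<le> L * (c v - c u)" using L c_mono[OF uv] by simp
    qed (auto simp: \<phi>_bd B)
    also have "\<dots> = m v - m u" by (simp add: m_def algebra_simps)
    finally show "\<bar>\<phi> v * A v - \<phi> u * A u\<bar> \<le> m v - m u" .
  next
    fix u assume "u \<le> p"
    then have "c u = p" using pr by (simp add: c_def)
    then show "\<phi> u * A u = 0 \<and> m u = 0" using \<phi>_out[of u] \<open>u \<le> p\<close> by (simp add: m_def)
  next
    fix u assume "r \<le> u"
    then have "c u = c r" using pr by (simp add: c_def)
    then show "\<phi> u * A u = 0 \<and> m u = m r" using \<phi>_out[of u] \<open>r \<le> u\<close> by (simp add: m_def)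
  qed
  also have "m r \<le> \<alpha> * (2 * B + L * (r - p))"
  proof -
    have "c r = r" using pr by (simp add: c_def)
    moreover have "A r - A p \<le> 2 * \<alpha>" using A_bd[of r] A_bd[of p] pr by simp
    ultimately have "m r \<le> L * \<alpha> * (r - p) + B * (2 * \<alpha>)"
      unfolding m_def using B by (auto intro!: mult_left_mono)
    then show ?thesis by (simp add: algebra_simps)
  qed
  finally show ?thesis using \<epsilon> by (simp add: mult_left_mono)
qed

section \<open>Linearization of a smooth functional of the estimator\<close>

text \<open>The empirical distribution as a measure, so that averages over the sample become integrals.\<close>

definition empirical_measure :: "(nat \<Rightarrow> real) \<Rightarrow> nat \<Rightarrow> real measure" where
  "empirical_measure ts n = distr (uniform_count_measure {..<n}) borel ts"

lemma empirical_measure: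
  assumes n: "0 < n"
  shows "prob_space (empirical_measure ts n)" and "sets (empirical_measure ts n) = sets borel"
    and cdf_empirical_measure: "cdf (empirical_measure ts n) x = real (obs_count ts n x) / n"
    and integral_empirical_measure: "q \<in> borel_measurable borel \<Longrightarrow>
      (LINT u|empirical_measure ts n. q u) = (\<Sum>i<n. q (ts i)) / real n"
proof -
  have ne: "{..<n} \<noteq> {}" using n by auto
  interpret U: prob_space "uniform_count_measure {..<n}"
    by (rule prob_space_uniform_count_measure) (use ne in auto)
  have m: "ts \<in> uniform_count_measure {..<n} \<rightarrow>\<^sub>M borel" by (simp add: uniform_count_measure_def point_measure_def)
  show "prob_space (empirical_measure ts n)" unfolding empirical_measure_def by (rule U.prob_space_distr[OF m])
  show "sets (empirical_measure ts n) = sets borel" by (simp add: empirical_measure_def)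
  show int: "(LINT u|empirical_measure ts n. q u) = (\<Sum>i<n. q (ts i)) / real n" if "q \<in> borel_measurable borel" for q :: "real \<Rightarrow> real"
    unfolding empirical_measure_def
    by (subst integral_distr[OF m that]) (simp add: lebesgue_integral_point_measure_finite uniform_count_measure_def sum_divide_distrib)
  have "cdf (empirical_measure ts n) x = (LINT u|empirical_measure ts n. indicator {..x} u)"
    by (simp add: cdf_def empirical_measure_def)
  also have "\<dots> = real (obs_count ts n x) / n"
    by (subst int) (auto simp: obs_count_def indicator_def sum.If_cases Int_def)
  finally show "cdf (empirical_measure ts n) x = real (obs_count ts n x) / n" .
qed

text \<open>Subtracting a common constant \<open>c\<close> from the estimator and from \<open>F0\<close> leaves their
  difference unchanged, but makes each of them small on the window. Only then is the exchange of \<open>\<nu>\<close>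
  for the empirical measure cheap enough to be done separately for the two.\<close>

lemma (in current_status_sample) functional_linearization:
  fixes \<phi> :: "real \<Rightarrow> real" and \<nu> :: "real measure"
  assumes \<nu>: "prob_space \<nu>" "sets \<nu> = sets borel" "cdf \<nu> = G"
    and pr: "0 \<le> p" "p \<le> r" "r \<le> M0" "\<kappa> \<le> F0 p" "F0 r \<le> 1 - \<kappa>"
    and \<alpha>: "\<And>u. p \<le> u \<Longrightarrow> u \<le> r \<Longrightarrow> \<bar>npmle ts ds n u - c\<bar> \<le> \<alpha>" "\<And>u. p \<le> u \<Longrightarrow> u \<le> r \<Longrightarrow> \<bar>F0 u - c\<bar> \<le> \<alpha>"
    and \<phi>_meas: "\<phi> \<in> borel_measurable borel"
    and \<phi>_out: "\<And>u. u \<notin> {p<..<r} \<Longrightarrow> \<phi> u = 0" and \<phi>_bd: "\<And>u. \<bar>\<phi> u\<bar> \<le> B"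
    and \<phi>_lip: "\<And>u w. p \<le> u \<Longrightarrow> u \<le> w \<Longrightarrow> w \<le> r \<Longrightarrow> \<bar>\<phi> w - \<phi> u\<bar> \<le> L * (w - u)" and L: "0 \<le> L"
  shows "\<bar>(LINT u|\<nu>. \<phi> u * npmle ts ds n u) - (LINT u|\<nu>. \<phi> u * F0 u) - (\<Sum>i<n. \<phi> (ts i) * (ds i - F0 (ts i))) / n\<bar>
     \<le> \<eta> * (B + L * (r - p)) / n + 2 * (e * (\<alpha> * (2 * B + L * (r - p))))"
proof -
  let ?F = "npmle ts ds n"
  let ?\<mu> = "empirical_measure ts n"
  interpret \<nu>: prob_space \<nu> by fact
  interpret \<mu>: prob_space ?\<mu> by (rule empirical_measure[OF n_pos])
  have Fm: "?F \<in> borel_measurable borel"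
    by (rule borel_measurable_mono) (auto intro!: monoI npmle_mono ds_nonneg)
  have F0m: "F0 \<in> borel_measurable borel"
    by (rule borel_measurable_mono) (auto intro!: monoI F0_mono)
  have cdf: "\<bar>cdf ?\<mu> x - cdf \<nu> x\<bar> \<le> e" if "p \<le> x" "x \<le> r" for x
    unfolding cdf_empirical_measure[OF n_pos] \<nu>(3) using empirical[of x] that pr by simp
  have A: "\<bar>(LINT u|?\<mu>. \<phi> u * (?F u - c)) - (LINT u|\<nu>. \<phi> u * (?F u - c))\<bar> \<le> e * (\<alpha> * (2 * B + L * (r - p)))"
    by (rule window_times_monotone_integral_diff[OF empirical_measure(1,2)[OF n_pos] \<nu>(1,2) cdf pr(2) _ \<alpha>(1) \<phi>_out \<phi>_bd \<phi>_lip L])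
       (simp_all add: npmle_mono ds_nonneg)
  have A0: "\<bar>(LINT u|?\<mu>. \<phi> u * (F0 u - c)) - (LINT u|\<nu>. \<phi> u * (F0 u - c))\<bar> \<le> e * (\<alpha> * (2 * B + L * (r - p)))"
    by (rule window_times_monotone_integral_diff[OF empirical_measure(1,2)[OF n_pos] \<nu>(1,2) cdf pr(2) _ \<alpha>(2) \<phi>_out \<phi>_bd \<phi>_lip L])
       (simp_all add: F0_mono)
  have B0: "0 \<le> B" using \<phi>_bd[of 0] by linarith
  have int: "integrable \<nu> (\<lambda>u. \<phi> u * (H u - c))"
    if H: "H \<in> borel_measurable borel" "\<And>u. p \<le> u \<Longrightarrow> u \<le> r \<Longrightarrow> \<bar>H u - c\<bar> \<le> \<alpha>" for H
  proof (rule \<nu>.integrable_const_bound[of _ "B * \<alpha>"])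
    have \<alpha>0: "0 \<le> \<alpha>" using H(2)[of p] pr by simp
    show "AE u in \<nu>. norm (\<phi> u * (H u - c)) \<le> B * \<alpha>"
    proof (rule AE_I2)
      fix u
      show "norm (\<phi> u * (H u - c)) \<le> B * \<alpha>"
      proof (cases "u \<in> {p<..<r}")
        case True
        then show ?thesis using \<phi>_bd[of u] H(2)[of u] B0 by (auto simp: abs_mult intro!: mult_mono)
      qed (use \<phi>_out[of u] B0 \<alpha>0 in simp)
    qed
    show "(\<lambda>u. \<phi> u * (H u - c)) \<in> borel_measurable \<nu>"
      using \<phi>_meas H(1) unfolding measurable_cong_sets[OF \<nu>(2) refl] by measurable
  qed
  have int\<phi>: "integrable \<nu> \<phi>"
    by (rule \<nu>.integrable_const_bound[of _ B]) (use \<phi>_bd \<phi>_meas in \<open>auto simp: measurable_cong_sets[OF \<nu>(2) refl]\<close>)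
  have split: "(LINT u|\<nu>. \<phi> u * H u) = (LINT u|\<nu>. \<phi> u * (H u - c)) + c * (LINT u|\<nu>. \<phi> u)"
    if H: "H \<in> borel_measurable borel" "\<And>u. p \<le> u \<Longrightarrow> u \<le> r \<Longrightarrow> \<bar>H u - c\<bar> \<le> \<alpha>" for H
  proof -
    have "(LINT u|\<nu>. \<phi> u * H u) = (LINT u|\<nu>. \<phi> u * (H u - c) + c * \<phi> u)"
      by (intro Bochner_Integration.integral_cong) (auto simp: algebra_simps)
    also have "\<dots> = (LINT u|\<nu>. \<phi> u * (H u - c)) + c * (LINT u|\<nu>. \<phi> u)"
      using int[OF H] int\<phi> by simp
    finally show ?thesis .
  qed
  have emp: "(LINT u|?\<mu>. \<phi> u * (H u - c)) =
      (\<Sum>i<n. \<phi> (ts i) * H (ts i)) / n - (\<Sum>i<n. \<phi> (ts i) * c) / n"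
    if H: "H \<in> borel_measurable borel" for H
  proof -
    note [measurable] = \<phi>_meas H
    have "(LINT u|?\<mu>. \<phi> u * (H u - c)) = (\<Sum>i<n. \<phi> (ts i) * (H (ts i) - c)) / n"
      by (intro integral_empirical_measure n_pos) measurable
    then show ?thesis by (simp add: right_diff_distrib sum_subtractf diff_divide_distrib)
  qed
  have sums: "(\<Sum>i<n. \<phi> (ts i) * (ds i - F0 (ts i))) = (\<Sum>i<n. \<phi> (ts i) * ds i) - (\<Sum>i<n. \<phi> (ts i) * F0 (ts i))"
    by (simp add: right_diff_distrib sum_subtractf)
  have lin: "\<bar>((\<Sum>i<n. \<phi> (ts i) * ?F (ts i)) - (\<Sum>i<n. \<phi> (ts i) * ds i)) / n\<bar> \<le> \<eta> * (B + L * (r - p)) / n"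
    using minorant_summation_by_parts[OF pr \<phi>_out \<phi>_bd \<phi>_lip L] n_pos by (simp add: abs_divide divide_right_mono)
  have "(LINT u|\<nu>. \<phi> u * ?F u) - (LINT u|\<nu>. \<phi> u * F0 u) - (\<Sum>i<n. \<phi> (ts i) * (ds i - F0 (ts i))) / n =
      ((LINT u|\<nu>. \<phi> u * (?F u - c)) - (LINT u|?\<mu>. \<phi> u * (?F u - c)))
      - ((LINT u|\<nu>. \<phi> u * (F0 u - c)) - (LINT u|?\<mu>. \<phi> u * (F0 u - c)))
      + ((\<Sum>i<n. \<phi> (ts i) * ?F (ts i)) - (\<Sum>i<n. \<phi> (ts i) * ds i)) / n"
    using split[OF Fm \<alpha>(1)] split[OF F0m \<alpha>(2)]
    unfolding emp[OF Fm] emp[OF F0m] sums diff_divide_distrib by linarith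
  then show ?thesis using A A0 lin by linarith
qed

section \<open>Kernel smoothing\<close>

lemma integrable_lborel_continuous_compact_support:
  fixes w :: "real \<Rightarrow> real"
  assumes "continuous_on UNIV w" and out: "\<And>x. x \<notin> {a..b} \<Longrightarrow> w x = 0"
  shows "integrable lborel w"
proof -
  have "integrable lborel (\<lambda>x. indicator {a..b} x *\<^sub>R w x)"
    by (rule borel_integrable_compact) (auto intro: continuous_on_subset[OF assms(1)])
  also have "(\<lambda>x. indicator {a..b} x *\<^sub>R w x) = w" using out by (auto simp: indicator_def fun_eq_iff)
  finally show ?thesis .
qed

lemma finite_interval_measure:
  fixes F :: "real \<Rightarrow> real"
  assumes mono: "\<And>x y. x \<le> y \<Longrightarrow> F x \<le> F y" and rc: "\<And>x. continuous (at_right x) F"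
    and lim: "(F \<longlongrightarrow> 0) at_bot" and bd: "\<And>x. F x \<le> B"
  shows "finite_measure (interval_measure F)"
proof
  have "(\<lambda>i::nat. emeasure (interval_measure F) {..real i}) \<longlonglongrightarrow> emeasure (interval_measure F) (\<Union>i::nat. {..real i})"
    by (intro Lim_emeasure_incseq) (auto simp: incseq_def)
  moreover have "(\<Union>i::nat. {..real i}) = UNIV" by (auto intro: real_arch_simple)
  ultimately have lim': "(\<lambda>i::nat. emeasure (interval_measure F) {..real i}) \<longlonglongrightarrow> emeasure (interval_measure F) UNIV"
    by simp
  have "emeasure (interval_measure F) UNIV \<le> ennreal B"
  proof (rule tendsto_upperbound[OF lim'])
    show "\<forall>\<^sub>F i::nat in sequentially. emeasure (interval_measure F) {..real i} \<le> ennreal B"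
      using emeasure_interval_measure_Iic[OF mono rc lim] bd by (auto intro!: always_eventually ennreal_leI)
  qed simp
  then show "emeasure (interval_measure F) (space (interval_measure F)) \<noteq> \<infinity>"
    by (auto simp: top_unique)
qed

text \<open>Write \<open>K u\<close> as minus the integral of \<open>K'\<close> over \<open>[u, \<infinity>)\<close>
  and exchange the order of integration.\<close>

lemma interval_measure_integration_by_parts:
  fixes F K K' :: "real \<Rightarrow> real"
  assumes mono: "\<And>x y. x \<le> y \<Longrightarrow> F x \<le> F y" and rc: "\<And>x. continuous (at_right x) F"
    and lim: "(F \<longlongrightarrow> 0) at_bot" and bd: "\<And>x. F x \<le> B"
    and K: "\<And>x. (K has_real_derivative K' x) (at x)" and K'_cont: "continuous_on UNIV K'"
    and supp: "\<And>x. x \<notin> {a..b} \<Longrightarrow> K x = 0" "\<And>x. x \<notin> {a..b} \<Longrightarrow> K' x = 0"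
  shows "(LINT u|interval_measure F. K u) = - (LINT s|lborel. K' s * F s)"
proof -
  let ?\<mu> = "interval_measure F"
  interpret finite_measure ?\<mu> by (rule finite_interval_measure[OF mono rc lim bd])
  interpret pair_sigma_finite ?\<mu> lborel ..
  have K'int: "integrable lborel K'" by (rule integrable_lborel_continuous_compact_support[OF K'_cont supp(2)])
  have [measurable]: "K' \<in> borel_measurable borel" by (rule borel_measurable_continuous_onI[OF K'_cont])
  have tail: "integrable lborel (\<lambda>s. indicator {u..} s * K' s)" for u
    using integrable_mult_indicator[OF _ K'int, of "{u..}"] by simp
  have inner: "(LINT s|lborel. indicator {u..} s * K' s) = - K u" for u
  proof -
    define c where "c = max u (b + 1)"
    have "(LINT s|lborel. indicator {u..} s * K' s) = (LINT s|lborel. K' s * indicator {u..c} s)"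
    proof (intro Bochner_Integration.integral_cong refl)
      fix s
      show "indicator {u..} s * K' s = K' s * indicator {u..c} s"
      proof (cases "s \<le> c")
        case False
        then have "b < s" by (simp add: c_def)
        then show ?thesis using supp(2)[of s] by simp
      qed (simp add: indicator_def)
    qed
    also have "\<dots> = K c - K u"
      by (rule integral_FTC_Icc_real) (use K K'_cont in \<open>auto simp: c_def continuous_on_eq_continuous_at\<close>)
    also have "K c = 0" using supp(1) by (simp add: c_def)
    finally show ?thesis by simp
  qed
  have "integrable (?\<mu> \<Otimes>\<^sub>M lborel) (\<lambda>z. indicator {z. fst z \<le> snd z} z * K' (snd z))"
  proof (rule Fubini_integrable)
    show "integrable ?\<mu> (\<lambda>u. LINT s|lborel. norm (indicator {z. fst z \<le> snd z} (u, s) * K' (snd (u, s))))"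
    proof (rule integrable_const_bound)
      show "AE u in ?\<mu>. norm (LINT s|lborel. norm (indicator {z. fst z \<le> snd z} (u, s) * K' (snd (u, s)))) \<le> (LINT s|lborel. \<bar>K' s\<bar>)"
      proof (rule AE_I2)
        fix u
        have "(LINT s|lborel. norm (indicator {z. fst z \<le> snd z} (u, s) * K' (snd (u, s)))) \<le> (LINT s|lborel. \<bar>K' s\<bar>)"
          by (rule integral_mono')
             (use K'int in \<open>auto simp: indicator_def intro: integrable_abs\<close>)
        then show "norm (LINT s|lborel. norm (indicator {z. fst z \<le> snd z} (u, s) * K' (snd (u, s)))) \<le> (LINT s|lborel. \<bar>K' s\<bar>)"
          by simp
      qed
    qed measurable
    show "AE u in ?\<mu>. integrable lborel (\<lambda>s. indicator {z. fst z \<le> snd z} (u, s) * K' (snd (u, s)))"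
    proof (rule AE_I2)
      fix u
      have "(\<lambda>s. indicator {z. fst z \<le> snd z} (u, s) * K' (snd (u, s))) = (\<lambda>s. indicator {u..} s * K' s)"
        by (auto simp: indicator_def fun_eq_iff)
      then show "integrable lborel (\<lambda>s. indicator {z. fst z \<le> snd z} (u, s) * K' (snd (u, s)))"
        using tail[of u] by simp
    qed
  qed measurable
  also have "(\<lambda>z. indicator {z. fst z \<le> snd z} z * K' (snd z)) = (\<lambda>(u, s). indicator {u..} s * K' s)"
    by (auto simp: indicator_def fun_eq_iff)
  finally have int: "integrable (?\<mu> \<Otimes>\<^sub>M lborel) (\<lambda>(u, s). indicator {u..} s * K' s)" .
  have outer: "(LINT u|?\<mu>. indicator {u..} s * K' s) = K' s * F s" for s
  proof -
    have "(LINT u|?\<mu>. indicator {u..} s * K' s) = (LINT u|?\<mu>. K' s * indicator {..s} u)"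
      by (intro Bochner_Integration.integral_cong) (auto simp: indicator_def)
    also have "\<dots> = K' s * measure ?\<mu> {..s}" by simp
    also have "\<dots> = K' s * F s" by (simp add: measure_interval_measure_Iic[OF mono rc lim])
    finally show ?thesis .
  qed
  show ?thesis using Fubini_integral[OF int, unfolded inner outer] by simp
qed

locale smooth_kernel_fun =
  fixes k :: "real \<Rightarrow> real"
  assumes smooth: "smooth_kernel k"
begin

lemma k_nonneg: "0 \<le> k u" and k_sym: "k (- u) = k u"
  using smooth by (auto simp: smooth_kernel_def)

lemma k_deriv: "(k has_real_derivative deriv k u) (at u)"
  and k'_deriv: "(deriv k has_real_derivative deriv (deriv k) u) (at u)"
  using smooth by (auto simp: smooth_kernel_def DERIV_deriv_iff_real_differentiable)

lemma k_cont: "continuous_on UNIV k" and k'_cont: "continuous_on UNIV (deriv k)"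
  and k''_cont: "continuous_on UNIV (deriv (deriv k))"
  using smooth k_deriv k'_deriv
  by (auto simp: smooth_kernel_def intro!: DERIV_isCont continuous_at_imp_continuous_on)

text \<open>The set where a continuous function does not vanish is open, hence contained in the interior of
  \<open>[-1, 1]\<close> as soon as it is contained in \<open>[-1, 1]\<close>.\<close>

lemma zero_on_boundary_of_support:
  fixes w :: "real \<Rightarrow> real"
  assumes "continuous_on UNIV w" and "\<And>u. 1 < \<bar>u\<bar> \<Longrightarrow> w u = 0" "1 \<le> \<bar>u\<bar>"
  shows "w u = 0"
proof (rule ccontr)
  assume "w u \<noteq> 0"
  have "open {u. w u \<noteq> 0}"
    using open_Collect_neq[of w "\<lambda>_. 0"] assms(1) by (simp add: continuous_on_const)
  moreover have "{u. w u \<noteq> 0} \<subseteq> {-1..1}" using assms(2) by force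
  ultimately have "{u. w u \<noteq> 0} \<subseteq> interior {-1..1}" by (intro interior_maximal)
  with \<open>w u \<noteq> 0\<close> have "u \<in> {-1<..<1}" by (auto simp: interior_atLeastAtMost_real)
  then show False using assms(3) by auto
qed

lemma k_outside: "1 < \<bar>u\<bar> \<Longrightarrow> k u = 0"
proof (rule ccontr)
  assume u: "1 < \<bar>u\<bar>" "k u \<noteq> 0"
  then have "u \<in> closure {u. k u \<noteq> 0}" using closure_subset[of "{u. k u \<noteq> 0}"] by auto
  then show False using u smooth by (auto simp: smooth_kernel_def)
qed

lemma deriv_outside:
  fixes w w' :: "real \<Rightarrow> real"
  assumes "\<And>u. (w has_real_derivative w' u) (at u)" "\<And>u. 1 < \<bar>u\<bar> \<Longrightarrow> w u = 0" "1 < \<bar>u\<bar>"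
  shows "w' u = 0"
proof -
  have "open {v::real. 1 < \<bar>v\<bar>}" by (intro open_Collect_less continuous_intros)
  then have "\<forall>\<^sub>F v in nhds u. v \<in> {v. 1 < \<bar>v\<bar>}" using assms(3) by (intro eventually_nhds_in_open) auto
  then have "\<forall>\<^sub>F v in nhds u. w v = 0" by eventually_elim (use assms(2) in auto)
  then have "(w has_real_derivative w' u) (at u) = ((\<lambda>_. 0) has_real_derivative w' u) (at u)"
    by (intro DERIV_cong_ev) auto
  then show ?thesis using assms(1)[of u] DERIV_unique[of "\<lambda>_. 0" "w' u" u 0] by simp
qed

lemma k'_outside: "1 < \<bar>u\<bar> \<Longrightarrow> deriv k u = 0"
  using deriv_outside[OF k_deriv k_outside] .

lemma k''_outside: "1 < \<bar>u\<bar> \<Longrightarrow> deriv (deriv k) u = 0"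
  using deriv_outside[OF k'_deriv k'_outside] .

lemma k'_zero: "1 \<le> \<bar>u\<bar> \<Longrightarrow> deriv k u = 0"
  using zero_on_boundary_of_support[OF k'_cont k'_outside] .

lemma bounded_of_support:
  fixes w :: "real \<Rightarrow> real"
  assumes "continuous_on UNIV w" and "\<And>u. 1 < \<bar>u\<bar> \<Longrightarrow> w u = 0"
  obtains B where "0 < B" "\<And>u. \<bar>w u\<bar> \<le> B"
proof -
  have "compact (w ` {-1..1})"
    by (intro compact_continuous_image continuous_on_subset[OF assms(1)]) auto
  then obtain B where B: "0 < B" "\<And>y. y \<in> w ` {-1..1} \<Longrightarrow> norm y \<le> B"
    using compact_imp_bounded bounded_pos by metis
  have "\<bar>w u\<bar> \<le> B" for u
  proof (cases "1 < \<bar>u\<bar>")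
    case False
    then have "w u \<in> w ` {-1..1}" by (intro imageI) auto
    then show ?thesis using B(2)[of "w u"] by auto
  qed (use assms(2) B in auto)
  with B(1) show ?thesis using that by blast
qed

lemma k'_bounded: obtains B where "0 < B" "\<And>u. \<bar>deriv k u\<bar> \<le> B"
  using bounded_of_support[OF k'_cont k'_outside] by blast

lemma k'_lipschitz: obtains L where "0 < L" "\<And>u v. \<bar>deriv k u - deriv k v\<bar> \<le> L * \<bar>u - v\<bar>"
proof -
  obtain L where L: "0 < L" "\<And>u. \<bar>deriv (deriv k) u\<bar> \<le> L"
    using bounded_of_support[OF k''_cont k''_outside] by blast
  have "norm (deriv k u - deriv k v) \<le> L * norm (u - v)" for u v
    by (rule field_differentiable_bound[of UNIV "deriv k" "deriv (deriv k)"])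
       (use L k'_deriv in \<open>auto intro: has_field_derivative_at_within\<close>)
  then show ?thesis using that[OF L(1)] by simp
qed

lemma k_integrable: "integrable lborel k"
  by (rule integrable_lborel_continuous_compact_support[OF k_cont, of "-1" 1]) (use k_outside in \<open>auto simp: abs_real_def\<close>)

lemma k_integral: "(LINT u|lborel. k u) = 1"
  using has_integral_unique[OF has_integral_integral_lborel[OF k_integrable]] smooth
  by (auto simp: smooth_kernel_def)

lemma k_first_moment: "(LINT u|lborel. u * k u) = 0"
proof -
  have "(LINT u|lborel. u * k u) = (LINT u|lborel. - (u * k u))"
    using lborel_integral_real_affine[of "-1" "\<lambda>u. u * k u" 0] by (simp add: k_sym)
  then show ?thesis by simp
qed

end

lemma continuous_nonneg_integral_pos:
  fixes w :: "real \<Rightarrow> real"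
  assumes cont: "continuous_on UNIV w" and int: "integrable lborel w" and nn: "\<And>x. 0 \<le> w x" and pos: "0 < w u"
  shows "0 < (LINT x|lborel. w x)"
proof -
  have "isCont w u" using cont by (simp add: continuous_on_eq_continuous_at)
  then have "\<forall>\<^sub>F x in at u. w u / 2 < w x"
    unfolding isCont_def by (rule order_tendstoD) (use pos in simp)
  then obtain \<delta> where \<delta>: "0 < \<delta>" "\<And>x. x \<noteq> u \<Longrightarrow> dist x u < \<delta> \<Longrightarrow> w u / 2 < w x"
    unfolding eventually_at by blast
  have "0 < w u / 2 * \<delta>" using pos \<delta> by simp
  also have "w u / 2 * \<delta> = (LINT x|lborel. w u / 2 * indicator {u..u + \<delta>} x)" using \<delta> by simp
  also have "\<dots> \<le> (LINT x|lborel. w x)"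
  proof (rule integral_mono_AE)
    show "integrable lborel (\<lambda>x. w u / 2 * indicator {u..u + \<delta>} x)"
      using pos by (intro integrable_mult_right integrable_real_indicator) (auto simp: emeasure_lborel_Icc_eq)
    show "AE x in lborel. w u / 2 * indicator {u..u + \<delta>} x \<le> w x"
      using AE_lborel_singleton[of "u + \<delta>"] AE_lborel_singleton[of u]
    proof eventually_elim
      case (elim x)
      then show ?case using \<delta>(2)[of x] nn[of x] by (auto simp: indicator_def dist_real_def)
    qed
  qed fact
  finally show ?thesis .
qed

context smooth_kernel_fun
begin

lemma k_positive_point: obtains u where "u \<noteq> 0" "0 < k u"
proof -
  have "\<exists>u. u \<noteq> 0 \<and> k u \<noteq> 0"
  proof (rule ccontr)
    assume "\<not> ?thesis"
    then have "{u. k u \<noteq> 0} \<subseteq> {0}" by auto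
    then have "closure {u. k u \<noteq> 0} \<subseteq> {0}" by (rule closure_minimal) simp
    then have "{-1..1::real} \<subseteq> {0}" using smooth by (simp add: smooth_kernel_def)
    then have "(1::real) \<in> {0}" by (rule subsetD) simp
    then show False by simp
  qed
  then show ?thesis using that k_nonneg by (metis less_le)
qed

lemma second_moment_pos: "0 < second_moment k"
proof -
  obtain u where u: "u \<noteq> 0" "0 < k u" by (rule k_positive_point)
  have c: "continuous_on UNIV (\<lambda>u. u\<^sup>2 * k u)" by (intro continuous_intros k_cont)
  show ?thesis unfolding second_moment_def
    by (rule continuous_nonneg_integral_pos[OF c integrable_lborel_continuous_compact_support[OF c, of "-1" 1], where u = u])
       (use k_outside k_nonneg u in \<open>auto simp: abs_real_def\<close>)
qed

lemma k'_square_integral_pos: "0 < (LINT u|lborel. (deriv k u)\<^sup>2)"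
proof -
  have "\<exists>u. deriv k u \<noteq> 0"
  proof (rule ccontr)
    assume "\<not> ?thesis"
    then have D: "\<forall>u. (k has_real_derivative 0) (at u)" using k_deriv by (metis (full_types))
    obtain u where u: "0 < k u" using k_positive_point by blast
    have "k u = k 2" using DERIV_isconst_all[OF D] by blast
    then show False using u k_outside[of 2] by simp
  qed
  then obtain u where u: "deriv k u \<noteq> 0" by blast
  have c: "continuous_on UNIV (\<lambda>u. (deriv k u)\<^sup>2)" by (intro continuous_intros k'_cont)
  show ?thesis
    by (rule continuous_nonneg_integral_pos[OF c integrable_lborel_continuous_compact_support[OF c, of "-1" 1], where u = u])
       (use k'_outside u in \<open>auto simp: abs_real_def\<close>)
qed

lemma rescaled_kernel_deriv:
  assumes "0 < h"
  shows "((\<lambda>u. rescaled_kernel k h (t - u)) has_real_derivative - (deriv k ((t - u) / h) / h\<^sup>2)) (at u)"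
  unfolding rescaled_kernel_def
  by (rule derivative_eq_intros DERIV_chain2[OF k_deriv] refl | use assms in \<open>simp add: power2_eq_square field_simps\<close>)+

lemma integral_rescaled_kernel_interval_measure:
  fixes F :: "real \<Rightarrow> real"
  assumes h: "0 < h" and mono: "\<And>x y. x \<le> y \<Longrightarrow> F x \<le> F y" and rc: "\<And>x. continuous (at_right x) F"
    and lim: "(F \<longlongrightarrow> 0) at_bot" and bd: "\<And>x. F x \<le> B"
  shows "(LINT u|interval_measure F. rescaled_kernel k h (t - u)) =
     (LINT u|lborel. deriv k ((t - u) / h) / h\<^sup>2 * F u)"
proof -
  have out: "1 < \<bar>(t - u) / h\<bar>" if "u \<notin> {t - h..t + h}" for u
    using that h by (auto simp: abs_real_def field_simps)
  have "(LINT u|interval_measure F. rescaled_kernel k h (t - u)) =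
     - (LINT u|lborel. - (deriv k ((t - u) / h) / h\<^sup>2) * F u)"
  proof (rule interval_measure_integration_by_parts[OF mono rc lim bd rescaled_kernel_deriv[OF h],
        where a = "t - h" and b = "t + h"])
    show "continuous_on UNIV (\<lambda>u. - (deriv k ((t - u) / h) / h\<^sup>2))"
      using h by (intro continuous_intros continuous_on_compose2[OF k'_cont]) auto
  qed (use out k_outside k'_outside in \<open>auto simp: rescaled_kernel_def\<close>)
  then show ?thesis by simp
qed

end

text \<open>Used for the bias, with \<open>w u = u\<^sup>2 k u\<close> and the Taylor quotient of the density, and for
  the variance, with \<open>w = k'\<^sup>2\<close> and \<open>F0 (1 - F0)/g\<close>.\<close>

lemma local_average_tendsto:
  fixes w a :: "real \<Rightarrow> real" and h :: "nat \<Rightarrow> real"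
  assumes w: "continuous_on UNIV w" "\<And>u. 1 < \<bar>u\<bar> \<Longrightarrow> w u = 0" and a[measurable]: "a \<in> borel_measurable borel"
    and ca: "isCont a t" and h: "h \<longlonglongrightarrow> 0"
  shows "(\<lambda>n. LINT v|lborel. w v * a (t - h n * v)) \<longlonglongrightarrow> (LINT v|lborel. w v) * a t" (is ?A)
    and "\<forall>\<^sub>F n in sequentially. integrable lborel (\<lambda>v. w v * a (t - h n * v))" (is ?B)
proof -
  have [measurable]: "w \<in> borel_measurable borel" by (rule borel_measurable_continuous_onI[OF w(1)])
  have wi: "integrable lborel w"
    by (rule integrable_lborel_continuous_compact_support[OF w(1), of "-1" 1]) (use w(2) in \<open>auto simp: abs_real_def\<close>)
  have near: "\<forall>\<^sub>F n in sequentially. \<forall>v. \<bar>v\<bar> \<le> 1 \<longrightarrow> \<bar>a (t - h n * v) - a t\<bar> < \<epsilon>" if \<epsilon>: "0 < \<epsilon>" for \<epsilon>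
  proof -
    obtain \<delta> where \<delta>: "0 < \<delta>" "\<And>x. \<bar>x - t\<bar> < \<delta> \<Longrightarrow> \<bar>a x - a t\<bar> < \<epsilon>"
      using ca \<epsilon> unfolding continuous_at_eps_delta by (auto simp: dist_real_def)
    have "\<forall>\<^sub>F n in sequentially. \<bar>h n\<bar> < \<delta>"
      using order_tendstoD(2)[OF tendsto_rabs_zero[OF h] \<delta>(1)] .
    then show ?thesis
    proof eventually_elim
      case (elim n)
      show ?case
      proof (intro allI impI \<delta>(2))
        fix v :: real assume "\<bar>v\<bar> \<le> 1"
        then have "\<bar>h n\<bar> * \<bar>v\<bar> \<le> \<bar>h n\<bar> * 1" by (intro mult_left_mono) auto
        then show "\<bar>t - h n * v - t\<bar> < \<delta>" using elim by (simp add: abs_mult)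
      qed
    qed
  qed
  have int: "integrable lborel (\<lambda>v. w v * a (t - h n * v))"
    if "\<forall>v. \<bar>v\<bar> \<le> 1 \<longrightarrow> \<bar>a (t - h n * v) - a t\<bar> < 1" for n
  proof (rule Bochner_Integration.integrable_bound)
    show "integrable lborel (\<lambda>v. (\<bar>a t\<bar> + 1) * w v)" using wi by simp
    show "AE v in lborel. norm (w v * a (t - h n * v)) \<le> norm ((\<bar>a t\<bar> + 1) * w v)"
    proof (rule AE_I2)
      fix v
      show "norm (w v * a (t - h n * v)) \<le> norm ((\<bar>a t\<bar> + 1) * w v)"
      proof (cases "1 < \<bar>v\<bar>")
        case False
        then have "\<bar>a (t - h n * v)\<bar> \<le> \<bar>a t\<bar> + 1" using that[rule_format, of v] by linarith
        then have "\<bar>w v\<bar> * \<bar>a (t - h n * v)\<bar> \<le> \<bar>w v\<bar> * (\<bar>a t\<bar> + 1)" by (intro mult_left_mono) auto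
        then show ?thesis by (simp add: abs_mult mult.commute)
      qed (use w(2) in auto)
    qed
  qed measurable
  show ?B using near[OF zero_less_one] by eventually_elim (use int in auto)
  show ?A
  proof (rule LIMSEQ_I)
    fix r :: real assume r: "0 < r"
    define W where "W = (LINT v|lborel. \<bar>w v\<bar>)"
    have W: "0 \<le> W" by (simp add: W_def)
    define \<epsilon> where "\<epsilon> = r / (W + 1)"
    have \<epsilon>: "0 < \<epsilon>" using r W by (simp add: \<epsilon>_def)
    have "\<forall>\<^sub>F n in sequentially. norm ((LINT v|lborel. w v * a (t - h n * v)) - (LINT v|lborel. w v) * a t) < r"
      using near[OF \<epsilon>] near[OF zero_less_one]
    proof eventually_elim
      case (elim n)
      have i: "integrable lborel (\<lambda>v. w v * a (t - h n * v))" using int elim(2) by blast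
      have "(LINT v|lborel. w v * a (t - h n * v)) - (LINT v|lborel. w v) * a t =
          (LINT v|lborel. w v * a (t - h n * v) - w v * a t)"
        using i wi by (subst Bochner_Integration.integral_diff) auto
      moreover have "\<bar>LINT v|lborel. w v * a (t - h n * v) - w v * a t\<bar> \<le> (LINT v|lborel. \<bar>w v * a (t - h n * v) - w v * a t\<bar>)"
        by (rule integral_abs_bound)
      moreover have "(LINT v|lborel. \<bar>w v * a (t - h n * v) - w v * a t\<bar>) \<le> (LINT v|lborel. \<epsilon> * \<bar>w v\<bar>)"
      proof (rule integral_mono)
        show "integrable lborel (\<lambda>v. \<bar>w v * a (t - h n * v) - w v * a t\<bar>)" using i wi by auto
        show "integrable lborel (\<lambda>v. \<epsilon> * \<bar>w v\<bar>)" using wi by auto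
        fix v
        show "\<bar>w v * a (t - h n * v) - w v * a t\<bar> \<le> \<epsilon> * \<bar>w v\<bar>"
        proof (cases "1 < \<bar>v\<bar>")
          case False
          then have "\<bar>a (t - h n * v) - a t\<bar> \<le> \<epsilon>" using elim(1)[rule_format, of v] by linarith
          then have "\<bar>w v\<bar> * \<bar>a (t - h n * v) - a t\<bar> \<le> \<bar>w v\<bar> * \<epsilon>" by (intro mult_left_mono) auto
          moreover have "\<bar>w v * a (t - h n * v) - w v * a t\<bar> = \<bar>w v\<bar> * \<bar>a (t - h n * v) - a t\<bar>"
            by (simp only: right_diff_distrib[symmetric] abs_mult)
          ultimately show ?thesis by (simp add: mult.commute)
        qed (use w(2) in auto)
      qed
      moreover have "(LINT v|lborel. \<epsilon> * \<bar>w v\<bar>) = \<epsilon> * W" by (simp add: W_def)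
      moreover have "\<epsilon> * W < r" using r W by (simp add: \<epsilon>_def field_simps)
      ultimately show ?case unfolding real_norm_def by linarith
    qed
    then show "\<exists>N. \<forall>n\<ge>N. norm ((LINT v|lborel. w v * a (t - h n * v)) - (LINT v|lborel. w v) * a t) < r"
      unfolding eventually_sequentially .
  qed
qed

text \<open>Taylor's theorem with Lagrange remainder expresses the quotient by a value of the second derivative at an
  intermediate point.\<close>

lemma second_order_remainder:
  fixes f :: "real \<Rightarrow> real"
  assumes diff: "\<forall>\<^sub>F x in nhds t. f differentiable (at x) \<and> deriv f differentiable (at x)"
    and cont: "isCont (deriv (deriv f)) t"
  shows "isCont (\<lambda>x. if x = t then deriv (deriv f) t / 2 else (f x - f t - deriv f t * (x - t)) / (x - t)\<^sup>2) t"
    (is "isCont ?a t")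
proof -
  obtain \<delta> where \<delta>: "0 < \<delta>" and D: "\<And>x. dist x t < \<delta> \<Longrightarrow> f differentiable (at x) \<and> deriv f differentiable (at x)"
    using diff unfolding eventually_nhds_metric by blast
  define d where "d m = (if m = (0::nat) then f else if m = 1 then deriv f else deriv (deriv f))" for m
  have taylor: "\<exists>s. \<bar>s - t\<bar> \<le> \<bar>x - t\<bar> \<and> f x - f t - deriv f t * (x - t) = deriv (deriv f) s / 2 * (x - t)\<^sup>2"
    if x: "\<bar>x - t\<bar> < \<delta>" "x \<noteq> t" for x
  proof -
    have "\<exists>s. (if x < t then x < s \<and> s < t else t < s \<and> s < x) \<and>
      f x = (\<Sum>m<2. d m t / fact m * (x - t) ^ m) + d 2 s / fact 2 * (x - t) ^ 2"
    proof (rule Taylor[where a = "min x t" and b = "max x t"])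
      show "\<forall>m y. m < 2 \<and> min x t \<le> y \<and> y \<le> max x t \<longrightarrow> (d m has_real_derivative d (Suc m) y) (at y)"
      proof (intro allI impI)
        fix m :: nat and y assume m: "m < 2 \<and> min x t \<le> y \<and> y \<le> max x t"
        then have "\<bar>y - t\<bar> \<le> \<bar>x - t\<bar>" by (auto simp: min_def max_def split: if_splits)
        then have "dist y t < \<delta>" using x by (simp add: dist_real_def)
        from D[OF this] m show "(d m has_real_derivative d (Suc m) y) (at y)"
          by (auto simp: d_def less_2_cases_iff DERIV_deriv_iff_real_differentiable)
      qed
    qed (use x in \<open>auto simp: d_def\<close>)
    then obtain s where s: "if x < t then x < s \<and> s < t else t < s \<and> s < x"
      "f x = (\<Sum>m<2. d m t / fact m * (x - t) ^ m) + d 2 s / fact 2 * (x - t) ^ 2" by blast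
    have "\<bar>s - t\<bar> \<le> \<bar>x - t\<bar>" using s(1) by (auto split: if_splits)
    moreover have "f x - f t - deriv f t * (x - t) = deriv (deriv f) s / 2 * (x - t)\<^sup>2"
      using s(2) by (simp add: d_def numeral_2_eq_2)
    ultimately show ?thesis by blast
  qed
  show ?thesis unfolding continuous_at_eps_delta
  proof (intro allI impI)
    fix \<epsilon> :: real assume "0 < \<epsilon>"
    then obtain \<rho> where \<rho>: "0 < \<rho>" "\<And>x. dist x t < \<rho> \<Longrightarrow> dist (deriv (deriv f) x) (deriv (deriv f) t) < \<epsilon>"
      using cont unfolding continuous_at_eps_delta by blast
    show "\<exists>\<gamma>>0. \<forall>x. dist x t < \<gamma> \<longrightarrow> dist (?a x) (?a t) < \<epsilon>"
    proof (intro exI[of _ "min \<delta> \<rho>"] conjI allI impI)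
      fix x assume x: "dist x t < min \<delta> \<rho>"
      show "dist (?a x) (?a t) < \<epsilon>"
      proof (cases "x = t")
        case False
        with x taylor[of x] obtain s where s: "\<bar>s - t\<bar> \<le> \<bar>x - t\<bar>"
          "f x - f t - deriv f t * (x - t) = deriv (deriv f) s / 2 * (x - t)\<^sup>2" by (auto simp: dist_real_def)
        have eq: "?a x = deriv (deriv f) s / 2" using False s(2) by simp
        have "dist (deriv (deriv f) s) (deriv (deriv f) t) < \<epsilon>"
          using s(1) x by (intro \<rho>(2)) (simp add: dist_real_def)
        then show ?thesis unfolding eq by (simp add: dist_real_def)
      qed (use \<open>0 < \<epsilon>\<close> in simp)
    qed (use \<delta> \<rho> in simp)
  qed
qed

context smooth_kernel_fun
begin

lemma integral_rescaled_kernel_lborel: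
  assumes "0 < h"
  shows "(LINT u|lborel. f u * rescaled_kernel k h (t - u)) = (LINT v|lborel. k v * f (t - h * v))"
proof -
  have "(LINT u|lborel. f u * rescaled_kernel k h (t - u)) =
      \<bar>- h\<bar> *\<^sub>R (LINT v|lborel. f (t + (- h) * v) * rescaled_kernel k h (t - (t + (- h) * v)))"
    by (rule lborel_integral_real_affine) (use assms in simp)
  also have "\<dots> = h * (LINT v|lborel. (k v * f (t - h * v)) / h)"
    using assms by (simp add: rescaled_kernel_def mult.commute)
  also have "\<dots> = (LINT v|lborel. k v * f (t - h * v))"
    unfolding Bochner_Integration.integral_divide_zero using assms by simp
  finally show ?thesis .
qed

text \<open>In the second-order expansion of \<open>f\<close> at \<open>t\<close> the constant term reproduces
  \<open>f t\<close>, the linear term vanishes by the symmetry of the kernel, and the quadratic term is a local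
  average of the Taylor quotient.\<close>

lemma kernel_bias_tendsto:
  fixes f :: "real \<Rightarrow> real" and h :: "nat \<Rightarrow> real"
  assumes [measurable]: "f \<in> borel_measurable borel"
    and diff: "\<forall>\<^sub>F x in nhds t. f differentiable (at x) \<and> deriv f differentiable (at x)"
    and cont: "isCont (deriv (deriv f)) t"
    and h: "h \<longlonglongrightarrow> 0" and h_pos: "\<forall>\<^sub>F n in sequentially. 0 < h n"
  shows "(\<lambda>n. ((LINT u|lborel. f u * rescaled_kernel k (h n) (t - u)) - f t) / (h n)\<^sup>2)
     \<longlonglongrightarrow> 1 / 2 * second_moment k * deriv (deriv f) t"
proof -
  define a where "a x = (if x = t then deriv (deriv f) t / 2 else (f x - f t - deriv f t * (x - t)) / (x - t)\<^sup>2)" for x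
  have am: "a \<in> borel_measurable borel" unfolding a_def[abs_def] by measurable
  have a: "isCont a t" unfolding a_def[abs_def] by (rule second_order_remainder[OF diff cont])
  have f_eq: "f x = f t + deriv f t * (x - t) + (x - t)\<^sup>2 * a x" for x by (simp add: a_def)
  define w where "w v = v\<^sup>2 * k v" for v
  have w: "continuous_on UNIV w" "\<And>u. 1 < \<bar>u\<bar> \<Longrightarrow> w u = 0"
    using k_outside by (auto simp: w_def[abs_def] intro!: continuous_intros k_cont)
  note lim = local_average_tendsto[OF w am a h]
  have c1: "continuous_on UNIV (\<lambda>v. v * k v)" by (intro continuous_intros k_cont)
  have i1: "integrable lborel (\<lambda>v. v * k v)"
    by (rule integrable_lborel_continuous_compact_support[OF c1, of "-1" 1]) (use k_outside in \<open>auto simp: abs_real_def\<close>)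
  have "(\<lambda>n. LINT v|lborel. w v * a (t - h n * v)) \<longlonglongrightarrow> (LINT v|lborel. w v) * a t" by (rule lim(1))
  also have "(LINT v|lborel. w v) * a t = 1 / 2 * second_moment k * deriv (deriv f) t"
    by (simp add: w_def second_moment_def a_def)
  finally have lim1: "(\<lambda>n. LINT v|lborel. w v * a (t - h n * v)) \<longlonglongrightarrow> 1 / 2 * second_moment k * deriv (deriv f) t" .
  have "\<forall>\<^sub>F n in sequentially. integrable lborel (\<lambda>v. w v * a (t - h n * v))" by (rule lim(2))
  then have ev: "\<forall>\<^sub>F n in sequentially. (LINT v|lborel. w v * a (t - h n * v)) =
      ((LINT u|lborel. f u * rescaled_kernel k (h n) (t - u)) - f t) / (h n)\<^sup>2"
    using h_pos
  proof eventually_elim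
    case (elim n)
    have "(LINT u|lborel. f u * rescaled_kernel k (h n) (t - u)) = (LINT v|lborel. k v * f (t - h n * v))"
      by (rule integral_rescaled_kernel_lborel[OF elim(2)])
    also have "\<dots> = (LINT v|lborel. f t * k v - (deriv f t * h n) * (v * k v) + (h n)\<^sup>2 * (w v * a (t - h n * v)))"
    proof (intro Bochner_Integration.integral_cong refl)
      fix v
      show "k v * f (t - h n * v) = f t * k v - (deriv f t * h n) * (v * k v) + (h n)\<^sup>2 * (w v * a (t - h n * v))"
        by (subst f_eq) (simp add: w_def algebra_simps power2_eq_square)
    qed
    also have "\<dots> = f t * 1 - (deriv f t * h n) * 0 + (h n)\<^sup>2 * (LINT v|lborel. w v * a (t - h n * v))"
      using k_integrable i1 elim(1) by (simp add: k_integral k_first_moment)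
    finally show ?case using elim(2) by (simp add: field_simps)
  qed
  show ?thesis by (rule Lim_transform_eventually[OF lim1 ev])
qed

end

section \<open>Measurability and deviation bounds\<close>

lemma measurable_insort_key:
  fixes f :: "'a \<Rightarrow> nat \<Rightarrow> real"
  assumes [measurable]: "\<And>i. (\<lambda>\<omega>. f \<omega> i) \<in> borel_measurable M"
  shows "(\<lambda>\<omega>. insort_key (f \<omega>) a xs) \<in> M \<rightarrow>\<^sub>M count_space UNIV"
proof (induction xs)
  case (Cons y ys)
  have [measurable]: "(\<lambda>\<omega>. y # insort_key (f \<omega>) a ys) \<in> M \<rightarrow>\<^sub>M count_space UNIV"
    using measurable_compose[OF Cons, of "Cons y" "count_space UNIV"] by simp
  have "(\<lambda>\<omega>. if f \<omega> a \<le> f \<omega> y then a # y # ys else y # insort_key (f \<omega>) a ys) \<in> M \<rightarrow>\<^sub>M count_space UNIV"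
    by measurable
  then show ?case by simp
qed simp

lemma measurable_sort_key:
  fixes f :: "'a \<Rightarrow> nat \<Rightarrow> real"
  assumes f: "\<And>i. (\<lambda>\<omega>. f \<omega> i) \<in> borel_measurable M"
  shows "(\<lambda>\<omega>. sort_key (f \<omega>) xs) \<in> M \<rightarrow>\<^sub>M count_space UNIV"
proof (induction xs)
  case (Cons a xs)
  have "(\<lambda>\<omega>. (\<lambda>ys \<omega>. insort_key (f \<omega>) a ys) (sort_key (f \<omega>) xs) \<omega>) \<in> M \<rightarrow>\<^sub>M count_space UNIV"
    by (rule measurable_compose_countable[OF measurable_insort_key[OF f] Cons])
  then show ?case by simp
qed (simp add: sort_key_def)

lemma measurable_sorted_index:
  fixes f :: "'a \<Rightarrow> nat \<Rightarrow> real"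
  assumes f: "\<And>i. (\<lambda>\<omega>. f \<omega> i) \<in> borel_measurable M"
  shows "(\<lambda>\<omega>. sorted_index (f \<omega>) n l) \<in> M \<rightarrow>\<^sub>M count_space UNIV"
  unfolding sorted_index_def by (rule measurable_compose[OF measurable_sort_key[OF f]]) simp

lemma measurable_at_sorted_index:
  fixes f g :: "'a \<Rightarrow> nat \<Rightarrow> real"
  assumes f: "\<And>i. (\<lambda>\<omega>. f \<omega> i) \<in> borel_measurable M" and g: "\<And>i. (\<lambda>\<omega>. g \<omega> i) \<in> borel_measurable M"
  shows "(\<lambda>\<omega>. g \<omega> (sorted_index (f \<omega>) n l)) \<in> borel_measurable M"
  by (rule measurable_compose_countable[OF g measurable_sorted_index[OF f]])

lemma measurable_obs_count:
  fixes f :: "'a \<Rightarrow> nat \<Rightarrow> real"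
  assumes [measurable]: "\<And>i. (\<lambda>\<omega>. f \<omega> i) \<in> borel_measurable M" "u \<in> borel_measurable M"
  shows "(\<lambda>\<omega>. obs_count (f \<omega>) n (u \<omega>)) \<in> M \<rightarrow>\<^sub>M count_space UNIV"
proof -
  have "obs_count (f \<omega>) n (u \<omega>) = (\<Sum>i<n. if f \<omega> i \<le> u \<omega> then 1 else 0)" for \<omega>
    by (simp add: obs_count_def sum.If_cases Int_def)
  then show ?thesis by simp
qed

lemma gcm_node_cong:
  assumes "\<And>j. j \<le> n \<Longrightarrow> s j = s' j"
  shows "gcm_node s n i = gcm_node s' n i"
proof -
  have "cusum s n = cusum s' n" unfolding cusum_def using assms by (intro image_cong) auto
  then show ?thesis by (simp add: gcm_node_def)
qed

lemma measurable_map_bool_list: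
  assumes P[measurable]: "\<And>l. Measurable.pred M (P l)"
  shows "(\<lambda>\<omega>. map (\<lambda>l. P l \<omega>) ls) \<in> M \<rightarrow>\<^sub>M count_space UNIV"
proof (induction ls)
  case (Cons l ls)
  have [measurable]: "(\<lambda>\<omega>. b # map (\<lambda>l. P l \<omega>) ls) \<in> M \<rightarrow>\<^sub>M count_space UNIV" for b
    using measurable_compose[OF Cons, of "Cons b" "count_space UNIV"] by simp
  have "(\<lambda>\<omega>. if P l \<omega> then True # map (\<lambda>l. P l \<omega>) ls else False # map (\<lambda>l. P l \<omega>) ls)
      \<in> M \<rightarrow>\<^sub>M count_space UNIV" by measurable
  also have "(\<lambda>\<omega>. if P l \<omega> then True # map (\<lambda>l. P l \<omega>) ls else False # map (\<lambda>l. P l \<omega>) ls) =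
      (\<lambda>\<omega>. map (\<lambda>l. P l \<omega>) (l # ls))" by (auto simp: fun_eq_iff)
  finally show ?case .
qed simp

text \<open>The estimator depends on the sample only through the pattern of sorted indicators and the count of
  observations, both of which take countably many values.\<close>

lemma measurable_npmle:
  fixes f x :: "'a \<Rightarrow> nat \<Rightarrow> real"
  assumes f: "\<And>i. (\<lambda>\<omega>. f \<omega> i) \<in> borel_measurable M" and x: "\<And>i. (\<lambda>\<omega>. x \<omega> i) \<in> borel_measurable M"
    and u: "u \<in> borel_measurable M"
  shows "(\<lambda>\<omega>. npmle (f \<omega>) (\<lambda>i. of_bool (x \<omega> i \<le> f \<omega> i)) n (u \<omega>)) \<in> borel_measurable M"
proof -
  note [measurable] = f x u
  define pat where "pat \<omega> = map (\<lambda>l. x \<omega> (sorted_index (f \<omega>) n l) \<le> f \<omega> (sorted_index (f \<omega>) n l)) [0..<n]" for \<omega>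
  define \<Psi> where "\<Psi> bs i = (if i = 0 then 0 else gcm_slope (\<lambda>j. \<Sum>l<j. of_bool (bs ! l)) n i)" for bs :: "bool list" and i
  have [measurable]: "(\<lambda>\<omega>. x \<omega> (sorted_index (f \<omega>) n l)) \<in> borel_measurable M"
    "(\<lambda>\<omega>. f \<omega> (sorted_index (f \<omega>) n l)) \<in> borel_measurable M" for l
    by (rule measurable_at_sorted_index[OF f x], rule measurable_at_sorted_index[OF f f])
  have pat: "pat \<in> M \<rightarrow>\<^sub>M count_space UNIV"
    unfolding pat_def[abs_def] by (rule measurable_map_bool_list) measurable
  have N: "(\<lambda>\<omega>. obs_count (f \<omega>) n (u \<omega>)) \<in> M \<rightarrow>\<^sub>M count_space UNIV" by (rule measurable_obs_count[OF f u])
  have "(\<lambda>\<omega>. \<Psi> (pat \<omega>) (obs_count (f \<omega>) n (u \<omega>))) \<in> borel_measurable M"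
    by (rule measurable_compose_countable[OF _ pat], rule measurable_compose[OF N]) simp
  moreover have "npmle (f \<omega>) (\<lambda>i. of_bool (x \<omega> i \<le> f \<omega> i)) n (u \<omega>) = \<Psi> (pat \<omega>) (obs_count (f \<omega>) n (u \<omega>))" for \<omega>
  proof -
    have "status_sum (f \<omega>) (\<lambda>i. of_bool (x \<omega> i \<le> f \<omega> i)) n j = (\<Sum>l<j. of_bool (pat \<omega> ! l))" if "j \<le> n" for j
      unfolding status_sum_def using that by (intro sum.cong) (auto simp: pat_def)
    then show ?thesis
      by (simp add: npmle_eq_gcm_slope \<Psi>_def gcm_slope_def cong: gcm_node_cong)
  qed
  ultimately show ?thesis by simp
qed

text \<open>Serves both deviation bounds: with thresholds that vary over the index set (the times, when these are held
  fixed) and with a constant threshold.\<close>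

lemma (in prob_space) indicator_sum_deviation:
  fixes Y :: "'i \<Rightarrow> 'a \<Rightarrow> real"
  assumes indep: "indep_vars (\<lambda>_. borel) Y I" and I: "finite I" "I \<noteq> {}" and lam: "0 \<le> lam"
    and F: "\<And>i. i \<in> I \<Longrightarrow> cdf (distr M borel (Y i)) = F"
  shows "prob {\<omega>\<in>space M. lam * sqrt (card I) < \<bar>\<Sum>i\<in>I. of_bool (Y i \<omega> \<le> c i) - F (c i)\<bar>} \<le> 2 * exp (- 2 * lam\<^sup>2)"
proof -
  have rv[measurable]: "random_variable borel (Y i)" if "i \<in> I" for i using indep that by (auto simp: indep_vars_def)
  define Z where "Z i \<omega> = (of_bool (Y i \<omega> \<le> c i) :: real)" for i \<omega>
  have Z_eq: "Z i = (\<lambda>\<omega>. indicator {..c i} (Y i \<omega>))" for i by (auto simp: Z_def fun_eq_iff indicator_def)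
  have ind: "indep_vars (\<lambda>_. borel) Z I"
    unfolding Z_eq by (rule indep_vars_compose2[OF indep]) simp
  interpret Hoeffding_ineq M I Z "\<lambda>_. 0" "\<lambda>_. 1" "\<Sum>i\<in>I. expectation (Z i)"
    by unfold_locales (use I ind in \<open>auto simp: Z_def\<close>)
  have EZ: "expectation (Z i) = F (c i)" if i: "i \<in> I" for i
  proof -
    have "expectation (Z i) = (LINT y|distr M borel (Y i). indicator {..c i} y)"
      unfolding Z_eq using rv[OF i] by (subst integral_distr) auto
    also have "\<dots> = F (c i)" using F[OF i] by (simp add: cdf_def fun_eq_iff)
    finally show ?thesis .
  qed
  have card: "0 < real (card I)" using I by (simp add: card_gt_0_iff)
  have "prob {\<omega>\<in>space M. lam * sqrt (card I) < \<bar>\<Sum>i\<in>I. of_bool (Y i \<omega> \<le> c i) - F (c i)\<bar>}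
      \<le> prob {\<omega>\<in>space M. \<bar>(\<Sum>i\<in>I. Z i \<omega>) - (\<Sum>i\<in>I. expectation (Z i))\<bar> \<ge> lam * sqrt (card I)}"
  proof (rule finite_measure_mono)
    show "{\<omega>\<in>space M. lam * sqrt (card I) < \<bar>\<Sum>i\<in>I. of_bool (Y i \<omega> \<le> c i) - F (c i)\<bar>} \<subseteq>
      {\<omega>\<in>space M. \<bar>(\<Sum>i\<in>I. Z i \<omega>) - (\<Sum>i\<in>I. expectation (Z i))\<bar> \<ge> lam * sqrt (card I)}"
      by (auto simp: Z_def EZ sum_subtractf cong: sum.cong)
  qed measurable
  also have "\<dots> \<le> 2 * exp (- 2 * (lam * sqrt (card I))\<^sup>2 / (\<Sum>i\<in>I. (1 - 0)\<^sup>2))"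
    by (rule Hoeffding_ineq_abs_ge) (use lam card in auto)
  also have "\<dots> = 2 * exp (- 2 * lam\<^sup>2)" using card by (simp add: power_mult_distrib)
  finally show ?thesis .
qed

text \<open>All partial sums of centred indicators over consecutive sorted positions, for observations
  \<open>x\<close> and times \<open>\<tau>\<close>, are of the order of their standard deviation.\<close>

definition windows_ok :: "(real \<Rightarrow> real) \<Rightarrow> real \<Rightarrow> nat \<Rightarrow> (nat \<Rightarrow> real) \<Rightarrow> (nat \<Rightarrow> real) \<Rightarrow> bool" where
  "windows_ok F lam n x \<tau> \<longleftrightarrow> (\<forall>a\<le>n. \<forall>b\<le>n. a \<le> b \<longrightarrow>
     \<bar>\<Sum>l = a..<b. of_bool (x (sorted_index \<tau> n l) \<le> \<tau> (sorted_index \<tau> n l)) - F (\<tau> (sorted_index \<tau> n l))\<bar>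
       \<le> lam * sqrt (real (b - a)))"

text \<open>For fixed times the sorting permutation is fixed, so a window is a fixed set of independent
  indicators.\<close>

lemma (in prob_space) windows_fixed_times:
  fixes X :: "nat \<Rightarrow> 'a \<Rightarrow> real"
  assumes indep: "indep_vars (\<lambda>_. borel) X UNIV" and lam: "0 \<le> lam"
    and F: "\<And>i. cdf (distr M borel (X i)) = F"
  shows "{\<omega>\<in>space M. \<not> windows_ok F lam n (\<lambda>i. X i \<omega>) \<tau>} \<in> events" (is "?B \<in> _")
    and "prob {\<omega>\<in>space M. \<not> windows_ok F lam n (\<lambda>i. X i \<omega>) \<tau>} \<le> (real n + 1)\<^sup>2 * (2 * exp (- 2 * lam\<^sup>2))"
proof -
  have [measurable]: "random_variable borel (X i)" for i using indep by (auto simp: indep_vars_def)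
  show "?B \<in> events" unfolding windows_ok_def by measurable
  let ?\<sigma> = "sorted_index \<tau> n"
  define W where "W ab = {\<omega>\<in>space M. lam * sqrt (card (?\<sigma> ` {fst ab..<snd ab})) <
      \<bar>\<Sum>i\<in>?\<sigma> ` {fst ab..<snd ab}. of_bool (X i \<omega> \<le> \<tau> i) - F (\<tau> i)\<bar>}" for ab
  define P where "P = {ab. fst ab < snd ab \<and> snd ab \<le> n}"
  have P_sub: "P \<subseteq> {..n} \<times> {..n}" by (auto simp: P_def)
  then have P: "finite P" by (rule finite_subset) simp
  have inj: "inj_on ?\<sigma> {a..<b}" if "b \<le> n" for a b
    using bij_betw_imp_inj_on[OF sorted_index_bij[of \<tau> n]] by (rule inj_on_subset) (use that in auto)
  have "?B \<subseteq> (\<Union>ab\<in>P. W ab)"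
  proof
    fix \<omega> assume "\<omega> \<in> ?B"
    then obtain a b where ab: "\<omega> \<in> space M" "b \<le> n" "a \<le> b"
      "\<not> \<bar>\<Sum>l = a..<b. of_bool (X (?\<sigma> l) \<omega> \<le> \<tau> (?\<sigma> l)) - F (\<tau> (?\<sigma> l))\<bar> \<le> lam * sqrt (real (b - a))"
      by (auto simp: windows_ok_def)
    have "a \<noteq> b" using ab(4) by auto
    then have "(a, b) \<in> P" using ab by (simp add: P_def)
    moreover have "\<omega> \<in> W (a, b)"
      using ab inj[OF ab(2), of a] by (simp add: W_def card_image sum.reindex)
    ultimately show "\<omega> \<in> (\<Union>ab\<in>P. W ab)" by blast
  qed
  then have "prob ?B \<le> prob (\<Union>ab\<in>P. W ab)"
    by (rule finite_measure_mono) (auto simp: W_def P intro!: sets.finite_UN)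
  also have "\<dots> \<le> (\<Sum>ab\<in>P. prob (W ab))"
    by (rule finite_measure_subadditive_finite[OF P]) (auto simp: W_def)
  also have "\<dots> \<le> (\<Sum>ab\<in>P. 2 * exp (- 2 * lam\<^sup>2))"
  proof (rule sum_mono)
    fix ab assume "ab \<in> P"
    then show "prob (W ab) \<le> 2 * exp (- 2 * lam\<^sup>2)"
      unfolding W_def
      by (intro indicator_sum_deviation indep_vars_subset[OF indep] lam F) (auto simp: P_def)
  qed
  also have "\<dots> = real (card P) * (2 * exp (- 2 * lam\<^sup>2))" by simp
  also have "\<dots> \<le> (real n + 1)\<^sup>2 * (2 * exp (- 2 * lam\<^sup>2))"
  proof (rule mult_right_mono)
    have "card P \<le> card ({..n} \<times> {..n})" using P_sub by (intro card_mono) auto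
    then have "real (card P) \<le> real (card ({..n} \<times> {..n}))" by (rule of_nat_mono)
    then show "real (card P) \<le> (real n + 1)\<^sup>2" by (simp add: card_cartesian_product power2_eq_square algebra_simps)
  qed simp
  finally show "prob ?B \<le> (real n + 1)\<^sup>2 * (2 * exp (- 2 * lam\<^sup>2))" .
qed

section \<open>The current status model\<close>

lemma real_distribution_eq_interval_measure:
  assumes "real_distribution N"
  shows "N = interval_measure (cdf N)"
proof -
  interpret N: real_distribution N by fact
  have "real_distribution (interval_measure (cdf N))" "cdf (interval_measure (cdf N)) = cdf N"
    using N.cdf_nondecreasing N.cdf_is_right_cont N.cdf_lim_at_bot N.cdf_lim_at_top_prob
    by (auto intro!: real_distribution_interval_measure cdf_interval_measure)
  then show ?thesis using cdf_unique[OF assms] by metis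
qed

locale current_status = prob_space M for M :: "'a measure" +
  fixes X T :: "nat \<Rightarrow> 'a \<Rightarrow> real" and F0 G :: "real \<Rightarrow> real"
  assumes model: "current_status_model M X T F0 G"
begin

lemma X_indep: "indep_vars (\<lambda>_. borel) X UNIV" and T_indep: "indep_vars (\<lambda>_. borel) T UNIV"
  and XT_indep: "indep_var (Pi\<^sub>M UNIV (\<lambda>_. borel)) (\<lambda>\<omega> i. X i \<omega>) (Pi\<^sub>M UNIV (\<lambda>_. borel)) (\<lambda>\<omega> i. T i \<omega>)"
  and cdf_X: "cdf (distr M borel (X i)) = F0" and cdf_T: "cdf (distr M borel (T i)) = G"
  and F0_neg: "x < 0 \<Longrightarrow> F0 x = 0"
  using model by (auto simp: current_status_model_def)

lemma X_rv[measurable]: "random_variable borel (X i)" and T_rv[measurable]: "random_variable borel (T i)"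
  using X_indep T_indep by (auto simp: indep_vars_def)

lemma real_distribution_X: "real_distribution (distr M borel (X i))"
  and real_distribution_T: "real_distribution (distr M borel (T i))"
  by (auto intro: real_distribution_distr)

lemma distr_X: "distr M borel (X i) = interval_measure F0"
  using real_distribution_eq_interval_measure[OF real_distribution_X] by (simp add: cdf_X)

lemma distr_T: "distr M borel (T i) = interval_measure G"
  using real_distribution_eq_interval_measure[OF real_distribution_T] by (simp add: cdf_T)

lemma F0_cdf: "\<And>x y. x \<le> y \<Longrightarrow> F0 x \<le> F0 y" "\<And>x. continuous (at_right x) F0" "(F0 \<longlongrightarrow> 0) at_bot"
  "\<And>x. 0 \<le> F0 x" "\<And>x. F0 x \<le> 1" "(F0 \<longlongrightarrow> 1) at_top"
proof -
  interpret X: real_distribution "distr M borel (X 0)" by (rule real_distribution_X)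
  show "\<And>x y. x \<le> y \<Longrightarrow> F0 x \<le> F0 y" "\<And>x. continuous (at_right x) F0" "(F0 \<longlongrightarrow> 0) at_bot"
    "\<And>x. 0 \<le> F0 x" "\<And>x. F0 x \<le> 1" "(F0 \<longlongrightarrow> 1) at_top"
    using X.cdf_nondecreasing X.cdf_is_right_cont X.cdf_lim_at_bot X.cdf_nonneg X.cdf_bounded_prob X.cdf_lim_at_top_prob
    unfolding cdf_X by auto
qed

lemma G_cdf: "\<And>x y. x \<le> y \<Longrightarrow> G x \<le> G y" "\<And>x. 0 \<le> G x" "\<And>x. G x \<le> 1"
proof -
  interpret T: real_distribution "distr M borel (T 0)" by (rule real_distribution_T)
  show "\<And>x y. x \<le> y \<Longrightarrow> G x \<le> G y" "\<And>x. 0 \<le> G x" "\<And>x. G x \<le> 1"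
    using T.cdf_nondecreasing T.cdf_nonneg T.cdf_bounded_prob unfolding cdf_T by auto
qed

text \<open>The observations and the times are independent as sequences; hence the bound for fixed times integrates
  over their law.\<close>

lemma windows_deviation:
  assumes lam: "0 \<le> lam"
  shows "{\<omega>\<in>space M. \<not> windows_ok F0 lam n (\<lambda>i. X i \<omega>) (\<lambda>i. T i \<omega>)} \<in> events" (is "?B \<in> _")
    and "prob {\<omega>\<in>space M. \<not> windows_ok F0 lam n (\<lambda>i. X i \<omega>) (\<lambda>i. T i \<omega>)}
        \<le> (real n + 1)\<^sup>2 * (2 * exp (- 2 * lam\<^sup>2))"
proof -
  let ?S = "Pi\<^sub>M UNIV (\<lambda>_. borel) :: (nat \<Rightarrow> real) measure"
  let ?c = "(real n + 1)\<^sup>2 * (2 * exp (- 2 * lam\<^sup>2))"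
  have [measurable]: "F0 \<in> borel_measurable borel" by (rule borel_measurable_mono) (simp add: F0_cdf monoI)
  have Xs[measurable]: "(\<lambda>\<omega> i. X i \<omega>) \<in> M \<rightarrow>\<^sub>M ?S" and Ts[measurable]: "(\<lambda>\<omega> i. T i \<omega>) \<in> M \<rightarrow>\<^sub>M ?S"
    using indep_var_rv1[OF XT_indep] indep_var_rv2[OF XT_indep] by auto
  define A where "A = {z \<in> space (?S \<Otimes>\<^sub>M ?S). \<not> windows_ok F0 lam n (fst z) (snd z)}"
  have A[measurable]: "A \<in> sets (?S \<Otimes>\<^sub>M ?S)"
  proof -
    have c: "(\<lambda>z. fst z i) \<in> borel_measurable (?S \<Otimes>\<^sub>M ?S)" "(\<lambda>z. snd z i) \<in> borel_measurable (?S \<Otimes>\<^sub>M ?S)" for i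
      by measurable
    have [measurable]: "(\<lambda>z. fst z (sorted_index (snd z) n l)) \<in> borel_measurable (?S \<Otimes>\<^sub>M ?S)"
      "(\<lambda>z. snd z (sorted_index (snd z) n l)) \<in> borel_measurable (?S \<Otimes>\<^sub>M ?S)" for l
      by (rule measurable_at_sorted_index[OF c(2) c(1)], rule measurable_at_sorted_index[OF c(2) c(2)])
    show ?thesis unfolding A_def windows_ok_def by measurable
  qed
  have eq: "?B = (\<lambda>\<omega>. (\<lambda>i. X i \<omega>, \<lambda>i. T i \<omega>)) -` A \<inter> space M"
    by (auto simp: A_def space_pair_measure space_PiM)
  show "?B \<in> events" unfolding eq by measurable
  interpret XM: prob_space "distr M ?S (\<lambda>\<omega> i. X i \<omega>)" by (rule prob_space_distr) measurable
  interpret TM: prob_space "distr M ?S (\<lambda>\<omega> i. T i \<omega>)" by (rule prob_space_distr) measurable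
  interpret P: pair_sigma_finite "distr M ?S (\<lambda>\<omega> i. X i \<omega>)" "distr M ?S (\<lambda>\<omega> i. T i \<omega>)" ..
  have A': "A \<in> sets (distr M ?S (\<lambda>\<omega> i. X i \<omega>) \<Otimes>\<^sub>M distr M ?S (\<lambda>\<omega> i. T i \<omega>))"
    using A by (simp cong: sets_pair_measure_cong)
  have "emeasure M ?B = emeasure (distr M (?S \<Otimes>\<^sub>M ?S) (\<lambda>\<omega>. (\<lambda>i. X i \<omega>, \<lambda>i. T i \<omega>))) A"
    unfolding eq by (rule emeasure_distr[symmetric]) measurable
  also have "\<dots> = emeasure (distr M ?S (\<lambda>\<omega> i. X i \<omega>) \<Otimes>\<^sub>M distr M ?S (\<lambda>\<omega> i. T i \<omega>)) A"
    using XT_indep unfolding indep_var_distribution_eq by simp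
  also have "\<dots> = (\<integral>\<^sup>+\<tau>. emeasure (distr M ?S (\<lambda>\<omega> i. X i \<omega>)) ((\<lambda>x. (x, \<tau>)) -` A) \<partial>distr M ?S (\<lambda>\<omega> i. T i \<omega>))"
    by (rule P.emeasure_pair_measure_alt2[OF A'])
  also have "\<dots> \<le> (\<integral>\<^sup>+\<tau>. ennreal ?c \<partial>distr M ?S (\<lambda>\<omega> i. T i \<omega>))"
  proof (rule nn_integral_mono)
    fix \<tau> :: "nat \<Rightarrow> real"
    have [measurable]: "(\<lambda>x. (x, \<tau>)) -` A \<in> sets ?S"
      using measurable_sets[OF measurable_Pair2' A, of \<tau>] by (simp add: space_PiM)
    have "emeasure (distr M ?S (\<lambda>\<omega> i. X i \<omega>)) ((\<lambda>x. (x, \<tau>)) -` A) =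
        emeasure M ((\<lambda>\<omega> i. X i \<omega>) -` ((\<lambda>x. (x, \<tau>)) -` A) \<inter> space M)"
      by (rule emeasure_distr) measurable
    also have "(\<lambda>\<omega> i. X i \<omega>) -` ((\<lambda>x. (x, \<tau>)) -` A) \<inter> space M =
        {\<omega>\<in>space M. \<not> windows_ok F0 lam n (\<lambda>i. X i \<omega>) \<tau>}"
      by (auto simp: A_def space_pair_measure space_PiM)
    also have "emeasure M \<dots> \<le> ennreal ?c"
      unfolding emeasure_eq_measure
      by (intro ennreal_leI windows_fixed_times(2)[OF X_indep lam cdf_X])
    finally show "emeasure (distr M ?S (\<lambda>\<omega> i. X i \<omega>)) ((\<lambda>x. (x, \<tau>)) -` A) \<le> ennreal ?c" .
  qed
  also have "\<dots> = ennreal ?c" by (simp add: TM.emeasure_space_1[simplified])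
  finally show "prob ?B \<le> ?c" unfolding emeasure_eq_measure by (subst (asm) ennreal_le_iff) auto
qed

lemma grid_deviation:
  fixes y :: "nat \<Rightarrow> real"
  assumes lam: "0 \<le> lam" and n: "0 < n"
  shows "{\<omega>\<in>space M. \<exists>j\<le>n. lam / sqrt n < \<bar>real (obs_count (\<lambda>i. T i \<omega>) n (y j)) / n - G (y j)\<bar>} \<in> events" (is "?B \<in> _")
    and "prob {\<omega>\<in>space M. \<exists>j\<le>n. lam / sqrt n < \<bar>real (obs_count (\<lambda>i. T i \<omega>) n (y j)) / n - G (y j)\<bar>}
      \<le> (real n + 1) * (2 * exp (- 2 * lam\<^sup>2))"
proof -
  define W where "W j = {\<omega>\<in>space M. lam * sqrt (card {..<n}) < \<bar>\<Sum>i<n. of_bool (T i \<omega> \<le> y j) - G (y j)\<bar>}" for j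
  have W[measurable]: "W j \<in> events" for j unfolding W_def by measurable
  have iff: "lam / sqrt n < \<bar>real (obs_count (\<lambda>i. T i \<omega>) n c) / n - G c\<bar> \<longleftrightarrow>
      lam * sqrt (card {..<n}) < \<bar>\<Sum>i<n. of_bool (T i \<omega> \<le> c) - G c\<bar>" for \<omega> c
  proof -
    have "(\<Sum>i<n. of_bool (T i \<omega> \<le> c) - G c) = real (obs_count (\<lambda>i. T i \<omega>) n c) - n * G c"
      by (simp add: obs_count_def sum_subtractf of_bool_def sum.If_cases Int_def)
    also have "\<dots> = n * (real (obs_count (\<lambda>i. T i \<omega>) n c) / n - G c)"
      using n by (simp add: right_diff_distrib)
    finally have "\<bar>\<Sum>i<n. of_bool (T i \<omega> \<le> c) - G c\<bar> = n * \<bar>real (obs_count (\<lambda>i. T i \<omega>) n c) / n - G c\<bar>"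
      by (simp add: abs_mult)
    moreover have "lam * sqrt (card {..<n}) = n * (lam / sqrt n)"
      using n by (simp add: field_simps)
    ultimately show ?thesis using n by (simp only: mult_less_cancel_left_pos of_nat_0_less_iff)
  qed
  have eq: "?B = (\<Union>j\<in>{..n}. W j)" unfolding iff W_def by auto
  show "?B \<in> events" unfolding eq by measurable
  have "prob ?B \<le> (\<Sum>j\<in>{..n}. prob (W j))"
    unfolding eq by (rule finite_measure_subadditive_finite) auto
  also have "\<dots> \<le> (\<Sum>j\<in>{..n}. 2 * exp (- 2 * lam\<^sup>2))"
    unfolding W_def using n
    by (intro sum_mono indicator_sum_deviation indep_vars_subset[OF T_indep] lam cdf_T) auto
  also have "\<dots> = (real n + 1) * (2 * exp (- 2 * lam\<^sup>2))" by simp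
  finally show "prob ?B \<le> (real n + 1) * (2 * exp (- 2 * lam\<^sup>2))" .
qed

lemma distr_T_pair:
  assumes "i \<noteq> j"
  shows "distr M (borel \<Otimes>\<^sub>M borel) (\<lambda>\<omega>. (T i \<omega>, T j \<omega>)) = distr M borel (T i) \<Otimes>\<^sub>M distr M borel (T j)"
proof -
  have "indep_var (PiM {i} (\<lambda>_. borel)) (\<lambda>\<omega>. restrict (\<lambda>i. T i \<omega>) {i}) (PiM {j} (\<lambda>_. borel)) (\<lambda>\<omega>. restrict (\<lambda>i. T i \<omega>) {j})"
    using assms by (intro indep_var_restrict[OF T_indep]) auto
  then have "indep_var borel ((\<lambda>x. x i) \<circ> (\<lambda>\<omega>. restrict (\<lambda>i. T i \<omega>) {i})) borel ((\<lambda>x. x j) \<circ> (\<lambda>\<omega>. restrict (\<lambda>i. T i \<omega>) {j}))"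
    by (rule indep_var_compose) auto
  then have "indep_var borel (T i) borel (T j)" by (simp add: comp_def)
  then show ?thesis unfolding indep_var_distribution_eq by simp
qed

text \<open>By Fubini's theorem the diagonal is a null set for the product of two laws without atoms.\<close>

lemma ties_null:
  assumes cont: "\<And>x. measure (interval_measure G) {x} = 0"
  shows "{\<omega>\<in>space M. \<not> inj_on (\<lambda>i. T i \<omega>) {..<n}} \<in> events"
    and "prob {\<omega>\<in>space M. \<not> inj_on (\<lambda>i. T i \<omega>) {..<n}} = 0"
proof -
  let ?P = "{ij. fst ij < n \<and> snd ij < n \<and> fst ij \<noteq> snd ij}"
  let ?W = "\<lambda>ij. {\<omega>\<in>space M. T (fst ij) \<omega> = T (snd ij) \<omega>}"
  have P: "finite ?P" by (rule finite_subset[of _ "{..<n} \<times> {..<n}"]) auto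
  have eq: "{\<omega>\<in>space M. \<not> inj_on (\<lambda>i. T i \<omega>) {..<n}} = (\<Union>ij\<in>?P. ?W ij)"
    by (auto simp: inj_on_def) blast
  show "{\<omega>\<in>space M. \<not> inj_on (\<lambda>i. T i \<omega>) {..<n}} \<in> events" unfolding eq using P by measurable
  have "prob (?W ij) = 0" if ij_P: "ij \<in> ?P" for ij
  proof -
    obtain i j where ij0: "ij = (i, j)" by (cases ij)
    then have ij: "ij = (i, j)" "i \<noteq> j" using ij_P by simp_all
    interpret Ti: real_distribution "distr M borel (T i)" by (rule real_distribution_T)
    interpret Tj: real_distribution "distr M borel (T j)" by (rule real_distribution_T)
    interpret P: pair_sigma_finite "distr M borel (T i)" "distr M borel (T j)" ..
    let ?D = "{z :: real \<times> real. fst z = snd z}"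
    have D[measurable]: "?D \<in> sets (borel \<Otimes>\<^sub>M borel)"
    proof -
      have "?D = {z \<in> space (borel \<Otimes>\<^sub>M borel). fst z = snd z}" by (auto simp: space_pair_measure)
      then show ?thesis by simp
    qed
    have "emeasure M (?W ij) = emeasure (distr M (borel \<Otimes>\<^sub>M borel) (\<lambda>\<omega>. (T i \<omega>, T j \<omega>))) ?D"
      by (subst emeasure_distr) (auto simp: ij intro!: arg_cong[where f = "emeasure M"])
    also have "\<dots> = emeasure (distr M borel (T i) \<Otimes>\<^sub>M distr M borel (T j)) ?D"
      by (simp add: distr_T_pair[OF ij(2)])
    also have "\<dots> = (\<integral>\<^sup>+y. emeasure (distr M borel (T i)) ((\<lambda>x. (x, y)) -` ?D) \<partial>distr M borel (T j))"
      by (rule P.emeasure_pair_measure_alt2) (use D in \<open>simp cong: sets_pair_measure_cong\<close>)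
    also have "\<dots> = (\<integral>\<^sup>+y. 0 \<partial>distr M borel (T j))"
    proof (rule nn_integral_cong)
      fix y :: real
      have "(\<lambda>x. (x, y)) -` ?D = {y}" by auto
      then show "emeasure (distr M borel (T i)) ((\<lambda>x. (x, y)) -` ?D) = 0"
        using cont[of y] Ti.emeasure_eq_measure[of "{y}"] by (simp add: distr_T)
    qed
    finally show ?thesis by (simp add: emeasure_eq_measure)
  qed
  then have "(\<Sum>ij\<in>?P. prob (?W ij)) = 0" by (intro sum.neutral) auto
  moreover have "prob (\<Union>ij\<in>?P. ?W ij) \<le> (\<Sum>ij\<in>?P. prob (?W ij))"
    using P by (intro finite_measure_subadditive_finite) auto
  ultimately show "prob {\<omega>\<in>space M. \<not> inj_on (\<lambda>i. T i \<omega>) {..<n}} = 0"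
    unfolding eq using measure_nonneg[of M "\<Union>ij\<in>?P. ?W ij"] by linarith
qed

text \<open>The law of the pair of sequences is a product, and so are the laws of the two sequences.\<close>

lemma XT_rectangle_prob:
  assumes J: "finite J" "J \<noteq> {}" and A: "\<And>j. j \<in> J \<Longrightarrow> A j \<in> sets borel" and B: "\<And>j. j \<in> J \<Longrightarrow> B j \<in> sets borel"
  shows "prob (\<Inter>j\<in>J. (\<lambda>\<omega>. (X j \<omega>, T j \<omega>)) -` (A j \<times> B j) \<inter> space M) =
     (\<Prod>j\<in>J. prob (X j -` A j \<inter> space M)) * (\<Prod>j\<in>J. prob (T j -` B j \<inter> space M))"
proof -
  let ?S = "Pi\<^sub>M UNIV (\<lambda>_. borel) :: (nat \<Rightarrow> real) measure"
  have cyl: "{x. \<forall>j\<in>J. x j \<in> A j} \<in> sets ?S" if "\<And>j. j \<in> J \<Longrightarrow> A j \<in> sets borel" for A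
  proof -
    have "{x. \<forall>j\<in>J. x j \<in> A j} = (\<Inter>j\<in>J. (\<lambda>x. x j) -` A j \<inter> space ?S)"
      using J by (auto simp: space_PiM)
    also have "\<dots> \<in> sets ?S" using J that by (intro sets.finite_INT measurable_sets[OF measurable_component_singleton]) auto
    finally show ?thesis .
  qed
  have "(\<Inter>j\<in>J. (\<lambda>\<omega>. (X j \<omega>, T j \<omega>)) -` (A j \<times> B j) \<inter> space M) =
     (\<lambda>\<omega>. (\<lambda>i. X i \<omega>, \<lambda>i. T i \<omega>)) -` ({x. \<forall>j\<in>J. x j \<in> A j} \<times> {x. \<forall>j\<in>J. x j \<in> B j}) \<inter> space M"
    using J by auto
  then have "prob (\<Inter>j\<in>J. (\<lambda>\<omega>. (X j \<omega>, T j \<omega>)) -` (A j \<times> B j) \<inter> space M) =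
     prob ((\<lambda>\<omega> i. X i \<omega>) -` {x. \<forall>j\<in>J. x j \<in> A j} \<inter> space M) * prob ((\<lambda>\<omega> i. T i \<omega>) -` {x. \<forall>j\<in>J. x j \<in> B j} \<inter> space M)"
    using indep_varD[OF XT_indep cyl[of A, OF A] cyl[of B, OF B]] by simp
  also have "(\<lambda>\<omega> i. X i \<omega>) -` {x. \<forall>j\<in>J. x j \<in> A j} \<inter> space M = (\<Inter>j\<in>J. X j -` A j \<inter> space M)" using J by auto
  also have "(\<lambda>\<omega> i. T i \<omega>) -` {x. \<forall>j\<in>J. x j \<in> B j} \<inter> space M = (\<Inter>j\<in>J. T j -` B j \<inter> space M)" using J by auto
  also have "prob (\<Inter>j\<in>J. X j -` A j \<inter> space M) = (\<Prod>j\<in>J. prob (X j -` A j \<inter> space M))"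
    using J A by (intro indep_varsD[OF X_indep]) auto
  also have "prob (\<Inter>j\<in>J. T j -` B j \<inter> space M) = (\<Prod>j\<in>J. prob (T j -` B j \<inter> space M))"
    using J B by (intro indep_varsD[OF T_indep]) auto
  finally show ?thesis .
qed

lemma pairs_indep: "indep_vars (\<lambda>_. borel \<Otimes>\<^sub>M borel) (\<lambda>i \<omega>. (X i \<omega>, T i \<omega>)) {..<n}"
proof (cases "n = 0")
  case False
  show ?thesis
  proof (rule iffD2[OF indep_vars_finite[where E = "\<lambda>_. {a \<times> b | a b. a \<in> sets (borel :: real measure) \<and> b \<in> sets (borel :: real measure)}"]])
    show "\<forall>C\<in>{..<n} \<rightarrow> {a \<times> b |a b. a \<in> sets (borel :: real measure) \<and> b \<in> sets (borel :: real measure)}.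
       prob (\<Inter>j\<in>{..<n}. (\<lambda>\<omega>. (X j \<omega>, T j \<omega>)) -` C j \<inter> space M) =
       (\<Prod>j\<in>{..<n}. prob ((\<lambda>\<omega>. (X j \<omega>, T j \<omega>)) -` C j \<inter> space M))"
    proof
      fix C assume "C \<in> {..<n} \<rightarrow> {a \<times> b |a b. a \<in> sets (borel :: real measure) \<and> b \<in> sets (borel :: real measure)}"
      then have "\<forall>j\<in>{..<n}. \<exists>a b. C j = a \<times> b \<and> a \<in> sets borel \<and> b \<in> sets borel" by (auto simp: Pi_iff)
      then obtain A B where AB: "\<And>j. j < n \<Longrightarrow> C j = A j \<times> B j" "\<And>j. j < n \<Longrightarrow> A j \<in> sets borel" "\<And>j. j < n \<Longrightarrow> B j \<in> sets borel"
        by (metis lessThan_iff)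
      have one: "prob ((\<lambda>\<omega>. (X j \<omega>, T j \<omega>)) -` C j \<inter> space M) =
          prob (X j -` A j \<inter> space M) * prob (T j -` B j \<inter> space M)" if "j < n" for j
        using XT_rectangle_prob[of "{j}" A B] AB that by simp
      have C: "(\<Inter>j\<in>{..<n}. (\<lambda>\<omega>. (X j \<omega>, T j \<omega>)) -` C j \<inter> space M) =
          (\<Inter>j\<in>{..<n}. (\<lambda>\<omega>. (X j \<omega>, T j \<omega>)) -` (A j \<times> B j) \<inter> space M)"
        using AB(1) by (intro INF_cong) auto
      have "(\<Prod>j\<in>{..<n}. prob ((\<lambda>\<omega>. (X j \<omega>, T j \<omega>)) -` C j \<inter> space M)) =
          (\<Prod>j\<in>{..<n}. prob (X j -` A j \<inter> space M)) * (\<Prod>j\<in>{..<n}. prob (T j -` B j \<inter> space M))"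
        unfolding prod.distrib[symmetric] by (intro prod.cong refl one) simp
      also have "\<dots> = prob (\<Inter>j\<in>{..<n}. (\<lambda>\<omega>. (X j \<omega>, T j \<omega>)) -` (A j \<times> B j) \<inter> space M)"
        by (rule XT_rectangle_prob[symmetric]) (use False AB in \<open>auto simp: lessThan_empty_iff\<close>)
      finally show "prob (\<Inter>j\<in>{..<n}. (\<lambda>\<omega>. (X j \<omega>, T j \<omega>)) -` C j \<inter> space M) =
         (\<Prod>j\<in>{..<n}. prob ((\<lambda>\<omega>. (X j \<omega>, T j \<omega>)) -` C j \<inter> space M))"
        unfolding C ..
    qed
    show "Int_stable {a \<times> b | a b. a \<in> sets (borel :: real measure) \<and> b \<in> sets (borel :: real measure)}"
      by (rule Int_stable_pair_measure_generator)
    show "sets (borel \<Otimes>\<^sub>M borel) = sigma_sets (space (borel \<Otimes>\<^sub>M borel))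
        {a \<times> b | a b. a \<in> sets (borel :: real measure) \<and> b \<in> sets (borel :: real measure)}"
      by (simp add: sets_pair_measure space_pair_measure)
    show "space (borel \<Otimes>\<^sub>M borel) \<in> {a \<times> b | a b. a \<in> sets (borel :: real measure) \<and> b \<in> sets (borel :: real measure)}"
      unfolding space_pair_measure by (rule CollectI, rule exI[of _ UNIV], rule exI[of _ UNIV]) simp
  qed (use False in \<open>auto simp: space_pair_measure\<close>)
qed (simp add: indep_vars_def2 indep_sets_def)

lemma distr_XT: "distr M (borel \<Otimes>\<^sub>M borel) (\<lambda>\<omega>. (X i \<omega>, T i \<omega>)) = interval_measure F0 \<Otimes>\<^sub>M interval_measure G"
proof -
  have "indep_var borel ((\<lambda>x. x i) \<circ> (\<lambda>\<omega> i. X i \<omega>)) borel ((\<lambda>x. x i) \<circ> (\<lambda>\<omega> i. T i \<omega>))"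
    by (rule indep_var_compose[OF XT_indep]) measurable
  then have "indep_var borel (X i) borel (T i)" by (simp add: comp_def)
  then show ?thesis unfolding indep_var_distribution_eq by (simp add: distr_X distr_T)
qed

end

section \<open>A central limit theorem for triangular arrays\<close>

lemma one_minus_exp_bound:
  assumes "0 \<le> (a::real)"
  shows "\<bar>(1 - a) - exp (- a)\<bar> \<le> a\<^sup>2"
proof -
  have 1: "1 - a \<le> exp (- a)" using exp_ge_add_one_self[of "- a"] by simp
  have "exp (- a) * (1 + a) \<le> exp (- a) * exp a" using exp_ge_add_one_self[of a] by (intro mult_left_mono) auto
  also have "\<dots> = 1" by (simp add: exp_minus)
  also have "1 \<le> (1 - a + a\<^sup>2) * (1 + a)" using assms by (simp add: algebra_simps power2_eq_square)
  finally have "exp (- a) \<le> 1 - a + a\<^sup>2" using assms by simp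
  with 1 show ?thesis by simp
qed

lemma (in prob_space) char_bounded_centered:
  fixes Y :: "'a \<Rightarrow> real"
  assumes [measurable]: "random_variable borel Y" and bd: "\<And>\<omega>. \<omega> \<in> space M \<Longrightarrow> \<bar>Y \<omega>\<bar> \<le> b"
    and mean: "expectation Y = 0" and var: "expectation (\<lambda>\<omega>. (Y \<omega>)\<^sup>2) = v"
  shows "cmod (char (distr M borel Y) s - (1 - s\<^sup>2 * v / 2)) \<le> \<bar>s\<bar> ^ 3 * b * v"
proof -
  have b0: "0 \<le> b" using bd not_empty by (metis abs_ge_zero ex_in_conv order_trans)
  have iY: "integrable M Y" using bd by (intro integrable_const_bound[of _ b]) auto
  have iY2: "integrable M (\<lambda>\<omega>. (Y \<omega>)\<^sup>2)"
  proof (rule integrable_const_bound[of _ "b\<^sup>2"])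
    show "AE \<omega> in M. norm ((Y \<omega>)\<^sup>2) \<le> b\<^sup>2"
      using bd power_mono[of "\<bar>Y _\<bar>" b 2] by (intro AE_I2) auto
  qed simp
  have "cmod (char (distr M borel Y) s - (1 - s\<^sup>2 * v / 2)) \<le>
      s\<^sup>2 / 6 * expectation (\<lambda>\<omega>. min (6 * (Y \<omega>)\<^sup>2) (\<bar>s\<bar> * \<bar>Y \<omega>\<bar> ^ 3))"
    by (rule char_approx3') (use iY iY2 mean var in auto)
  also have "\<dots> \<le> s\<^sup>2 / 6 * (\<bar>s\<bar> * b * v)"
  proof (rule mult_left_mono)
    have "expectation (\<lambda>\<omega>. min (6 * (Y \<omega>)\<^sup>2) (\<bar>s\<bar> * \<bar>Y \<omega>\<bar> ^ 3)) \<le> expectation (\<lambda>\<omega>. \<bar>s\<bar> * b * (Y \<omega>)\<^sup>2)"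
    proof (rule integral_mono)
      show "integrable M (\<lambda>\<omega>. min (6 * (Y \<omega>)\<^sup>2) (\<bar>s\<bar> * \<bar>Y \<omega>\<bar> ^ 3))"
        by (rule Bochner_Integration.integrable_bound[OF integrable_mult_right[OF iY2, of 6]]) auto
      fix \<omega> assume "\<omega> \<in> space M"
      then have "\<bar>s\<bar> * \<bar>Y \<omega>\<bar> * (Y \<omega>)\<^sup>2 \<le> \<bar>s\<bar> * b * (Y \<omega>)\<^sup>2"
        using bd by (intro mult_right_mono mult_left_mono) auto
      moreover have "\<bar>Y \<omega>\<bar> ^ 3 = \<bar>Y \<omega>\<bar> * (Y \<omega>)\<^sup>2"
        by (simp add: power3_eq_cube power2_eq_square abs_mult[symmetric] mult.assoc)
      ultimately show "min (6 * (Y \<omega>)\<^sup>2) (\<bar>s\<bar> * \<bar>Y \<omega>\<bar> ^ 3) \<le> \<bar>s\<bar> * b * (Y \<omega>)\<^sup>2"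
        by (simp add: mult.assoc)
    qed (use iY2 in auto)
    then show "expectation (\<lambda>\<omega>. min (6 * (Y \<omega>)\<^sup>2) (\<bar>s\<bar> * \<bar>Y \<omega>\<bar> ^ 3)) \<le> \<bar>s\<bar> * b * v"
      by (simp add: var)
  qed simp
  also have "\<dots> \<le> \<bar>s\<bar> ^ 3 * b * v"
  proof -
    have "0 \<le> v" using var by (metis integral_nonneg_AE AE_I2 zero_le_power2)
    then have nn: "0 \<le> s\<^sup>2 * (\<bar>s\<bar> * b * v)" using b0 by simp
    have "\<bar>s\<bar> ^ 3 = \<bar>s\<bar>\<^sup>2 * \<bar>s\<bar>" by (simp only: power3_eq_cube power2_eq_square)
    then have eq: "\<bar>s\<bar> ^ 3 * b * v = s\<^sup>2 * (\<bar>s\<bar> * b * v)" unfolding power2_abs by (simp only: mult.assoc)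
    have "s\<^sup>2 / 6 * (\<bar>s\<bar> * b * v) = s\<^sup>2 * (\<bar>s\<bar> * b * v) / 6" by simp
    then show ?thesis unfolding eq using nn by linarith
  qed
  finally show ?thesis .
qed

text \<open>Each factor of the characteristic function of the sum differs from \<open>exp (- s\<^sup>2 v n/(2
  n))\<close> by at most a multiple of \<open>b n v n/n + 1/n\<^sup>2\<close>, and there are \<open>n\<close> factors
  of modulus at most 1. The uniform bound \<open>b n\<close> replaces the Lindeberg condition.\<close>

lemma (in prob_space) triangular_array_char_tendsto:
  fixes Y :: "nat \<Rightarrow> nat \<Rightarrow> 'a \<Rightarrow> real" and b v :: "nat \<Rightarrow> real"
  assumes indep: "\<forall>\<^sub>F n in sequentially. indep_vars (\<lambda>_. borel) (Y n) {..<n}"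
    and bd: "\<forall>\<^sub>F n in sequentially. \<forall>i<n. \<forall>\<omega>\<in>space M. \<bar>Y n i \<omega>\<bar> \<le> b n"
    and mean: "\<forall>\<^sub>F n in sequentially. \<forall>i<n. expectation (Y n i) = 0"
    and var: "\<forall>\<^sub>F n in sequentially. \<forall>i<n. expectation (\<lambda>\<omega>. (Y n i \<omega>)\<^sup>2) = v n / n"
    and b: "b \<longlonglongrightarrow> 0" and v: "v \<longlonglongrightarrow> V"
  shows "(\<lambda>n. char (distr M borel (\<lambda>\<omega>. \<Sum>i<n. Y n i \<omega>)) s) \<longlonglongrightarrow> complex_of_real (exp (- (s\<^sup>2 * V / 2)))"
proof -
  have ev: "\<forall>\<^sub>F n in sequentially.
      norm (char (distr M borel (\<lambda>\<omega>. \<Sum>i<n. Y n i \<omega>)) s - complex_of_real (exp (- (s\<^sup>2 * v n / 2)))) \<le>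
      \<bar>s\<bar> ^ 3 * b n * v n + (s\<^sup>2 * v n / 2)\<^sup>2 / n"
    using indep bd mean var eventually_gt_at_top[of 0]
  proof eventually_elim
    case (elim n)
    define a where "a = s\<^sup>2 * (v n / n) / 2"
    have rv[measurable]: "random_variable borel (Y n i)" if "i < n" for i
      using elim(1) that by (auto simp: indep_vars_def)
    have "v n / n = expectation (\<lambda>\<omega>. (Y n 0 \<omega>)\<^sup>2)" using elim by simp
    also have "0 \<le> \<dots>" by (rule Bochner_Integration.integral_nonneg) simp
    finally have vn: "0 \<le> v n / n" .
    have a0: "0 \<le> a" unfolding a_def by (intro divide_nonneg_pos mult_nonneg_nonneg vn) auto
    have "norm (char (distr M borel (\<lambda>\<omega>. \<Sum>i<n. Y n i \<omega>)) s - complex_of_real (exp (- (s\<^sup>2 * v n / 2)))) =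
        norm ((\<Prod>i<n. char (distr M borel (Y n i)) s) - (\<Prod>i<n. complex_of_real (exp (- a))))"
    proof -
      have "(\<Prod>i<n. complex_of_real (exp (- a))) = complex_of_real (exp (- a) ^ n)" by simp
      also have "exp (- a) ^ n = exp (- (s\<^sup>2 * v n / 2))"
        using elim(5) by (simp add: exp_of_nat_mult[symmetric] a_def)
      finally show ?thesis by (simp add: char_distr_sum[OF elim(1)])
    qed
    also have "\<dots> \<le> (\<Sum>i<n. norm (char (distr M borel (Y n i)) s - complex_of_real (exp (- a))))"
    proof (rule norm_prod_diff)
      fix i assume "i \<in> {..<n}"
      then interpret D: real_distribution "distr M borel (Y n i)" by (intro real_distribution_distr rv) simp
      show "norm (char (distr M borel (Y n i)) s) \<le> 1" by (rule D.cmod_char_le_1)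
    qed (use a0 in simp)
    also have "\<dots> \<le> (\<Sum>i<n. \<bar>s\<bar> ^ 3 * b n * (v n / n) + a\<^sup>2)"
    proof (rule sum_mono)
      fix i assume i: "i \<in> {..<n}"
      have "norm (char (distr M borel (Y n i)) s - complex_of_real (1 - a)) \<le> \<bar>s\<bar> ^ 3 * b n * (v n / n)"
        using char_bounded_centered[of "Y n i" "b n" "v n / n" s] elim i rv by (simp add: a_def)
      moreover have "norm (complex_of_real (1 - a) - complex_of_real (exp (- a))) \<le> a\<^sup>2"
        using one_minus_exp_bound[OF a0] by (simp only: of_real_diff[symmetric] norm_of_real)
      ultimately show "norm (char (distr M borel (Y n i)) s - complex_of_real (exp (- a))) \<le> \<bar>s\<bar> ^ 3 * b n * (v n / n) + a\<^sup>2"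
        using norm_triangle_ineq[of "char (distr M borel (Y n i)) s - complex_of_real (1 - a)" "complex_of_real (1 - a) - complex_of_real (exp (- a))"] by simp
    qed
    also have "\<dots> = \<bar>s\<bar> ^ 3 * b n * v n + (s\<^sup>2 * v n / 2)\<^sup>2 / n"
      using elim(5) by (simp add: a_def field_simps power2_eq_square)
    finally show ?case .
  qed
  have "(\<lambda>n. \<bar>s\<bar> ^ 3 * b n * v n + (s\<^sup>2 * v n / 2)\<^sup>2 / n) \<longlonglongrightarrow> \<bar>s\<bar> ^ 3 * 0 * V + 0"
    by (intro tendsto_intros b v tendsto_divide_0[OF tendsto_power[OF tendsto_divide[OF tendsto_mult[OF tendsto_const v] tendsto_const]]]
        filterlim_real_at_infinity_sequentially) simp
  then have "(\<lambda>n. char (distr M borel (\<lambda>\<omega>. \<Sum>i<n. Y n i \<omega>)) s - complex_of_real (exp (- (s\<^sup>2 * v n / 2)))) \<longlonglongrightarrow> 0"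
    by (intro Lim_null_comparison[OF ev]) simp
  moreover have "(\<lambda>n. complex_of_real (exp (- (s\<^sup>2 * v n / 2)))) \<longlonglongrightarrow> complex_of_real (exp (- (s\<^sup>2 * V / 2)))"
    by (intro tendsto_intros v) simp
  ultimately show ?thesis by (rule Lim_transform[rotated])
qed

lemma (in prob_space) char_distr_eq:
  assumes [measurable]: "random_variable borel Z"
  shows "char (distr M borel Z) s = (CLINT \<omega>|M. iexp (s * Z \<omega>))"
  unfolding char_def by (subst integral_distr) auto

text \<open>Slutsky's lemma in terms of characteristic functions: \<open>exp (i s x)\<close> is bounded and Lipschitz
  in \<open>x\<close>, so a perturbation that tends to \<open>m\<close> in probability only contributes the factor
  \<open>exp (i s m)\<close>.\<close>

lemma (in prob_space) char_perturbation_tendsto: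
  fixes L Z :: "nat \<Rightarrow> 'a \<Rightarrow> real"
  assumes Lm: "\<And>n. random_variable borel (L n)" and Zm: "\<And>n. random_variable borel (Z n)"
    and lim: "(\<lambda>n. char (distr M borel (L n)) s) \<longlonglongrightarrow> c"
    and small: "\<And>\<epsilon>. 0 < \<epsilon> \<Longrightarrow> (\<lambda>n. prob {\<omega>\<in>space M. \<epsilon> < \<bar>Z n \<omega> - L n \<omega> - m\<bar>}) \<longlonglongrightarrow> 0"
  shows "(\<lambda>n. char (distr M borel (Z n)) s) \<longlonglongrightarrow> iexp (s * m) * c"
proof -
  note [measurable] = Lm Zm
  have bound: "cmod (char (distr M borel (Z n)) s - iexp (s * m) * char (distr M borel (L n)) s) \<le>
      \<bar>s\<bar> * \<epsilon> + 2 * prob {\<omega>\<in>space M. \<epsilon> < \<bar>Z n \<omega> - L n \<omega> - m\<bar>}" if \<epsilon>: "0 < \<epsilon>" for n \<epsilon>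
  proof -
    let ?B = "{\<omega>\<in>space M. \<epsilon> < \<bar>Z n \<omega> - L n \<omega> - m\<bar>}"
    have B: "?B \<in> events" by measurable
    have iB: "integrable M (indicator ?B :: 'a \<Rightarrow> real)"
      by (rule integrable_real_indicator[OF B]) (simp add: emeasure_eq_measure)
    have i1: "integrable M (\<lambda>\<omega>. iexp (s * Z n \<omega>))" "integrable M (\<lambda>\<omega>. iexp (s * m) * iexp (s * L n \<omega>))"
      by (intro integrable_const_bound[of _ 1]; simp add: norm_mult)+
    have "char (distr M borel (Z n)) s - iexp (s * m) * char (distr M borel (L n)) s =
        (CLINT \<omega>|M. iexp (s * Z n \<omega>) - iexp (s * m) * iexp (s * L n \<omega>))"
      using i1 by (simp add: char_distr_eq)
    then have "cmod (char (distr M borel (Z n)) s - iexp (s * m) * char (distr M borel (L n)) s) \<le>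
        (LINT \<omega>|M. cmod (iexp (s * Z n \<omega>) - iexp (s * m) * iexp (s * L n \<omega>)))"
      by (simp add: integral_norm_bound)
    also have "\<dots> \<le> (LINT \<omega>|M. \<bar>s\<bar> * \<epsilon> + 2 * indicator ?B \<omega>)"
    proof (rule integral_mono)
      show "integrable M (\<lambda>\<omega>. cmod (iexp (s * Z n \<omega>) - iexp (s * m) * iexp (s * L n \<omega>)))"
        using i1 by (intro integrable_norm Bochner_Integration.integrable_diff)
      show "integrable M (\<lambda>\<omega>. \<bar>s\<bar> * \<epsilon> + 2 * indicator ?B \<omega>)"
        by (intro Bochner_Integration.integrable_add integrable_mult_right iB) simp
      fix \<omega> assume \<omega>: "\<omega> \<in> space M"
      define y where "y = Z n \<omega> - L n \<omega> - m"
      have "iexp (s * Z n \<omega>) - iexp (s * m) * iexp (s * L n \<omega>) = iexp (s * m) * iexp (s * L n \<omega>) * (iexp (s * y) - 1)"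
        by (simp add: y_def exp_add[symmetric] algebra_simps)
      then have eq: "cmod (iexp (s * Z n \<omega>) - iexp (s * m) * iexp (s * L n \<omega>)) = cmod (iexp (s * y) - 1)"
        by (simp add: norm_mult)
      show "cmod (iexp (s * Z n \<omega>) - iexp (s * m) * iexp (s * L n \<omega>)) \<le> \<bar>s\<bar> * \<epsilon> + 2 * indicator ?B \<omega>"
      proof (cases "\<omega> \<in> ?B")
        case True
        have "cmod (iexp (s * y) - 1) \<le> cmod (iexp (s * y)) + cmod 1" by (rule norm_triangle_ineq4)
        moreover have "0 \<le> \<bar>s\<bar> * \<epsilon>" using \<epsilon> by simp
        ultimately show ?thesis unfolding eq using True by simp
      next
        case False
        then have "\<bar>y\<bar> \<le> \<epsilon>" using \<omega> by (simp add: y_def)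
        then have "\<bar>s\<bar> * \<bar>y\<bar> \<le> \<bar>s\<bar> * \<epsilon>" by (intro mult_left_mono) auto
        moreover have "cmod (iexp (s * y) - 1) \<le> \<bar>s * y\<bar>" using iexp_approx1[of "s * y" 0] by simp
        ultimately show ?thesis unfolding eq using False by (simp add: abs_mult)
      qed
    qed
    also have "\<dots> = \<bar>s\<bar> * \<epsilon> + 2 * prob ?B"
      using B by (subst Bochner_Integration.integral_add[OF _ integrable_mult_right[OF iB]]) (simp_all add: prob_space)
    finally show ?thesis .
  qed
  have "(\<lambda>n. char (distr M borel (Z n)) s - iexp (s * m) * char (distr M borel (L n)) s) \<longlonglongrightarrow> 0"
  proof (rule LIMSEQ_I)
    fix r :: real assume r: "0 < r"
    define \<epsilon> where "\<epsilon> = r / (2 * (\<bar>s\<bar> + 1))"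
    have \<epsilon>: "0 < \<epsilon>" using r by (simp add: \<epsilon>_def)
    have "\<bar>s\<bar> * \<epsilon> \<le> (\<bar>s\<bar> + 1) * \<epsilon>" using \<epsilon> by simp
    also have "\<dots> = r / 2" by (simp add: \<epsilon>_def field_simps)
    finally have s\<epsilon>: "\<bar>s\<bar> * \<epsilon> \<le> r / 2" .
    have "\<forall>\<^sub>F n in sequentially. prob {\<omega>\<in>space M. \<epsilon> < \<bar>Z n \<omega> - L n \<omega> - m\<bar>} < r / 4"
      by (rule order_tendstoD(2)[OF small[OF \<epsilon>]]) (use r in simp)
    then have "\<forall>\<^sub>F n in sequentially. norm (char (distr M borel (Z n)) s - iexp (s * m) * char (distr M borel (L n)) s - 0) < r"
    proof eventually_elim
      case (elim n)
      have "norm (char (distr M borel (Z n)) s - iexp (s * m) * char (distr M borel (L n)) s - 0) \<le>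
          \<bar>s\<bar> * \<epsilon> + 2 * prob {\<omega>\<in>space M. \<epsilon> < \<bar>Z n \<omega> - L n \<omega> - m\<bar>}" using bound[OF \<epsilon>, of n] by simp
      then show ?case using elim s\<epsilon> by linarith
    qed
    then show "\<exists>N. \<forall>n\<ge>N. norm (char (distr M borel (Z n)) s - iexp (s * m) * char (distr M borel (L n)) s - 0) < r"
      unfolding eventually_sequentially .
  qed
  moreover have "(\<lambda>n. iexp (s * m) * char (distr M borel (L n)) s) \<longlonglongrightarrow> iexp (s * m) * c"
    by (intro tendsto_mult tendsto_const lim)
  ultimately show ?thesis by (rule Lim_transform[rotated])
qed

lemma
  assumes v: "0 < v"
  shows real_distribution_normal_law: "real_distribution (normal_law m v)"
    and char_normal_law: "char (normal_law m v) s = iexp (s * m) * complex_of_real (exp (- (s\<^sup>2 * v / 2)))"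
proof -
  interpret N: real_distribution std_normal_distribution by (rule real_dist_normal_dist)
  have "distributed std_normal_distribution lborel (\<lambda>x. x) std_normal_density"
    unfolding distributed_def by (simp add: distr_id2)
  from N.normal_density_affine[OF this, of "sqrt v" m]
  have "distributed std_normal_distribution lborel (\<lambda>x. m + sqrt v * x) (normal_density m (sqrt v))"
    using v by simp
  then have "distr std_normal_distribution lborel (\<lambda>x. m + sqrt v * x) = normal_law m v"
    by (simp add: distributed_def normal_law_def)
  then have eq: "normal_law m v = distr std_normal_distribution borel (\<lambda>x. m + sqrt v * x)"
    by (simp cong: distr_cong)
  show "real_distribution (normal_law m v)" unfolding eq by (rule N.real_distribution_distr) simp
  have "char (normal_law m v) s = (CLINT x|std_normal_distribution. iexp (s * m) * iexp (s * sqrt v * x))"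
    unfolding eq by (subst N.char_distr_eq) (auto simp: exp_add[symmetric] algebra_simps intro!: Bochner_Integration.integral_cong)
  also have "\<dots> = iexp (s * m) * char std_normal_distribution (s * sqrt v)"
    unfolding char_def by simp
  also have "char std_normal_distribution (s * sqrt v) = complex_of_real (exp (- (s\<^sup>2 * v / 2)))"
    using v by (simp add: char_std_normal_distribution power_mult_distrib)
  finally show "char (normal_law m v) s = iexp (s * m) * complex_of_real (exp (- (s\<^sup>2 * v / 2)))" .
qed

lemma (in prob_space) conv_in_distr_normal:
  fixes L Z :: "nat \<Rightarrow> 'a \<Rightarrow> real"
  assumes Lm: "\<And>n. random_variable borel (L n)" and Zm: "\<And>n. random_variable borel (Z n)"
    and lim: "\<And>s. (\<lambda>n. char (distr M borel (L n)) s) \<longlonglongrightarrow> complex_of_real (exp (- (s\<^sup>2 * v / 2)))"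
    and small: "\<And>\<epsilon>. 0 < \<epsilon> \<Longrightarrow> (\<lambda>n. prob {\<omega>\<in>space M. \<epsilon> < \<bar>Z n \<omega> - L n \<omega> - m\<bar>}) \<longlonglongrightarrow> 0"
    and v: "0 < v"
  shows "conv_in_distr M Z (normal_law m v)"
  unfolding conv_in_distr_def
proof (intro conjI allI Zm)
  show "weak_conv_m (\<lambda>n. distr M borel (Z n)) (normal_law m v)"
  proof (rule levy_continuity)
    fix s
    show "(\<lambda>n. char (distr M borel (Z n)) s) \<longlonglongrightarrow> char (normal_law m v) s"
      unfolding char_normal_law[OF v] by (rule char_perturbation_tendsto[OF Lm Zm lim small])
  qed (auto intro: real_distribution_distr Zm real_distribution_normal_law v)
qed

section \<open>Consequences of the regularity conditions\<close>

lemma density_interval_increment: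
  assumes mono: "\<And>x y. x \<le> y \<Longrightarrow> F x \<le> F y" and rc: "\<And>x. continuous (at_right x) F"
    and dens: "has_density F f" and xy: "x \<le> y"
  shows "ennreal (F y - F x) = (\<integral>\<^sup>+u. ennreal (f u) * indicator {x<..y} u \<partial>lborel)"
proof -
  have [measurable]: "f \<in> borel_measurable borel" using dens by (simp add: has_density_def)
  have "ennreal (F y - F x) = emeasure (interval_measure F) {x<..y}"
    by (rule emeasure_interval_measure_Ioc[symmetric, OF xy mono rc])
  also have "\<dots> = (\<integral>\<^sup>+u. ennreal (f u) * indicator {x<..y} u \<partial>lborel)"
    using dens unfolding has_density_def by (simp add: emeasure_density)
  finally show ?thesis .
qed

lemma density_lower_increment:
  assumes mono: "\<And>x y. x \<le> y \<Longrightarrow> F x \<le> F y" and rc: "\<And>x. continuous (at_right x) F"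
    and dens: "has_density F f" and xy: "x \<le> y" and low: "\<And>u. x < u \<Longrightarrow> u \<le> y \<Longrightarrow> b \<le> f u" and b: "0 \<le> b"
  shows "b * (y - x) \<le> F y - F x"
proof -
  have "ennreal (b * (y - x)) = (\<integral>\<^sup>+u. ennreal b * indicator {x<..y} u \<partial>lborel)"
    using xy b by (simp add: nn_integral_cmult_indicator ennreal_mult)
  also have "\<dots> \<le> (\<integral>\<^sup>+u. ennreal (f u) * indicator {x<..y} u \<partial>lborel)"
    using low by (intro nn_integral_mono) (auto simp: indicator_def intro: ennreal_leI)
  also have "\<dots> = ennreal (F y - F x)" by (rule density_interval_increment[symmetric, OF mono rc dens xy])
  finally show ?thesis using mono[OF xy] by (simp add: ennreal_le_iff)
qed

lemma density_upper_increment: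
  assumes mono: "\<And>x y. x \<le> y \<Longrightarrow> F x \<le> F y" and rc: "\<And>x. continuous (at_right x) F"
    and dens: "has_density F f" and xy: "x \<le> y" and up: "\<And>u. x < u \<Longrightarrow> u \<le> y \<Longrightarrow> f u \<le> b" and b: "0 \<le> b"
  shows "F y - F x \<le> b * (y - x)"
proof -
  have "ennreal (F y - F x) = (\<integral>\<^sup>+u. ennreal (f u) * indicator {x<..y} u \<partial>lborel)"
    by (rule density_interval_increment[OF mono rc dens xy])
  also have "\<dots> \<le> (\<integral>\<^sup>+u. ennreal b * indicator {x<..y} u \<partial>lborel)"
    using up by (intro nn_integral_mono) (auto simp: indicator_def intro: ennreal_leI)
  also have "\<dots> = ennreal (b * (y - x))"
    using xy b by (simp add: nn_integral_cmult_indicator ennreal_mult)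
  finally show ?thesis using xy b by (subst (asm) ennreal_le_iff) auto
qed

text \<open>A point outside the support has a null neighbourhood, and the distribution function does not increase
  there.\<close>

lemma outside_df_support_locally_constant:
  assumes mono: "\<And>x y. x \<le> y \<Longrightarrow> F x \<le> F y" and rc: "\<And>x. continuous (at_right x) F"
    and x: "x \<notin> df_support F"
  shows "\<exists>\<delta>>0. \<forall>y. \<bar>y - x\<bar> < \<delta> \<longrightarrow> F y = F x"
proof -
  obtain U where U: "open U" "x \<in> U" "emeasure (interval_measure F) U = 0"
    using x by (auto simp: df_support_def topological_support_def zero_less_iff_neq_zero)
  obtain \<delta> where \<delta>: "0 < \<delta>" "ball x \<delta> \<subseteq> U" using U openE by blast
  have inc: "F b = F a" if ab: "a \<le> b" "\<bar>a - x\<bar> < \<delta>" "\<bar>b - x\<bar> < \<delta>" for a b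
  proof -
    have "{a<..b} \<subseteq> ball x \<delta>"
    proof
      fix u assume "u \<in> {a<..b}"
      then have "\<bar>u - x\<bar> < \<delta>" using ab by (auto simp: abs_less_iff)
      then show "u \<in> ball x \<delta>" by (simp add: dist_real_def abs_minus_commute)
    qed
    then have "emeasure (interval_measure F) {a<..b} \<le> emeasure (interval_measure F) U"
      using \<delta> U by (intro emeasure_mono) auto
    then have "ennreal (F b - F a) = 0"
      using U(3) emeasure_interval_measure_Ioc[OF ab(1) mono rc] by simp
    then show ?thesis using mono[OF ab(1)] by (simp add: ennreal_eq_0_iff)
  qed
  have "F y = F x" if "\<bar>y - x\<bar> < \<delta>" for y
    using inc[of y x] inc[of x y] that \<delta>(1) by (cases "y \<le> x") auto
  then show ?thesis using \<delta>(1) by blast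
qed

lemma density_zero_outside_support:
  assumes mono: "\<And>x y. x \<le> y \<Longrightarrow> F x \<le> F y" and rc: "\<And>x. continuous (at_right x) F"
    and dens: "has_density F f" and x: "x \<notin> df_support F" and c: "isCont f x"
  shows "f x = 0"
proof (rule ccontr)
  assume "f x \<noteq> 0"
  then have pos: "0 < f x" using dens by (simp add: has_density_def less_le)
  obtain \<delta> where \<delta>: "0 < \<delta>" "\<And>y. \<bar>y - x\<bar> < \<delta> \<Longrightarrow> F y = F x"
    using outside_df_support_locally_constant[OF mono rc x] by auto
  obtain \<gamma> where \<gamma>: "0 < \<gamma>" "\<And>y. dist y x < \<gamma> \<Longrightarrow> dist (f y) (f x) < f x / 2"
    using c pos unfolding continuous_at_eps_delta by (meson half_gt_zero)
  \<comment> \<open>on an interval to the right of \<open>x\<close> the density is at least \<open>f x/2\<close>, yet \<open>F\<close> does not increase\<close>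
  define \<rho> where "\<rho> = min \<delta> \<gamma> / 2"
  have \<rho>: "0 < \<rho>" "\<rho> < \<delta>" "\<rho> < \<gamma>" using \<delta> \<gamma> by (auto simp: \<rho>_def min_def)
  have "f x / 2 * (x + \<rho> - x) \<le> F (x + \<rho>) - F x"
  proof (rule density_lower_increment[OF mono rc dens])
    fix u assume "x < u" "u \<le> x + \<rho>"
    then show "f x / 2 \<le> f u" using \<gamma>(2)[of u] \<rho> by (auto simp: dist_real_def abs_real_def split: if_splits)
  qed (use \<rho> pos in auto)
  moreover have "F (x + \<rho>) = F x" using \<delta>(2)[of "x + \<rho>"] \<rho> by simp
  ultimately show False using pos \<rho> by (simp add: mult_le_0_iff)
qed

lemma has_density_integral:
  assumes "has_density F f" and [measurable]: "q \<in> borel_measurable borel"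
  shows "(LINT u|interval_measure F. q u) = (LINT u|lborel. f u * q u)"
  using assms unfolding has_density_def by (simp add: integral_density)

locale smle_setting = current_status M X T F0 G + smooth_kernel_fun k
  for M :: "'a measure" and X T :: "nat \<Rightarrow> 'a \<Rightarrow> real" and F0 G k :: "real \<Rightarrow> real" +
  fixes f0 g g' :: "real \<Rightarrow> real" and M0 t :: real
  assumes F_support: "df_support F0 = {0..M0}"
    and F_density: "has_density F0 f0"
    and F_away: "\<exists>\<epsilon>>0. \<forall>x\<in>{0..M0}. \<epsilon> \<le> f0 x"
    and G_density: "has_density G g"
    and G_away: "\<exists>\<epsilon>>0. \<forall>x\<in>{0..M0}. \<epsilon> \<le> g x"
    and g_deriv: "\<forall>x\<in>{0..M0}. (g has_real_derivative g' x) (at x within {0..M0})"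
    and g'_bounded: "bounded (g' ` {0..M0})"
    and t_pos: "0 < t"
    and f0_twice_diff: "\<forall>\<^sub>F x in nhds t. f0 differentiable (at x) \<and> deriv f0 differentiable (at x)"
    and f0''_cont: "isCont (deriv (deriv f0)) t"
    and f0''_nonzero: "deriv (deriv f0) t \<noteq> 0"
begin

lemma G_right_cont: "continuous (at_right x) G"
proof -
  interpret T: real_distribution "distr M borel (T 0)" by (rule real_distribution_T)
  show ?thesis using T.cdf_is_right_cont unfolding cdf_T .
qed

lemma f0_meas[measurable]: "f0 \<in> borel_measurable borel" and g_meas[measurable]: "g \<in> borel_measurable borel"
  and f0_nonneg: "0 \<le> f0 x"
  using F_density G_density by (auto simp: has_density_def)

lemma f0_cont_near: "\<forall>\<^sub>F x in nhds t. isCont f0 x"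
  using f0_twice_diff by eventually_elim (auto intro: differentiable_imp_continuous_within)

text \<open>The density vanishes at every point outside the support at which it is continuous. If \<open>t\<close>
  were beyond \<open>M0\<close>, this would make the second derivative at \<open>t\<close> zero; if \<open>t\<close>
  were equal to \<open>M0\<close>, continuity at \<open>t\<close> from the right would contradict that the density is
  bounded away from zero on \<open>[0, M0]\<close>.\<close>

lemma t_interior: "t < M0"
proof (rule ccontr)
  assume "\<not> t < M0"
  then have tM: "M0 \<le> t" by simp
  obtain \<rho> where \<rho>: "0 < \<rho>" "\<And>x. dist x t < \<rho> \<Longrightarrow> isCont f0 x"
    using f0_cont_near unfolding eventually_nhds_metric by blast
  have zero: "f0 x = 0" if "M0 < x" "dist x t < \<rho>" for x
    by (rule density_zero_outside_support[OF F0_cdf(1,2) F_density _ \<rho>(2)]) (use that F_support in auto)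
  show False
  proof (cases "M0 = t")
    case True
    have "(f0 \<longlongrightarrow> f0 t) (at_right t)"
      using \<rho>(2)[of t] \<rho>(1) unfolding isCont_def by (auto intro: tendsto_within_subset)
    moreover have "\<forall>\<^sub>F x in at_right t. f0 x = 0"
      using eventually_at_right_real[of t "t + \<rho>"] \<rho>(1)
      by (auto elim!: eventually_mono intro!: zero simp: True dist_real_def)
    then have "(f0 \<longlongrightarrow> 0) (at_right t)" by (rule tendsto_eventually)
    ultimately have "f0 t = 0" using tendsto_unique trivial_limit_at_right_real by blast
    moreover obtain \<epsilon> where "0 < \<epsilon>" "\<forall>x\<in>{0..M0}. \<epsilon> \<le> f0 x" using F_away by blast
    ultimately show False using True t_pos by (auto dest!: bspec[of _ _ t])
  next
    case False
    then have lt: "M0 < t" using tM by simp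
    define \<delta> where "\<delta> = min \<rho> (t - M0)"
    have \<delta>: "0 < \<delta>" using \<rho> lt by (simp add: \<delta>_def)
    have z: "f0 x = 0" if "dist x t < \<delta>" for x
      using that by (intro zero) (auto simp: \<delta>_def dist_real_def)
    have "\<forall>\<^sub>F x in nhds t. f0 x = 0" unfolding eventually_nhds_metric using z \<delta> by blast
    then have ev2: "\<forall>\<^sub>F x in nhds t. \<forall>\<^sub>F y in nhds x. f0 y = 0" by (simp add: eventually_eventually)
    have "\<forall>\<^sub>F x in nhds t. deriv f0 x = 0"
      using ev2
    proof eventually_elim
      case (elim x)
      then have "(f0 has_real_derivative 0) (at x) = ((\<lambda>_. 0) has_real_derivative 0) (at x)"
        by (intro DERIV_cong_ev) auto
      then show ?case by (simp add: DERIV_imp_deriv)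
    qed
    then have "(deriv f0 has_real_derivative 0) (at t) = ((\<lambda>_. 0) has_real_derivative 0) (at t)"
      by (intro DERIV_cong_ev) auto
    then have "deriv (deriv f0) t = 0" by (simp add: DERIV_imp_deriv)
    then show False using f0''_nonzero by simp
  qed
qed

text \<open>On the complement of the support \<open>F0\<close> is locally constant, so it has derivative zero and is
  constant on \<open>(M0, \<infinity>)\<close>.\<close>

lemma F0_right: "M0 < x \<Longrightarrow> F0 x = 1"
proof -
  assume x: "M0 < x"
  have "\<exists>c. \<forall>y\<in>{M0<..}. F0 y = c"
  proof (rule has_field_derivative_zero_constant)
    fix y assume "y \<in> {M0<..}"
    then have y: "y \<notin> df_support F0" using F_support by auto
    obtain \<delta> where \<delta>: "0 < \<delta>" "\<And>z. \<bar>z - y\<bar> < \<delta> \<Longrightarrow> F0 z = F0 y"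
      using outside_df_support_locally_constant[OF F0_cdf(1,2) y] by auto
    have "\<forall>\<^sub>F z in nhds y. F0 z = F0 y"
      unfolding eventually_nhds_metric dist_real_def using \<delta> by blast
    then have "(F0 has_real_derivative 0) (at y) = ((\<lambda>_. F0 y) has_real_derivative 0) (at y)"
      by (intro DERIV_cong_ev) auto
    then show "(F0 has_real_derivative 0) (at y within {M0<..})"
      by (auto intro: has_field_derivative_at_within)
  qed simp
  then obtain c where c: "\<And>y. M0 < y \<Longrightarrow> F0 y = c" by auto
  have "\<forall>\<^sub>F y in at_top. F0 y = c" using eventually_gt_at_top[of M0] by eventually_elim (rule c)
  then have "(F0 \<longlongrightarrow> c) at_top" by (rule tendsto_eventually)
  then have "c = 1" using F0_cdf(6) tendsto_unique trivial_limit_at_top_linorder by blast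
  then show ?thesis using c[OF x] by simp
qed

lemma F0_increment_lower:
  obtains \<epsilon> where "0 < \<epsilon>" "\<And>x y. 0 \<le> x \<Longrightarrow> x \<le> y \<Longrightarrow> y \<le> M0 \<Longrightarrow> \<epsilon> * (y - x) \<le> F0 y - F0 x"
proof -
  obtain \<epsilon> where \<epsilon>: "0 < \<epsilon>" "\<And>x. 0 \<le> x \<Longrightarrow> x \<le> M0 \<Longrightarrow> \<epsilon> \<le> f0 x" using F_away by auto
  have "\<epsilon> * (y - x) \<le> F0 y - F0 x" if "0 \<le> x" "x \<le> y" "y \<le> M0" for x y
    by (rule density_lower_increment[OF F0_cdf(1,2) F_density that(2)]) (use that \<epsilon> in auto)
  then show ?thesis using that \<epsilon>(1) by blast
qed

lemma g_lipschitz: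
  obtains Lg where "0 < Lg" "\<And>x y. 0 \<le> x \<Longrightarrow> x \<le> M0 \<Longrightarrow> 0 \<le> y \<Longrightarrow> y \<le> M0 \<Longrightarrow> \<bar>g x - g y\<bar> \<le> Lg * \<bar>x - y\<bar>"
proof -
  obtain Lg where Lg: "0 < Lg" "\<And>y. y \<in> g' ` {0..M0} \<Longrightarrow> norm y \<le> Lg"
    using g'_bounded bounded_pos by metis
  have "norm (g x - g y) \<le> Lg * norm (x - y)" if "x \<in> {0..M0}" "y \<in> {0..M0}" for x y
    by (rule field_differentiable_bound[of "{0..M0}" g g']) (use g_deriv Lg(2) that in auto)
  then show ?thesis using that[OF Lg(1)] by simp
qed

lemma g_bounds:
  obtains \<gamma> \<Gamma> where "0 < \<gamma>" "0 < \<Gamma>" "\<And>x. 0 \<le> x \<Longrightarrow> x \<le> M0 \<Longrightarrow> \<gamma> \<le> g x" "\<And>x. 0 \<le> x \<Longrightarrow> x \<le> M0 \<Longrightarrow> g x \<le> \<Gamma>"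
proof -
  obtain \<gamma> where \<gamma>: "0 < \<gamma>" "\<And>x. 0 \<le> x \<Longrightarrow> x \<le> M0 \<Longrightarrow> \<gamma> \<le> g x" using G_away by auto
  obtain Lg where Lg: "0 < Lg" "\<And>x y. 0 \<le> x \<Longrightarrow> x \<le> M0 \<Longrightarrow> 0 \<le> y \<Longrightarrow> y \<le> M0 \<Longrightarrow> \<bar>g x - g y\<bar> \<le> Lg * \<bar>x - y\<bar>"
    by (rule g_lipschitz) blast
  have M0: "0 \<le> M0" using t_pos t_interior by simp
  have "g x \<le> g 0 + Lg * M0" if "0 \<le> x" "x \<le> M0" for x
  proof -
    have "\<bar>g x - g 0\<bar> \<le> Lg * \<bar>x - 0\<bar>" using Lg(2)[of x 0] that M0 by simp
    also have "\<dots> \<le> Lg * M0" using that Lg by (intro mult_left_mono) auto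
    finally show ?thesis by linarith
  qed
  note up = this
  have "0 < g 0 + Lg * M0" using \<gamma>(1) \<gamma>(2)[of 0] M0 Lg(1) by (intro add_pos_nonneg) auto
  then show ?thesis by (rule that[OF \<gamma>(1) _ \<gamma>(2) up])
qed

lemma G_increments:
  assumes "\<And>x. 0 \<le> x \<Longrightarrow> x \<le> M0 \<Longrightarrow> \<gamma> \<le> g x" "\<And>x. 0 \<le> x \<Longrightarrow> x \<le> M0 \<Longrightarrow> g x \<le> \<Gamma>" "0 < \<gamma>" "0 < \<Gamma>"
    and "0 \<le> x" "x \<le> y" "y \<le> M0"
  shows "\<gamma> * (y - x) \<le> G y - G x" "G y - G x \<le> \<Gamma> * (y - x)"
  by (rule density_lower_increment[OF G_cdf(1) G_right_cont G_density assms(6)], use assms in auto)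
     (rule density_upper_increment[OF G_cdf(1) G_right_cont G_density assms(6)], use assms in auto)

lemma G_no_atoms: "measure (interval_measure G) {x} = 0"
proof -
  have "emeasure (interval_measure G) {x} = 0"
  proof -
    have "{x} \<in> null_sets lborel" by (rule finite_imp_null_set_lborel) simp
    then have "(\<integral>\<^sup>+u. ennreal (g u) * indicator {x} u \<partial>lborel) = 0" by (rule nn_integral_null_set)
    then show ?thesis using G_density unfolding has_density_def by (simp add: emeasure_density)
  qed
  then show ?thesis by (simp add: measure_def)
qed

lemma F0_local_lipschitz:
  obtains \<rho> Cf where "0 < \<rho>" "0 < Cf" "\<And>x y. t - \<rho> \<le> x \<Longrightarrow> x \<le> y \<Longrightarrow> y \<le> t + \<rho> \<Longrightarrow> F0 y - F0 x \<le> Cf * (y - x)"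
proof -
  have "isCont f0 t" using f0_cont_near by (rule eventually_nhds_x_imp_x)
  then obtain \<delta> where \<delta>: "0 < \<delta>" "\<And>x. dist x t < \<delta> \<Longrightarrow> dist (f0 x) (f0 t) < 1"
    unfolding continuous_at_eps_delta by (meson zero_less_one)
  have b0: "0 \<le> f0 t + 1" using f0_nonneg[of t] by linarith
  have "F0 y - F0 x \<le> (f0 t + 1) * (y - x)" if "t - \<delta> / 2 \<le> x" "x \<le> y" "y \<le> t + \<delta> / 2" for x y
  proof (rule density_upper_increment[OF F0_cdf(1,2) F_density that(2) _ b0])
    fix u assume "x < u" "u \<le> y"
    then have "dist u t < \<delta>" using that \<delta>(1) by (auto simp: dist_real_def abs_real_def)
    from \<delta>(2)[OF this] show "f0 u \<le> f0 t + 1" by (simp add: dist_real_def)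
  qed
  then show ?thesis using that[of "\<delta> / 2" "f0 t + 1"] \<delta>(1) f0_nonneg[of t] by simp
qed

lemma variance_factor_cont: "isCont (\<lambda>x. F0 x * (1 - F0 x) / g x) t"
proof -
  obtain \<rho> Cf where \<rho>: "0 < \<rho>" "0 < Cf" "\<And>x y. t - \<rho> \<le> x \<Longrightarrow> x \<le> y \<Longrightarrow> y \<le> t + \<rho> \<Longrightarrow> F0 y - F0 x \<le> Cf * (y - x)"
    by (rule F0_local_lipschitz) blast
  have F: "isCont F0 t"
    unfolding isCont_def
  proof (rule LIM_I)
    fix e :: real assume e: "0 < e"
    show "\<exists>s>0. \<forall>x. x \<noteq> t \<and> norm (x - t) < s \<longrightarrow> norm (F0 x - F0 t) < e"
    proof (intro exI[of _ "min \<rho> (e / Cf)"] conjI allI impI)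
      show "0 < min \<rho> (e / Cf)" using \<rho> e by simp
      fix x assume x: "x \<noteq> t \<and> norm (x - t) < min \<rho> (e / Cf)"
      then have lt: "Cf * \<bar>x - t\<bar> < e" "\<bar>x - t\<bar> < \<rho>" using \<rho>(2) by (auto simp: field_simps)
      have "\<bar>F0 x - F0 t\<bar> \<le> Cf * \<bar>x - t\<bar>"
      proof (cases "x \<le> t")
        case True
        then show ?thesis using \<rho>(3)[of x t] F0_cdf(1)[OF True] lt \<rho>(1) by simp
      next
        case False
        then show ?thesis using \<rho>(3)[of t x] F0_cdf(1)[of t x] lt \<rho>(1) by simp
      qed
      then show "norm (F0 x - F0 t) < e" using lt by simp
    qed
  qed
  have "(g has_real_derivative g' t) (at t within {0..M0})" using g_deriv t_pos t_interior by simp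
  then have "(g has_real_derivative g' t) (at t)"
    using at_within_interior[of t "{0..M0}"] t_pos t_interior by (simp add: interior_atLeastAtMost_real)
  then have g: "isCont g t" by (rule DERIV_isCont)
  obtain \<gamma> where "0 < \<gamma>" "\<forall>x\<in>{0..M0}. \<gamma> \<le> g x" using G_away by blast
  then have "g t \<noteq> 0" using t_pos t_interior by (auto dest!: bspec[of _ _ t])
  then show ?thesis by (intro continuous_intros F g)
qed

lemma F0_t_strictly_between: "0 < F0 t" "F0 t < 1"
proof -
  obtain \<epsilon> where \<epsilon>: "0 < \<epsilon>" "\<And>x y. 0 \<le> x \<Longrightarrow> x \<le> y \<Longrightarrow> y \<le> M0 \<Longrightarrow> \<epsilon> * (y - x) \<le> F0 y - F0 x"
    by (rule F0_increment_lower) blast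
  have "\<epsilon> * t \<le> F0 t - F0 0" "\<epsilon> * (M0 - t) \<le> F0 M0 - F0 t" using \<epsilon>(2)[of 0 t] \<epsilon>(2)[of t M0] t_pos t_interior by auto
  moreover have "0 < \<epsilon> * t" "0 < \<epsilon> * (M0 - t)" using \<epsilon>(1) t_pos t_interior by auto
  ultimately show "0 < F0 t" "F0 t < 1" using F0_cdf(4)[of 0] F0_cdf(5)[of M0] by linarith+
qed

end

section \<open>Rates and the optimal bandwidth constant\<close>

text \<open>The choices are: noise level \<open>ln n\<close>, which makes the union bounds over polynomially many
  events converge; distance \<open>ln n/\<surd>n + \<Gamma> M0/n\<close> of the distribution functions, the second
  summand being the mass of a grid cell; and \<open>m0 = n\<^bsup>2/3\<^esup> ln n\<close>. The inequalities are those
  under which a sample can be linearized.\<close>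

lemma smle_rate_conditions:
  fixes c \<gamma> \<kappa> \<Gamma> M0 r0 :: real
  assumes "0 < c" "0 < \<gamma>" "0 < \<kappa>" "0 < \<Gamma>" "0 < M0" "0 < r0"
  shows "\<forall>\<^sub>F n::nat in sequentially. 2 * (c * real n powr (- (1 / 7))) \<le> r0"
    and "\<forall>\<^sub>F n::nat in sequentially. c * real n powr (- (1 / 7)) \<le> 1"
    and "\<forall>\<^sub>F n::nat in sequentially. ln (real n) / sqrt (real n) + \<Gamma> * M0 / real n \<le> \<gamma> * (c * real n powr (- (1 / 7))) / 4"
    and "\<forall>\<^sub>F n::nat in sequentially. 2 \<le> real n powr (2 / 3) * ln (real n)"
    and "\<forall>\<^sub>F n::nat in sequentially. 16 * real n * (ln (real n) / sqrt (real n) + \<Gamma> * M0 / real n) \<le> real n powr (2 / 3) * ln (real n)"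
    and "\<forall>\<^sub>F n::nat in sequentially. 8 * real n * ln (real n) \<le> \<kappa> * (real n powr (2 / 3) * ln (real n)) * sqrt (real n powr (2 / 3) * ln (real n))"
proof -
  show "\<forall>\<^sub>F n::nat in sequentially. 2 * (c * real n powr (- (1 / 7))) \<le> r0" using assms by real_asymp
  show "\<forall>\<^sub>F n::nat in sequentially. c * real n powr (- (1 / 7)) \<le> 1" using assms by real_asymp
  show "\<forall>\<^sub>F n::nat in sequentially. ln (real n) / sqrt (real n) + \<Gamma> * M0 / real n \<le> \<gamma> * (c * real n powr (- (1 / 7))) / 4" using assms by real_asymp
  show "\<forall>\<^sub>F n::nat in sequentially. 2 \<le> real n powr (2 / 3) * ln (real n)" using assms by real_asymp
  show "\<forall>\<^sub>F n::nat in sequentially. 16 * real n * (ln (real n) / sqrt (real n) + \<Gamma> * M0 / real n) \<le> real n powr (2 / 3) * ln (real n)" using assms by real_asymp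
  show "\<forall>\<^sub>F n::nat in sequentially. 8 * real n * ln (real n) \<le> \<kappa> * (real n powr (2 / 3) * ln (real n)) * sqrt (real n powr (2 / 3) * ln (real n))" using assms by real_asymp
qed

lemma deviation_probability_tendsto_0:
  "(\<lambda>n::nat. (real n + 1)\<^sup>2 * (2 * exp (- 2 * (ln (real n))\<^sup>2)) + (real n + 1) * (2 * exp (- 2 * (ln (real n))\<^sup>2))) \<longlonglongrightarrow> 0"
  by real_asymp

text \<open>The error of \<open>functional_linearization\<close> for \<open>\<bar>\<phi>\<bar> \<le>
  C/h\<^sup>2\<close> with Lipschitz constant \<open>C/h\<^sup>3\<close> on a window of length \<open>2h\<close>. The
  factor after \<open>e\<close> starts with the bound for the estimator and \<open>F0\<close>, centred at
  \<open>F0(t)\<close>, on the window: \<open>Cf\<close> is a local Lipschitz constant of \<open>F0\<close>, and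
  \<open>n \<gamma> h/2\<close> a lower bound for the number of observations in an interval of length
  \<open>h\<close>.\<close>

definition remainder_bound :: "real \<Rightarrow> real \<Rightarrow> real \<Rightarrow> nat \<Rightarrow> real \<Rightarrow> real \<Rightarrow> real \<Rightarrow> real \<Rightarrow> real" where
  "remainder_bound C Cf \<gamma> n h lam m0 e =
     (lam * sqrt m0) * (C / h\<^sup>2 + C / h ^ 3 * (2 * h)) / n +
     2 * (e * ((2 * Cf * h + lam / sqrt (n * \<gamma> * h / 2) + lam * sqrt m0 / (n * \<gamma> * h / 2)) * (2 * (C / h\<^sup>2) + C / h ^ 3 * (2 * h))))"

lemma remainder_bound_tendsto_0:
  fixes c \<gamma> \<Gamma> M0 C Cf :: real
  assumes "0 < c" "0 < \<gamma>" "0 < \<Gamma>" "0 < M0" "0 < C" "0 < Cf"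
  shows "(\<lambda>n. real n powr (2 / 7) * remainder_bound C Cf \<gamma> n (c * real n powr (- (1 / 7))) (ln (real n))
     (real n powr (2 / 3) * ln (real n)) (ln (real n) / sqrt (real n) + \<Gamma> * M0 / real n)) \<longlonglongrightarrow> 0"
  unfolding remainder_bound_def using assms by real_asymp

lemma influence_size_tendsto_0:
  fixes c C :: real
  assumes "0 < c" "0 < C"
  shows "(\<lambda>n::nat. real n powr (2 / 7) / real n * (C / (c * real n powr (- (1 / 7)))\<^sup>2)) \<longlonglongrightarrow> 0"
  using assms by real_asymp

lemma bandwidth_tendsto_0:
  fixes c :: real
  assumes "0 < c"
  shows "(\<lambda>n::nat. c * real n powr (- (1 / 7))) \<longlonglongrightarrow> 0"
  using assms by real_asymp

lemma bandwidth_identities: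
  fixes c x :: real
  assumes "0 < c" "0 < x"
  shows "x powr (2 / 7) * (c * x powr (- (1 / 7)))\<^sup>2 = c\<^sup>2"
    and "(x powr (2 / 7))\<^sup>2 / x / (c * x powr (- (1 / 7))) ^ 3 = 1 / c ^ 3"
proof -
  have 2: "(x powr (- (1 / 7)))\<^sup>2 = x powr (- (2 / 7))"
    using assms by (simp add: powr_powr powr_realpow[symmetric] flip: powr_numeral)
  have 3: "(x powr (- (1 / 7))) ^ 3 = x powr (- (3 / 7))"
    using assms by (simp add: powr_powr flip: powr_numeral)
  have 4: "(x powr (2 / 7))\<^sup>2 = x powr (4 / 7)"
    using assms by (simp add: powr_powr flip: powr_numeral)
  show "x powr (2 / 7) * (c * x powr (- (1 / 7)))\<^sup>2 = c\<^sup>2"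
    using assms unfolding power_mult_distrib 2 by (simp add: powr_add[symmetric] mult.left_commute)
  have "x powr (4 / 7) / x / (c ^ 3 * x powr (- (3 / 7))) = (x powr (4 / 7) / x powr (- (3 / 7)) / x) / c ^ 3"
    by simp
  also have "x powr (4 / 7) / x powr (- (3 / 7)) = x" using assms by (simp add: powr_diff[symmetric])
  finally show "(x powr (2 / 7))\<^sup>2 / x / (c * x powr (- (1 / 7))) ^ 3 = 1 / c ^ 3"
    using assms unfolding power_mult_distrib 3 4 by simp
qed

text \<open>The polynomial \<open>3r\<^sup>7 - 7r\<^sup>3 + 4\<close> has a double zero at 1, and the cofactor has
  positive coefficients.\<close>

lemma amse_factor:
  fixes r :: real
  assumes "0 < r" "r \<noteq> 1"
  shows "7 / 3 < r ^ 4 + 4 / 3 / r ^ 3"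
proof -
  have "3 * r ^ 7 - 7 * r ^ 3 + 4 = (r - 1)\<^sup>2 * (3 * r ^ 5 + 6 * r ^ 4 + 9 * r ^ 3 + 12 * r\<^sup>2 + 8 * r + 4)"
    by algebra
  moreover have "0 < (r - 1)\<^sup>2 * (3 * r ^ 5 + 6 * r ^ 4 + 9 * r ^ 3 + 12 * r\<^sup>2 + 8 * r + 4)"
    using assms by (intro mult_pos_pos add_pos_pos) auto
  ultimately have "7 * r ^ 3 < 3 * r ^ 7 + 4" by linarith
  then have "7 * r ^ 3 / (3 * r ^ 3) < (3 * r ^ 7 + 4) / (3 * r ^ 3)"
    using assms by (intro divide_strict_right_mono) auto
  also have "(3 * r ^ 7 + 4) / (3 * r ^ 3) = r ^ 4 + 4 / 3 / r ^ 3"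
  proof -
    have "r ^ 7 = r ^ 4 * r ^ 3" by (simp add: power_add[symmetric])
    then show ?thesis using assms by (simp add: field_simps)
  qed
  finally show ?thesis using assms by simp
qed

text \<open>In the variable \<open>r = c/c0\<close> the sum is \<open>A c0\<^sup>4 (r\<^sup>4 +
  4/(3r\<^sup>3))\<close>.\<close>

lemma power_sum_unique_minimum:
  fixes A B c0 c :: real
  assumes "0 < A" "0 < B" "0 < c0" "c0 ^ 7 = 3 * B / (4 * A)" "0 < c" "c \<noteq> c0"
  shows "A * c0 ^ 4 + B / c0 ^ 3 < A * c ^ 4 + B / c ^ 3"
proof -
  define r where "r = c / c0"
  have r: "0 < r" "r \<noteq> 1" "c = r * c0" using assms by (auto simp: r_def)
  have "c0 ^ 4 * c0 ^ 3 = 3 * B / (4 * A)" using assms(4) by (simp add: power_add[symmetric])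
  then have B: "B / c0 ^ 3 = 4 / 3 * (A * c0 ^ 4)" using assms by (simp add: field_simps)
  have "A * c ^ 4 + B / c ^ 3 = A * c0 ^ 4 * r ^ 4 + B / c0 ^ 3 / r ^ 3"
    by (simp add: r(3) power_mult_distrib mult.commute mult.left_commute)
  also have "\<dots> = A * c0 ^ 4 * (r ^ 4 + 4 / 3 / r ^ 3)" unfolding B by (simp add: algebra_simps)
  finally have eq: "A * c ^ 4 + B / c ^ 3 = A * c0 ^ 4 * (r ^ 4 + 4 / 3 / r ^ 3)" .
  have "A * c0 ^ 4 + B / c0 ^ 3 = A * c0 ^ 4 * (7 / 3)" unfolding B by (simp add: algebra_simps)
  also have "\<dots> < A * c0 ^ 4 * (r ^ 4 + 4 / 3 / r ^ 3)"
    using amse_factor[OF r(1,2)] assms by (intro mult_strict_left_mono) auto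
  finally show ?thesis using eq by simp
qed

section \<open>Linearization of the smoothed estimator\<close>

context smle_setting
begin

text \<open>The factor against which a distribution function is integrated after integration by parts; it is minus the
  derivative of \<open>u \<mapsto> rescaled_kernel k h (t - u)\<close>.\<close>

definition weight :: "real \<Rightarrow> real \<Rightarrow> real" where
  "weight h u = deriv k ((t - u) / h) / h\<^sup>2"

definition influence :: "real \<Rightarrow> real \<Rightarrow> real" where
  "influence h u = weight h u / g u"

lemma weight_measurable[measurable]: "weight h \<in> borel_measurable borel"
proof -
  have [measurable]: "deriv k \<in> borel_measurable borel" by (rule borel_measurable_continuous_onI[OF k'_cont])
  show ?thesis unfolding weight_def[abs_def] by measurable
qed

lemma influence_measurable[measurable]: "influence h \<in> borel_measurable borel"
  unfolding influence_def[abs_def] by measurable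

lemma weight_outside:
  assumes "0 < h" "u \<notin> {t - h<..<t + h}"
  shows "weight h u = 0"
proof -
  have "1 \<le> \<bar>(t - u) / h\<bar>" using assms by (auto simp: abs_real_def field_simps)
  then show ?thesis unfolding weight_def by (simp add: k'_zero)
qed

lemma influence_outside: "0 < h \<Longrightarrow> u \<notin> {t - h<..<t + h} \<Longrightarrow> influence h u = 0"
  by (simp add: influence_def weight_outside)

lemma influence_bounds:
  obtains C where "0 < C"
    "\<And>h u. 0 < h \<Longrightarrow> 0 \<le> t - h \<Longrightarrow> t + h \<le> M0 \<Longrightarrow> \<bar>influence h u\<bar> \<le> C / h\<^sup>2"
    "\<And>h u w. 0 < h \<Longrightarrow> h \<le> 1 \<Longrightarrow> 0 \<le> t - h \<Longrightarrow> t + h \<le> M0 \<Longrightarrow> t - h \<le> u \<Longrightarrow> u \<le> w \<Longrightarrow> w \<le> t + h \<Longrightarrow>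
       \<bar>influence h w - influence h u\<bar> \<le> C / h ^ 3 * (w - u)"
proof -
  obtain B1 where B1: "0 < B1" "\<And>u. \<bar>deriv k u\<bar> \<le> B1" by (rule k'_bounded) blast
  obtain L2 where L2: "0 < L2" "\<And>u v. \<bar>deriv k u - deriv k v\<bar> \<le> L2 * \<bar>u - v\<bar>" by (rule k'_lipschitz) blast
  obtain \<gamma> \<Gamma> where \<gamma>: "0 < \<gamma>" "0 < \<Gamma>" "\<And>x. 0 \<le> x \<Longrightarrow> x \<le> M0 \<Longrightarrow> \<gamma> \<le> g x" "\<And>x. 0 \<le> x \<Longrightarrow> x \<le> M0 \<Longrightarrow> g x \<le> \<Gamma>"
    by (rule g_bounds) blast
  obtain Lg where Lg: "0 < Lg" "\<And>x y. 0 \<le> x \<Longrightarrow> x \<le> M0 \<Longrightarrow> 0 \<le> y \<Longrightarrow> y \<le> M0 \<Longrightarrow> \<bar>g x - g y\<bar> \<le> Lg * \<bar>x - y\<bar>"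
    by (rule g_lipschitz) blast
  define C where "C = B1 / \<gamma> + (L2 / \<gamma> + B1 * Lg / \<gamma>\<^sup>2)"
  have parts: "0 < B1 / \<gamma>" "0 < L2 / \<gamma>" "0 < B1 * Lg / \<gamma>\<^sup>2" using B1 L2 Lg \<gamma> by simp_all
  then have C: "0 < C" by (simp add: C_def)
  have wb: "\<bar>weight h u\<bar> \<le> B1 / h\<^sup>2" for h u
    unfolding weight_def using B1(2) by (simp add: abs_divide divide_right_mono)
  have bd: "\<bar>influence h u\<bar> \<le> C / h\<^sup>2" if h: "0 < h" "0 \<le> t - h" "t + h \<le> M0" for h u
  proof (cases "u \<in> {t - h<..<t + h}")
    case True
    then have gu: "\<gamma> \<le> g u" using \<gamma>(3) h by simp
    have "\<bar>influence h u\<bar> = \<bar>weight h u\<bar> / g u" using gu \<gamma>(1) by (simp add: influence_def abs_divide)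
    also have "\<dots> \<le> (B1 / h\<^sup>2) / \<gamma>" using wb[of h u] gu \<gamma>(1) by (intro frac_le) auto
    also have "\<dots> = (B1 / \<gamma>) / h\<^sup>2" by simp
    also have "\<dots> \<le> C / h\<^sup>2" using parts by (intro divide_right_mono) (auto simp: C_def)
    finally show ?thesis .
  qed (use influence_outside h C in simp)
  have lip: "\<bar>influence h w - influence h u\<bar> \<le> C / h ^ 3 * (w - u)"
    if h: "0 < h" "h \<le> 1" "0 \<le> t - h" "t + h \<le> M0" and uw: "t - h \<le> u" "u \<le> w" "w \<le> t + h" for h u w
  proof -
    have gu: "\<gamma> \<le> g u" "\<gamma> \<le> g w" using \<gamma>(3) h uw by auto
    then have g0: "0 < g u" "0 < g w" using \<gamma>(1) by auto
    have "influence h w - influence h u = (weight h w - weight h u) / g w + weight h u * (g u - g w) / (g u * g w)"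
      using g0 by (simp add: influence_def field_simps)
    also have "\<bar>\<dots>\<bar> \<le> \<bar>weight h w - weight h u\<bar> / g w + \<bar>weight h u\<bar> * \<bar>g u - g w\<bar> / (g u * g w)"
      by (rule order_trans[OF abs_triangle_ineq]) (use g0 in \<open>simp add: abs_mult abs_divide\<close>)
    also have "\<dots> \<le> (L2 / h ^ 3 * (w - u)) / \<gamma> + (B1 / h ^ 3) * (Lg * (w - u)) / \<gamma>\<^sup>2"
    proof (rule add_mono)
      have "\<bar>weight h w - weight h u\<bar> = \<bar>deriv k ((t - w) / h) - deriv k ((t - u) / h)\<bar> / h\<^sup>2"
        unfolding weight_def by (simp add: diff_divide_distrib[symmetric] abs_divide)
      also have "\<dots> \<le> (L2 * \<bar>(t - w) / h - (t - u) / h\<bar>) / h\<^sup>2"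
        using L2(2) by (intro divide_right_mono) auto
      also have "\<bar>(t - w) / h - (t - u) / h\<bar> = (w - u) / h"
        using h uw by (simp add: diff_divide_distrib[symmetric] abs_divide)
      also have "(L2 * ((w - u) / h)) / h\<^sup>2 = L2 / h ^ 3 * (w - u)"
        by (simp add: power2_eq_square power3_eq_cube)
      finally have "\<bar>weight h w - weight h u\<bar> \<le> L2 / h ^ 3 * (w - u)" .
      then show "\<bar>weight h w - weight h u\<bar> / g w \<le> (L2 / h ^ 3 * (w - u)) / \<gamma>"
        using gu \<gamma>(1) L2(1) h uw by (intro frac_le) auto
      have "\<bar>weight h u\<bar> \<le> B1 / h ^ 3"
      proof -
        have "h ^ 3 \<le> h\<^sup>2" using h by (intro power_decreasing) auto
        then have "B1 / h\<^sup>2 \<le> B1 / h ^ 3" using B1 h by (intro divide_left_mono) auto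
        then show ?thesis using wb[of h u] by linarith
      qed
      moreover have "\<bar>g u - g w\<bar> \<le> Lg * (w - u)" using Lg(2)[of u w] h uw by simp
      ultimately have "\<bar>weight h u\<bar> * \<bar>g u - g w\<bar> \<le> (B1 / h ^ 3) * (Lg * (w - u))"
        using B1(1) h by (intro mult_mono) auto
      moreover have "\<gamma>\<^sup>2 \<le> g u * g w" unfolding power2_eq_square using gu \<gamma>(1) by (intro mult_mono) auto
      ultimately show "\<bar>weight h u\<bar> * \<bar>g u - g w\<bar> / (g u * g w) \<le> (B1 / h ^ 3) * (Lg * (w - u)) / \<gamma>\<^sup>2"
        using \<gamma>(1) B1(1) Lg(1) h uw by (intro frac_le) auto
    qed
    also have "\<dots> = (L2 / \<gamma> + B1 * Lg / \<gamma>\<^sup>2) / h ^ 3 * (w - u)"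
    proof -
      have "(L2 / h ^ 3 * (w - u)) / \<gamma> = (L2 / \<gamma>) / h ^ 3 * (w - u)"
        "(B1 / h ^ 3) * (Lg * (w - u)) / \<gamma>\<^sup>2 = (B1 * Lg / \<gamma>\<^sup>2) / h ^ 3 * (w - u)" by (simp_all add: ac_simps)
      then show ?thesis by (simp only: add_divide_distrib distrib_right)
    qed
    also have "\<dots> \<le> C / h ^ 3 * (w - u)"
      using parts h uw by (intro mult_right_mono divide_right_mono) (auto simp: C_def)
    finally show ?thesis .
  qed
  show ?thesis by (rule that[OF C bd lip])
qed

text \<open>Division by \<open>g\<close> is harmless although \<open>g\<close> may vanish beyond \<open>M0\<close>:
  the weight is zero outside the window.\<close>

lemma integral_influence_G:
  assumes h: "0 < h" "0 \<le> t - h" "t + h \<le> M0" and [measurable]: "H \<in> borel_measurable borel"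
  shows "(LINT u|interval_measure G. influence h u * H u) = (LINT u|lborel. weight h u * H u)"
proof -
  have "(LINT u|interval_measure G. influence h u * H u) = (LINT u|lborel. g u * (influence h u * H u))"
    by (rule has_density_integral[OF G_density]) measurable
  also have "\<dots> = (LINT u|lborel. weight h u * H u)"
  proof (intro Bochner_Integration.integral_cong refl)
    fix u
    show "g u * (influence h u * H u) = weight h u * H u"
    proof (cases "u \<in> {t - h<..<t + h}")
      case True
      obtain \<gamma> where "0 < \<gamma>" "\<forall>x\<in>{0..M0}. \<gamma> \<le> g x" using G_away by blast
      then have "g u \<noteq> 0" using True h by (auto dest!: bspec[of _ _ u])
      then show ?thesis by (simp add: influence_def)
    qed (use weight_outside[OF h(1)] influence_outside[OF h(1)] in simp)
  qed
  finally show ?thesis .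
qed

abbreviation "est h n \<omega> \<equiv> smle_density k h (\<lambda>i. T i \<omega>) (status X T \<omega>) n t"

lemma status_nonneg: "0 \<le> status X T \<omega> i" by (simp add: status_def)

lemma smle_eq_weight_integral:
  assumes "0 < h"
  shows "est h n \<omega> = (LINT u|lborel. weight h u * npmle (\<lambda>i. T i \<omega>) (status X T \<omega>) n u)"
proof -
  obtain B where B: "\<And>x. npmle (\<lambda>i. T i \<omega>) (status X T \<omega>) n x \<le> B" using npmle_bounded by blast
  show ?thesis unfolding smle_density_def weight_def
    by (rule integral_rescaled_kernel_interval_measure[OF assms npmle_mono npmle_right_cont npmle_at_bot B])
       (auto simp: status_nonneg)
qed

lemma smoothed_density_eq_weight_integral:
  assumes "0 < h"
  shows "(LINT u|lborel. f0 u * rescaled_kernel k h (t - u)) = (LINT u|lborel. weight h u * F0 u)"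
proof -
  have [measurable]: "k \<in> borel_measurable borel" by (rule borel_measurable_continuous_onI[OF k_cont])
  have "(LINT u|lborel. f0 u * rescaled_kernel k h (t - u)) = (LINT u|interval_measure F0. rescaled_kernel k h (t - u))"
    by (rule has_density_integral[OF F_density, symmetric]) (simp add: rescaled_kernel_def)
  also have "\<dots> = (LINT u|lborel. weight h u * F0 u)"
    unfolding weight_def by (rule integral_rescaled_kernel_interval_measure[OF assms F0_cdf(1,2,3,5)])
  finally show ?thesis .
qed

lemma smle_measurable: "est h n \<in> borel_measurable M" if "0 < h"
proof -
  have "(\<lambda>z. npmle (\<lambda>i. T i (fst z)) (\<lambda>i. of_bool (X i (fst z) \<le> T i (fst z))) n (snd z)) \<in> borel_measurable (M \<Otimes>\<^sub>M lborel)"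
    by (rule measurable_npmle) measurable
  then have [measurable]: "(\<lambda>z. npmle (\<lambda>i. T i (fst z)) (status X T (fst z)) n (snd z)) \<in> borel_measurable (M \<Otimes>\<^sub>M lborel)"
    by (simp add: status_def[abs_def])
  have "(\<lambda>\<omega>. LINT u|lborel. (\<lambda>z. weight h (snd z) * npmle (\<lambda>i. T i (fst z)) (status X T (fst z)) n (snd z)) (\<omega>, u)) \<in> borel_measurable M"
    by (intro lborel.borel_measurable_lebesgue_integral) measurable
  then show ?thesis unfolding smle_eq_weight_integral[OF that] by simp
qed

text \<open>Both functions are monotone, so between two grid points they differ by at most \<open>\<delta>\<close>
  plus the increase of \<open>G\<close> over the cell.\<close>

lemma empirical_from_grid:
  assumes n: "0 < n" and \<Gamma>: "\<And>x y. 0 \<le> x \<Longrightarrow> x \<le> y \<Longrightarrow> y \<le> M0 \<Longrightarrow> G y - G x \<le> \<Gamma> * (y - x)"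
    and grid: "\<And>j. j \<le> n \<Longrightarrow> \<bar>real (obs_count ts n (real j * M0 / n)) / n - G (real j * M0 / n)\<bar> \<le> \<delta>"
    and x: "0 \<le> x" "x \<le> M0"
  shows "\<bar>real (obs_count ts n x) / n - G x\<bar> \<le> \<delta> + \<Gamma> * M0 / n"
proof -
  have M0: "0 < M0" using t_pos t_interior by simp
  \<comment> \<open>at \<open>x = M0\<close> the index is lowered by one to keep the right end of the cell on the grid\<close>
  define j where "j = (if x = M0 then n - 1 else nat \<lfloor>x * n / M0\<rfloor>)"
  have j: "Suc j \<le> n" "real j * M0 / n \<le> x" "x \<le> real (Suc j) * M0 / n"
  proof -
    have "Suc j \<le> n \<and> real j * M0 / n \<le> x \<and> x \<le> real (Suc j) * M0 / n"
    proof (cases "x = M0")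
      case True
      then show ?thesis using n M0 by (auto simp: j_def of_nat_diff field_simps)
    next
      case False
      then have xM: "x < M0" using x by simp
      have nn: "0 \<le> x * n / M0" using x M0 by simp
      have jr: "real j \<le> x * n / M0" "x * n / M0 < real j + 1"
        using nn False by (auto simp: j_def)
      have "x * n / M0 < n" using xM M0 n by (simp add: field_simps)
      then have "real j < real n" using jr by linarith
      then show ?thesis using jr M0 n by (auto simp: field_simps)
    qed
    then show "Suc j \<le> n" "real j * M0 / n \<le> x" "x \<le> real (Suc j) * M0 / n" by auto
  qed
  let ?a = "real j * M0 / n" and ?b = "real (Suc j) * M0 / n"
  have b: "?b \<le> M0" "0 \<le> ?a"
  proof -
    have "real (Suc j) * M0 \<le> real n * M0" using j(1) M0 by (intro mult_right_mono) auto
    then show "?b \<le> M0" using n by (simp add: field_simps)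
  qed (use M0 in simp)
  have width: "\<Gamma> * (?b - ?a) = \<Gamma> * M0 / n" using n by (simp add: field_simps)
  have "G ?b - G ?a \<le> \<Gamma> * M0 / n" using \<Gamma>[of ?a ?b] b j width by auto
  moreover have "G ?a \<le> G x" "G x \<le> G ?b" using j by (auto intro: G_cdf(1))
  moreover have "real (obs_count ts n ?a) / n \<le> real (obs_count ts n x) / n"
    "real (obs_count ts n x) / n \<le> real (obs_count ts n ?b) / n"
    using j by (auto intro!: divide_right_mono obs_count_mono simp del: of_nat_Suc)
  moreover have "\<bar>real (obs_count ts n ?a) / n - G ?a\<bar> \<le> \<delta>" "\<bar>real (obs_count ts n ?b) / n - G ?b\<bar> \<le> \<delta>"
    using grid[of j] grid[of "Suc j"] j(1) by auto
  ultimately show ?thesis by linarith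
qed

definition linear_term :: "real \<Rightarrow> nat \<Rightarrow> 'a \<Rightarrow> real" where
  "linear_term h n \<omega> = (\<Sum>i<n. influence h (T i \<omega>) * (status X T \<omega> i - F0 (T i \<omega>))) / n"

definition good_sample :: "real \<Rightarrow> nat \<Rightarrow> 'a \<Rightarrow> bool" where
  "good_sample lam n \<omega> \<longleftrightarrow> windows_ok F0 lam n (\<lambda>i. X i \<omega>) (\<lambda>i. T i \<omega>) \<and>
     (\<forall>j\<le>n. \<bar>real (obs_count (\<lambda>i. T i \<omega>) n (real j * M0 / n)) / n - G (real j * M0 / n)\<bar> \<le> lam / sqrt n) \<and>
     inj_on (\<lambda>i. T i \<omega>) {..<n}"

text \<open>Near \<open>t\<close> the function \<open>F0\<close> stays at distance \<open>\<kappa>\<close> from 0 and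
  1, which is what the comparison of diagram and minorant requires. The bound for the estimator on the window comes
  from its values at the two end points \<open>t \<plusminus> h\<close>, which are compared with \<open>F0\<close> at
  \<open>t \<plusminus> 2h\<close>.\<close>

lemma linearization_on_good_event:
  obtains C Cf \<gamma> \<Gamma> \<kappa> r0 where "0 < C" "0 < Cf" "0 < \<gamma>" "0 < \<Gamma>" "0 < \<kappa>" "0 < r0" "r0 \<le> t" "t + r0 \<le> M0"
    "\<And>h u. 0 < h \<Longrightarrow> 0 \<le> t - h \<Longrightarrow> t + h \<le> M0 \<Longrightarrow> \<bar>influence h u\<bar> \<le> C / h\<^sup>2"
    "\<And>n h lam m0 e \<omega>. 0 < n \<Longrightarrow> 0 < h \<Longrightarrow> h \<le> 1 \<Longrightarrow> 2 * h \<le> r0 \<Longrightarrow> 0 \<le> lam \<Longrightarrow> e = lam / sqrt n + \<Gamma> * M0 / n \<Longrightarrow>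
      e \<le> \<gamma> * h / 4 \<Longrightarrow> 2 \<le> m0 \<Longrightarrow> 16 * real n * e \<le> m0 \<Longrightarrow> 8 * real n * lam \<le> \<kappa> * m0 * sqrt m0 \<Longrightarrow>
      good_sample lam n \<omega> \<Longrightarrow>
      \<bar>est h n \<omega> - (LINT u|lborel. f0 u * rescaled_kernel k h (t - u)) - linear_term h n \<omega>\<bar>
        \<le> remainder_bound C Cf \<gamma> n h lam m0 e"
proof -
  obtain C where C: "0 < C"
    "\<And>h u. 0 < h \<Longrightarrow> 0 \<le> t - h \<Longrightarrow> t + h \<le> M0 \<Longrightarrow> \<bar>influence h u\<bar> \<le> C / h\<^sup>2"
    "\<And>h u w. 0 < h \<Longrightarrow> h \<le> 1 \<Longrightarrow> 0 \<le> t - h \<Longrightarrow> t + h \<le> M0 \<Longrightarrow> t - h \<le> u \<Longrightarrow> u \<le> w \<Longrightarrow> w \<le> t + h \<Longrightarrow>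
       \<bar>influence h w - influence h u\<bar> \<le> C / h ^ 3 * (w - u)"
    by (rule influence_bounds) blast
  obtain \<gamma> \<Gamma> where \<gamma>: "0 < \<gamma>" "0 < \<Gamma>" "\<And>x. 0 \<le> x \<Longrightarrow> x \<le> M0 \<Longrightarrow> \<gamma> \<le> g x" "\<And>x. 0 \<le> x \<Longrightarrow> x \<le> M0 \<Longrightarrow> g x \<le> \<Gamma>"
    by (rule g_bounds) blast
  have Ginc: "\<gamma> * (y - x) \<le> G y - G x" "G y - G x \<le> \<Gamma> * (y - x)" if "0 \<le> x" "x \<le> y" "y \<le> M0" for x y
    using G_increments[of \<gamma> \<Gamma> x y] \<gamma> that by auto
  obtain \<epsilon> where \<epsilon>: "0 < \<epsilon>" "\<And>x y. 0 \<le> x \<Longrightarrow> x \<le> y \<Longrightarrow> y \<le> M0 \<Longrightarrow> \<epsilon> * (y - x) \<le> F0 y - F0 x"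
    by (rule F0_increment_lower) blast
  obtain \<rho> Cf where \<rho>: "0 < \<rho>" "0 < Cf" "\<And>x y. t - \<rho> \<le> x \<Longrightarrow> x \<le> y \<Longrightarrow> y \<le> t + \<rho> \<Longrightarrow> F0 y - F0 x \<le> Cf * (y - x)"
    by (rule F0_local_lipschitz) blast
  \<comment> \<open>half the distance to the end points of \<open>[0, M0]\<close>, so that \<open>F0\<close> is bounded away from 0 and 1 on \<open>[t - r0, t + r0]\<close>\<close>
  define r0 where "r0 = min \<rho> (min (t / 2) ((M0 - t) / 2))"
  have r0: "0 < r0" "r0 \<le> \<rho>" "r0 \<le> t / 2" "r0 \<le> (M0 - t) / 2"
    using \<rho>(1) t_pos t_interior by (auto simp: r0_def min_def)
  define \<kappa> where "\<kappa> = min (\<epsilon> / \<Gamma>) (min (\<epsilon> * (t - r0)) (\<epsilon> * (M0 - t - r0)))"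
  have \<kappa>: "0 < \<kappa>" "\<kappa> \<le> \<epsilon> / \<Gamma>" "\<kappa> \<le> \<epsilon> * (t - r0)" "\<kappa> \<le> \<epsilon> * (M0 - t - r0)"
    using \<epsilon>(1) \<gamma>(2) r0 t_pos t_interior by (auto simp: \<kappa>_def)
  have F0_low: "\<kappa> \<le> F0 u" if "t - r0 \<le> u" for u
  proof -
    have "\<epsilon> * (t - r0) \<le> F0 (t - r0) - F0 0" using \<epsilon>(2)[of 0 "t - r0"] r0 t_pos t_interior by simp
    then show ?thesis using \<kappa>(3) F0_cdf(4)[of 0] F0_cdf(1)[OF that] by linarith
  qed
  have F0_high: "F0 u \<le> 1 - \<kappa>" if "u \<le> t + r0" for u
  proof -
    have "\<epsilon> * (M0 - (t + r0)) \<le> F0 M0 - F0 (t + r0)" using \<epsilon>(2)[of "t + r0" M0] r0 t_pos t_interior by simp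
    then show ?thesis using \<kappa>(4) F0_cdf(5)[of M0] F0_cdf(1)[OF that] by (simp add: algebra_simps)
  qed
  have main: "\<bar>est h n \<omega> - (LINT u|lborel. f0 u * rescaled_kernel k h (t - u)) - linear_term h n \<omega>\<bar>
        \<le> remainder_bound C Cf \<gamma> n h lam m0 e"
    if n: "0 < n" and h: "0 < h" "h \<le> 1" "2 * h \<le> r0" and lam: "0 \<le> lam" and e: "e = lam / sqrt n + \<Gamma> * M0 / n"
      and eh: "e \<le> \<gamma> * h / 4" and m0: "2 \<le> m0" "16 * real n * e \<le> m0" "8 * real n * lam \<le> \<kappa> * m0 * sqrt m0"
      and good: "good_sample lam n \<omega>"
    for n h lam m0 e \<omega>
  proof -
    note win = good[unfolded good_sample_def, THEN conjunct1]
      and grid = good[unfolded good_sample_def, THEN conjunct2, THEN conjunct1]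
      and inj = good[unfolded good_sample_def, THEN conjunct2, THEN conjunct2]
    let ?ts = "\<lambda>i. T i \<omega>" and ?ds = "status X T \<omega>"
    have M0: "0 < M0" using t_pos t_interior by simp
    interpret S: current_status_sample ?ts ?ds n F0 G M0 lam e \<kappa> m0
    proof
      show "\<bar>\<Sum>l = a..<b. ?ds (sorted_index ?ts n l) - F0 (?ts (sorted_index ?ts n l))\<bar> \<le> lam * sqrt (real (b - a))"
        if "a \<le> b" "b \<le> n" for a b
        using win that unfolding windows_ok_def status_def by auto
      show "\<bar>real (obs_count ?ts n x) / n - G x\<bar> \<le> e" if "0 \<le> x" "x \<le> M0" for x
        unfolding e by (rule empirical_from_grid[OF n Ginc(2)]) (use grid that in auto)
      show "\<kappa> * (G y - G x) \<le> F0 y - F0 x" if "0 \<le> x" "x \<le> y" "y \<le> M0" for x y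
      proof -
        have "\<kappa> * (G y - G x) \<le> (\<epsilon> / \<Gamma>) * (G y - G x)"
          using \<kappa>(2) G_cdf(1)[OF that(2)] by (intro mult_right_mono) auto
        also have "\<dots> \<le> (\<epsilon> / \<Gamma>) * (\<Gamma> * (y - x))"
          using Ginc(2)[OF that] \<epsilon>(1) \<gamma>(2) by (intro mult_left_mono) auto
        also have "\<dots> \<le> F0 y - F0 x" using \<epsilon>(2)[OF that] \<gamma>(2) by simp
        finally show ?thesis .
      qed
      show "0 \<le> e" unfolding e using lam \<gamma>(2) M0 by simp
    qed (use n inj status_nonneg F0_cdf(1) F0_neg F0_right \<kappa>(1) lam m0 in auto)
    define b where "b = n * \<gamma> * h / 2"
    have b: "0 < b" using n \<gamma>(1) h by (simp add: b_def)
    define \<alpha> where "\<alpha> = 2 * Cf * h + lam / sqrt b + lam * sqrt m0 / b"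
    have rest: "0 \<le> lam / sqrt b" "0 \<le> lam * sqrt m0 / b" using lam b m0 by simp_all
    have loc: "0 \<le> t - 2 * h" "t + 2 * h \<le> M0" "t - r0 \<le> t - 2 * h" "t + 2 * h \<le> t + r0" "0 \<le> t - h" "t + h \<le> M0"
      using h r0 by auto
    \<comment> \<open>an interval of length \<open>h\<close> contains at least \<open>b\<close> observations\<close>
    have b_le: "b \<le> n * (G v - G u - 2 * e)" if "0 \<le> u" "u + h = v" "v \<le> M0" for u v
    proof -
      have "\<gamma> * h \<le> G v - G u" using Ginc(1)[of u v] that h by auto
      then have "\<gamma> * h / 2 \<le> G v - G u - 2 * e" using eh by linarith
      then have "real n * (\<gamma> * h / 2) \<le> n * (G v - G u - 2 * e)" by (intro mult_left_mono) auto
      then show ?thesis by (simp add: b_def mult.assoc)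
    qed
    have up: "npmle ?ts ?ds n (t + h) \<le> F0 (t + 2 * h) + lam / sqrt b + lam * sqrt m0 / b"
      unfolding S.\<eta>_def[symmetric]
      by (rule S.npmle_le_at) (use F0_low F0_high b_le[of "t + h" "t + 2 * h"] b h r0 loc t_pos in auto)
    have low: "F0 (t - 2 * h) - lam / sqrt b - lam * sqrt m0 / b \<le> npmle ?ts ?ds n (t - h)"
      unfolding S.\<eta>_def[symmetric]
      by (rule S.npmle_ge_at) (use F0_low F0_high b_le[of "t - 2 * h" "t - h"] b h r0 loc t_pos t_interior in auto)
    have Fup: "F0 (t + 2 * h) - F0 t \<le> 2 * Cf * h" and Flow: "F0 t - F0 (t - 2 * h) \<le> 2 * Cf * h"
      using \<rho>(3)[of t "t + 2 * h"] \<rho>(3)[of "t - 2 * h" t] h r0 by auto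
    have \<alpha>1: "\<bar>npmle ?ts ?ds n u - F0 t\<bar> \<le> \<alpha>" if "t - h \<le> u" "u \<le> t + h" for u
    proof -
      have "npmle ?ts ?ds n u \<le> npmle ?ts ?ds n (t + h)" "npmle ?ts ?ds n (t - h) \<le> npmle ?ts ?ds n u"
        using that by (auto intro!: npmle_mono status_nonneg)
      then show ?thesis using up low Fup Flow by (simp add: \<alpha>_def abs_le_iff)
    qed
    have \<alpha>2: "\<bar>F0 u - F0 t\<bar> \<le> \<alpha>" if "t - h \<le> u" "u \<le> t + h" for u
    proof -
      have "F0 u \<le> F0 (t + 2 * h)" "F0 (t - 2 * h) \<le> F0 u" using that h by (auto intro!: F0_cdf(1))
      then show ?thesis using Fup Flow rest by (simp add: \<alpha>_def abs_le_iff)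
    qed
    have G1: "prob_space (interval_measure G)" "sets (interval_measure G) = sets borel" "cdf (interval_measure G) = G"
    proof -
      interpret T: real_distribution "distr M borel (T 0)" by (rule real_distribution_T)
      show "prob_space (interval_measure G)" using T.prob_space_axioms by (simp add: distr_T)
      show "cdf (interval_measure G) = G" using cdf_T[of 0] by (simp add: distr_T)
    qed simp
    have Fm: "npmle ?ts ?ds n \<in> borel_measurable borel"
      by (rule borel_measurable_mono) (auto intro!: monoI npmle_mono status_nonneg)
    have F0m: "F0 \<in> borel_measurable borel"
      by (rule borel_measurable_mono) (auto intro!: monoI F0_cdf(1))
    have "\<bar>(LINT u|interval_measure G. influence h u * npmle ?ts ?ds n u) - (LINT u|interval_measure G. influence h u * F0 u)
        - (\<Sum>i<n. influence h (?ts i) * (?ds i - F0 (?ts i))) / n\<bar>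
      \<le> S.\<eta> * (C / h\<^sup>2 + C / h ^ 3 * ((t + h) - (t - h))) / n + 2 * (e * (\<alpha> * (2 * (C / h\<^sup>2) + C / h ^ 3 * ((t + h) - (t - h)))))"
    proof (rule S.functional_linearization[OF G1 _ _ _ _ _ \<alpha>1 \<alpha>2 influence_measurable influence_outside[OF h(1)]])
      show "\<bar>influence h u\<bar> \<le> C / h\<^sup>2" for u by (rule C(2)) (use h loc in auto)
      show "\<bar>influence h w - influence h u\<bar> \<le> C / h ^ 3 * (w - u)" if "t - h \<le> u" "u \<le> w" "w \<le> t + h" for u w
        by (rule C(3)) (use h loc that in auto)
    qed (use h loc F0_low F0_high C(1) r0 in auto)
    also have "\<dots> = remainder_bound C Cf \<gamma> n h lam m0 e"
      by (simp add: remainder_bound_def S.\<eta>_def \<alpha>_def b_def)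
    finally show ?thesis
      unfolding integral_influence_G[OF h(1) loc(5,6) Fm] integral_influence_G[OF h(1) loc(5,6) F0m]
        smle_eq_weight_integral[OF h(1)] smoothed_density_eq_weight_integral[OF h(1)] linear_term_def .
  qed
  show ?thesis
    by (rule that[OF C(1) \<rho>(2) \<gamma>(1,2) \<kappa>(1) r0(1) _ _ C(2) main]) (use r0 t_pos t_interior in auto)
qed

end

section \<open>Asymptotic normality\<close>

context smle_setting
begin

text \<open>By independence the law of \<open>(X\<^sub>i, T\<^sub>i)\<close> is a product, so the expectation may be
  taken first over \<open>X\<^sub>i\<close>.\<close>

lemma expectation_pair:
  fixes f :: "real \<times> real \<Rightarrow> real"
  assumes f[measurable]: "f \<in> borel_measurable (borel \<Otimes>\<^sub>M borel)" and bd: "\<And>z. \<bar>f z\<bar> \<le> B"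
  shows "expectation (\<lambda>\<omega>. f (X i \<omega>, T i \<omega>)) = (LINT \<tau>|interval_measure G. LINT x|interval_measure F0. f (x, \<tau>))"
proof -
  interpret X: real_distribution "interval_measure F0" using real_distribution_X[of 0] by (simp add: distr_X)
  interpret T: real_distribution "interval_measure G" using real_distribution_T[of 0] by (simp add: distr_T)
  interpret P: pair_prob_space "interval_measure F0" "interval_measure G" ..
  have fm: "f \<in> borel_measurable (interval_measure F0 \<Otimes>\<^sub>M interval_measure G)"
    using f by (simp cong: measurable_cong_sets sets_pair_measure_cong)
  have int: "integrable (interval_measure F0 \<Otimes>\<^sub>M interval_measure G) f"
    by (rule P.P.integrable_const_bound[of _ B]) (use bd fm in auto)
  have "expectation (\<lambda>\<omega>. f (X i \<omega>, T i \<omega>)) = (LINT z|(distr M (borel \<Otimes>\<^sub>M borel) (\<lambda>\<omega>. (X i \<omega>, T i \<omega>))). f z)"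
    by (subst integral_distr) auto
  also have "\<dots> = (LINT z|(interval_measure F0 \<Otimes>\<^sub>M interval_measure G). f z)" by (simp add: distr_XT)
  also have "\<dots> = (LINT \<tau>|interval_measure G. LINT x|interval_measure F0. f (x, \<tau>))"
    using P.integral_snd[of "\<lambda>x \<tau>. f (x, \<tau>)"] int by (simp add: case_prod_beta')
  finally show ?thesis .
qed

definition summand :: "real \<Rightarrow> real \<times> real \<Rightarrow> real" where
  "summand h z = influence h (snd z) * (of_bool (fst z \<le> snd z) - F0 (snd z))"

lemma F0_measurable[measurable]: "F0 \<in> borel_measurable borel"
  by (rule borel_measurable_mono) (auto intro!: monoI F0_cdf(1))

lemma summand_measurable[measurable]: "summand h \<in> borel_measurable (borel \<Otimes>\<^sub>M borel)"
  unfolding summand_def[abs_def] by measurable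

lemma summand_bound:
  assumes "\<And>u. \<bar>influence h u\<bar> \<le> B"
  shows "\<bar>summand h z\<bar> \<le> B"
proof -
  have "\<bar>of_bool (fst z \<le> snd z) - F0 (snd z)\<bar> \<le> 1" using F0_cdf(4,5)[of "snd z"] by auto
  then have "\<bar>influence h (snd z)\<bar> * \<bar>of_bool (fst z \<le> snd z) - F0 (snd z)\<bar> \<le> B * 1"
    using assms[of "snd z"] by (intro mult_mono) auto
  then show ?thesis by (simp add: summand_def abs_mult)
qed

text \<open>Given \<open>T\<^sub>i = \<tau>\<close> the indicator is a Bernoulli variable with success probability
  \<open>F0 \<tau>\<close>; the powers of \<open>h\<close> come from the substitution \<open>u = t - h
  v\<close>.\<close>

lemma summand_moments:
  assumes bd: "\<And>u. \<bar>influence h u\<bar> \<le> B" and h: "0 < h" "0 \<le> t - h" "t + h \<le> M0"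
  shows "expectation (\<lambda>\<omega>. summand h (X i \<omega>, T i \<omega>)) = 0"
    and "expectation (\<lambda>\<omega>. (summand h (X i \<omega>, T i \<omega>))\<^sup>2) =
      (LINT v|lborel. (deriv k v)\<^sup>2 * (F0 (t - h * v) * (1 - F0 (t - h * v)) / g (t - h * v))) / h ^ 3"
proof -
  interpret X: real_distribution "interval_measure F0" using real_distribution_X[of 0] by (simp add: distr_X)
  have i: "(LINT x|interval_measure F0. of_bool (x \<le> \<tau>)) = F0 \<tau>" "integrable (interval_measure F0) (\<lambda>x. of_bool (x \<le> \<tau>) :: real)" for \<tau>
  proof -
    have eq: "(\<lambda>x. of_bool (x \<le> \<tau>) :: real) = indicator {..\<tau>}" by (auto simp: fun_eq_iff indicator_def)
    show "(LINT x|interval_measure F0. of_bool (x \<le> \<tau>)) = F0 \<tau>"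
      unfolding eq using cdf_X[of 0] by (simp add: distr_X cdf_def fun_eq_iff)
    show "integrable (interval_measure F0) (\<lambda>x. of_bool (x \<le> \<tau>) :: real)"
      unfolding eq by (rule integrable_real_indicator) (auto simp: X.emeasure_eq_measure)
  qed
  have "expectation (\<lambda>\<omega>. summand h (X i \<omega>, T i \<omega>)) =
      (LINT \<tau>|interval_measure G. LINT x|interval_measure F0. summand h (x, \<tau>))"
    by (rule expectation_pair[of _ B]) (use summand_bound[OF bd] in auto)
  also have "\<dots> = (LINT \<tau>|interval_measure G. 0)"
    using i by (intro Bochner_Integration.integral_cong) (auto simp: summand_def X.prob_space[simplified])
  finally show "expectation (\<lambda>\<omega>. summand h (X i \<omega>, T i \<omega>)) = 0" by simp
  have B: "0 \<le> B" using bd[of 0] by linarith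
  have "expectation (\<lambda>\<omega>. (summand h (X i \<omega>, T i \<omega>))\<^sup>2) =
      (LINT \<tau>|interval_measure G. LINT x|interval_measure F0. (summand h (x, \<tau>))\<^sup>2)"
  proof (rule expectation_pair[of "\<lambda>z. (summand h z)\<^sup>2" "B\<^sup>2"])
    fix z
    have "\<bar>summand h z\<bar>\<^sup>2 \<le> B\<^sup>2" using summand_bound[OF bd, of z] by (intro power_mono) auto
    then show "\<bar>(summand h z)\<^sup>2\<bar> \<le> B\<^sup>2" by simp
  qed measurable
  also have "\<dots> = (LINT \<tau>|interval_measure G. influence h \<tau> * (influence h \<tau> * (F0 \<tau> * (1 - F0 \<tau>))))"
  proof (intro Bochner_Integration.integral_cong refl)
    fix \<tau>
    have "(LINT x|interval_measure F0. (summand h (x, \<tau>))\<^sup>2) =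
        (LINT x|interval_measure F0. (influence h \<tau>)\<^sup>2 * ((1 - 2 * F0 \<tau>) * of_bool (x \<le> \<tau>) + (F0 \<tau>)\<^sup>2))"
      by (intro Bochner_Integration.integral_cong) (auto simp: summand_def power_mult_distrib power2_eq_square algebra_simps)
    also have "\<dots> = (influence h \<tau>)\<^sup>2 * ((1 - 2 * F0 \<tau>) * F0 \<tau> + (F0 \<tau>)\<^sup>2)"
      using i by (simp add: X.prob_space[simplified])
    also have "\<dots> = influence h \<tau> * (influence h \<tau> * (F0 \<tau> * (1 - F0 \<tau>)))"
      by (simp add: power2_eq_square algebra_simps)
    finally show "(LINT x|interval_measure F0. (summand h (x, \<tau>))\<^sup>2) =
        influence h \<tau> * (influence h \<tau> * (F0 \<tau> * (1 - F0 \<tau>)))" .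
  qed
  also have "\<dots> = (LINT u|lborel. weight h u * (influence h u * (F0 u * (1 - F0 u))))"
    by (rule integral_influence_G[OF h]) measurable
  also have "\<dots> = \<bar>- h\<bar> *\<^sub>R (LINT v|lborel. weight h (t + (- h) * v) * (influence h (t + (- h) * v) * (F0 (t + (- h) * v) * (1 - F0 (t + (- h) * v)))))"
    by (rule lborel_integral_real_affine) (use h in simp)
  also have "\<dots> = h * (LINT v|lborel. ((deriv k v)\<^sup>2 * (F0 (t - h * v) * (1 - F0 (t - h * v)) / g (t - h * v))) / h ^ 4)"
  proof -
    have "weight h (t + (- h) * v) * (influence h (t + (- h) * v) * (F0 (t + (- h) * v) * (1 - F0 (t + (- h) * v)))) =
        ((deriv k v)\<^sup>2 * (F0 (t - h * v) * (1 - F0 (t - h * v)) / g (t - h * v))) / h ^ 4" for v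
    proof -
      have "weight h (t + (- h) * v) = deriv k v / h\<^sup>2" using h by (simp add: weight_def)
      moreover have "h ^ 4 = h\<^sup>2 * h\<^sup>2" by (simp add: power_add[symmetric])
      ultimately show ?thesis by (simp add: influence_def power2_eq_square ac_simps)
    qed
    then show ?thesis using h by simp
  qed
  also have "\<dots> = (LINT v|lborel. (deriv k v)\<^sup>2 * (F0 (t - h * v) * (1 - F0 (t - h * v)) / g (t - h * v))) / h ^ 3"
    unfolding Bochner_Integration.integral_divide_zero using h by (simp add: power_numeral_reduce)
  finally show "expectation (\<lambda>\<omega>. (summand h (X i \<omega>, T i \<omega>))\<^sup>2) =
      (LINT v|lborel. (deriv k v)\<^sup>2 * (F0 (t - h * v) * (1 - F0 (t - h * v)) / g (t - h * v))) / h ^ 3" .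
qed

definition bw :: "real \<Rightarrow> nat \<Rightarrow> real" where
  "bw c n = c * real n powr (- (1 / 7))"

lemma bw_tendsto_0: "0 < c \<Longrightarrow> bw c \<longlonglongrightarrow> 0"
  unfolding bw_def[abs_def] by (rule bandwidth_tendsto_0)

lemma bw_eventually:
  assumes c: "0 < c" and r: "0 < r"
  shows "\<forall>\<^sub>F n in sequentially. 0 < n \<and> 0 < bw c n \<and> bw c n < r"
  using order_tendstoD(2)[OF bw_tendsto_0[OF c] r] eventually_gt_at_top[of 0]
  by eventually_elim (use c in \<open>auto simp: bw_def\<close>)

lemma smle_var_pos:
  assumes "0 < c"
  shows "0 < smle_var k F0 g t c"
proof -
  obtain \<gamma> where "0 < \<gamma>" "\<forall>x\<in>{0..M0}. \<gamma> \<le> g x" using G_away by blast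
  then have "0 < g t" using t_pos t_interior by (auto dest!: bspec[of _ _ t])
  then show ?thesis using F0_t_strictly_between k'_square_integral_pos assms
    by (simp add: smle_var_def)
qed

lemma linear_term_char_tendsto:
  assumes c: "0 < c"
  shows "(\<lambda>n. char (distr M borel (\<lambda>\<omega>. real n powr (2 / 7) * linear_term (bw c n) n \<omega>)) s) \<longlonglongrightarrow>
     complex_of_real (exp (- (s\<^sup>2 * smle_var k F0 g t c / 2)))"
proof -
  obtain C where C: "0 < C"
    "\<And>h u. 0 < h \<Longrightarrow> 0 \<le> t - h \<Longrightarrow> t + h \<le> M0 \<Longrightarrow> \<bar>influence h u\<bar> \<le> C / h\<^sup>2"
    by (rule influence_bounds) blast
  define Y where "Y n i \<omega> = real n powr (2 / 7) / n * summand (bw c n) (X i \<omega>, T i \<omega>)" for n i \<omega>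
  define J where "J n = (LINT v|lborel. (deriv k v)\<^sup>2 * (F0 (t - bw c n * v) * (1 - F0 (t - bw c n * v)) / g (t - bw c n * v)))" for n
  define v where "v n = J n / c ^ 3" for n
  have ev: "\<forall>\<^sub>F n in sequentially. 0 < n \<and> 0 < bw c n \<and> bw c n < min t (M0 - t)"
    by (rule bw_eventually[OF c]) (use t_pos t_interior in simp)
  have sum: "real n powr (2 / 7) * linear_term (bw c n) n \<omega> = (\<Sum>i<n. Y n i \<omega>)" for n \<omega>
    by (simp add: linear_term_def Y_def summand_def status_def sum_distrib_left sum_divide_distrib)
  have Jlim: "J \<longlonglongrightarrow> (LINT v|lborel. (deriv k v)\<^sup>2) * (F0 t * (1 - F0 t) / g t)"
    unfolding J_def
    by (rule local_average_tendsto(1)[OF _ _ _ variance_factor_cont bw_tendsto_0[OF c]])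
       (use k'_outside in \<open>auto intro!: continuous_intros k'_cont\<close>)
  have vlim: "v \<longlonglongrightarrow> smle_var k F0 g t c"
  proof -
    have "v \<longlonglongrightarrow> (LINT v|lborel. (deriv k v)\<^sup>2) * (F0 t * (1 - F0 t) / g t) / c ^ 3"
      unfolding v_def[abs_def] by (rule tendsto_divide[OF Jlim tendsto_const]) (use c in simp)
    moreover have "(LINT v|lborel. (deriv k v)\<^sup>2) * (F0 t * (1 - F0 t) / g t) / c ^ 3 = smle_var k F0 g t c"
      by (simp add: smle_var_def ac_simps)
    ultimately show ?thesis by simp
  qed
  have "(\<lambda>n. char (distr M borel (\<lambda>\<omega>. \<Sum>i<n. Y n i \<omega>)) s) \<longlonglongrightarrow> complex_of_real (exp (- (s\<^sup>2 * smle_var k F0 g t c / 2)))"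
  proof (rule triangular_array_char_tendsto[OF _ _ _ _ influence_size_tendsto_0[OF c C(1), folded bw_def] vlim])
    have "indep_vars (\<lambda>_. borel) (Y n) {..<n}" for n
      unfolding Y_def[abs_def] by (rule indep_vars_compose2[OF pairs_indep]) measurable
    then show "\<forall>\<^sub>F n in sequentially. indep_vars (\<lambda>_. borel) (Y n) {..<n}" by simp
    show "\<forall>\<^sub>F n in sequentially. \<forall>i<n. \<forall>\<omega>\<in>space M. \<bar>Y n i \<omega>\<bar> \<le> real n powr (2 / 7) / real n * (C / (bw c n)\<^sup>2)"
      using ev
    proof eventually_elim
      case (elim n)
      have bd: "\<bar>influence (bw c n) u\<bar> \<le> C / (bw c n)\<^sup>2" for u by (rule C(2)) (use elim in auto)
      show ?case
        unfolding Y_def abs_mult by (intro allI impI ballI mult_mono summand_bound bd) auto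
    qed
    show "\<forall>\<^sub>F n in sequentially. \<forall>i<n. expectation (Y n i) = 0"
      using ev
    proof eventually_elim
      case (elim n)
      have bd: "\<bar>influence (bw c n) u\<bar> \<le> C / (bw c n)\<^sup>2" for u by (rule C(2)) (use elim in auto)
      show ?case using summand_moments(1)[OF bd] elim by (simp add: Y_def[abs_def])
    qed
    show "\<forall>\<^sub>F n in sequentially. \<forall>i<n. expectation (\<lambda>\<omega>. (Y n i \<omega>)\<^sup>2) = v n / real n"
      using ev
    proof eventually_elim
      case (elim n)
      have bd: "\<bar>influence (bw c n) u\<bar> \<le> C / (bw c n)\<^sup>2" for u by (rule C(2)) (use elim in auto)
      have "expectation (\<lambda>\<omega>. (Y n i \<omega>)\<^sup>2) = v n / real n" for i
      proof -
        have "expectation (\<lambda>\<omega>. (Y n i \<omega>)\<^sup>2) = (real n powr (2 / 7) / n)\<^sup>2 * (J n / (bw c n) ^ 3)"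
          unfolding Y_def power_mult_distrib J_def using summand_moments(2)[OF bd] elim by simp
        also have "\<dots> = ((real n powr (2 / 7))\<^sup>2 / n / (bw c n) ^ 3) * J n / n"
          by (simp add: power_divide power2_eq_square)
        also have "\<dots> = v n / n" using elim bandwidth_identities(2)[OF c, of "real n", folded bw_def] by (simp add: v_def)
        finally show ?thesis .
      qed
      then show ?case by simp
    qed
  qed
  then show ?thesis by (simp add: sum)
qed

text \<open>The normalized error is the linear term, plus the normalized bias, plus a remainder. The remainder is
  deterministically small on the good samples, and the probability of the others tends to zero.\<close>

theorem smle_asymptotic_normality:
  assumes c: "0 < c"
  shows "conv_in_distr M
        (\<lambda>n \<omega>. real n powr (2 / 7) * (est (bw c n) n \<omega> - f0 t))
        (normal_law (smle_mean k f0 t c) (smle_var k F0 g t c))"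
proof (rule conv_in_distr_normal[OF _ _ linear_term_char_tendsto[OF c] _ smle_var_pos[OF c]])
  show Lm: "random_variable borel (\<lambda>\<omega>. real n powr (2 / 7) * linear_term (bw c n) n \<omega>)" for n
    unfolding linear_term_def[abs_def] status_def by measurable
  show Zm: "random_variable borel (\<lambda>\<omega>. real n powr (2 / 7) * (est (bw c n) n \<omega> - f0 t))" for n
  proof (cases "n = 0")
    case False
    then have [measurable]: "est (bw c n) n \<in> borel_measurable M" using c by (intro smle_measurable) (simp add: bw_def)
    show ?thesis by measurable
  qed simp
  define bias where "bias n = real n powr (2 / 7) * ((LINT u|lborel. f0 u * rescaled_kernel k (bw c n) (t - u)) - f0 t)" for n
  have bias: "bias \<longlonglongrightarrow> smle_mean k f0 t c"
  proof -
    have "(\<lambda>n. c\<^sup>2 * (((LINT u|lborel. f0 u * rescaled_kernel k (bw c n) (t - u)) - f0 t) / (bw c n)\<^sup>2))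
        \<longlonglongrightarrow> c\<^sup>2 * (1 / 2 * second_moment k * deriv (deriv f0) t)"
      by (intro tendsto_mult tendsto_const kernel_bias_tendsto f0_meas f0_twice_diff f0''_cont bw_tendsto_0[OF c]
          eventually_mono[OF bw_eventually[OF c zero_less_one]]) auto
    moreover have "\<forall>\<^sub>F n in sequentially. c\<^sup>2 * (((LINT u|lborel. f0 u * rescaled_kernel k (bw c n) (t - u)) - f0 t) / (bw c n)\<^sup>2) = bias n"
      using bw_eventually[OF c zero_less_one]
    proof eventually_elim
      case (elim n)
      have "c\<^sup>2 / (bw c n)\<^sup>2 = real n powr (2 / 7)"
        using bandwidth_identities(1)[OF c, of "real n", folded bw_def] elim by (simp add: field_simps)
      moreover have "c\<^sup>2 * (d / (bw c n)\<^sup>2) = c\<^sup>2 / (bw c n)\<^sup>2 * d" for d by simp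
      ultimately show ?case by (simp only: bias_def)
    qed
    ultimately have "bias \<longlonglongrightarrow> c\<^sup>2 * (1 / 2 * second_moment k * deriv (deriv f0) t)" by (rule Lim_transform_eventually)
    then show ?thesis by (simp add: smle_mean_def mult.left_commute mult.assoc)
  qed
  obtain C Cf \<gamma> \<Gamma> \<kappa> r0 where const: "0 < C" "0 < Cf" "0 < \<gamma>" "0 < \<Gamma>" "0 < \<kappa>" "0 < r0" "r0 \<le> t" "t + r0 \<le> M0"
    and lin: "\<And>n h lam m0 e \<omega>. 0 < n \<Longrightarrow> 0 < h \<Longrightarrow> h \<le> 1 \<Longrightarrow> 2 * h \<le> r0 \<Longrightarrow> 0 \<le> lam \<Longrightarrow> e = lam / sqrt n + \<Gamma> * M0 / n \<Longrightarrow>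
      e \<le> \<gamma> * h / 4 \<Longrightarrow> 2 \<le> m0 \<Longrightarrow> 16 * real n * e \<le> m0 \<Longrightarrow> 8 * real n * lam \<le> \<kappa> * m0 * sqrt m0 \<Longrightarrow>
      good_sample lam n \<omega> \<Longrightarrow>
      \<bar>est h n \<omega> - (LINT u|lborel. f0 u * rescaled_kernel k h (t - u)) - linear_term h n \<omega>\<bar>
        \<le> remainder_bound C Cf \<gamma> n h lam m0 e"
    by (rule linearization_on_good_event) blast
  have M0: "0 < M0" using t_pos t_interior by simp
  note rate = smle_rate_conditions[OF c const(3,5,4) M0 const(6), folded bw_def]
  define rb where "rb n = remainder_bound C Cf \<gamma> n (bw c n) (ln (real n)) (real n powr (2 / 3) * ln (real n))
      (ln (real n) / sqrt (real n) + \<Gamma> * M0 / real n)" for n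
  have rb: "(\<lambda>n. real n powr (2 / 7) * rb n) \<longlonglongrightarrow> 0"
    unfolding rb_def bw_def by (rule remainder_bound_tendsto_0[OF c const(3,4) M0 const(1,2)])
  fix \<epsilon> :: real assume \<epsilon>: "0 < \<epsilon>"
  let ?D = "\<lambda>n \<omega>. real n powr (2 / 7) * (est (bw c n) n \<omega> - f0 t) - real n powr (2 / 7) * linear_term (bw c n) n \<omega> - smle_mean k f0 t c"
  have bias_ev: "\<forall>\<^sub>F n in sequentially. \<bar>bias n - smle_mean k f0 t c\<bar> < \<epsilon> / 2"
    using tendstoD[OF bias, of "\<epsilon> / 2"] \<epsilon> by (simp add: dist_real_def)
  have rb_ev: "\<forall>\<^sub>F n in sequentially. real n powr (2 / 7) * rb n < \<epsilon> / 2"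
    using order_tendstoD(2)[OF rb, of "\<epsilon> / 2"] \<epsilon> by simp
  have "\<forall>\<^sub>F n in sequentially. prob {\<omega>\<in>space M. \<epsilon> < \<bar>?D n \<omega>\<bar>} \<le>
      (real n + 1)\<^sup>2 * (2 * exp (- 2 * (ln (real n))\<^sup>2)) + (real n + 1) * (2 * exp (- 2 * (ln (real n))\<^sup>2))"
    using bias_ev rb_ev bw_eventually[OF c zero_less_one] rate
  proof eventually_elim
    case (elim n)
    define lam where "lam = ln (real n)"
    have n: "0 < n" using elim(3) by simp
    have hh: "0 < bw c n" using elim(3) by simp
    have lam: "0 \<le> lam" using n by (simp add: lam_def)
    let ?B1 = "{\<omega>\<in>space M. \<not> windows_ok F0 lam n (\<lambda>i. X i \<omega>) (\<lambda>i. T i \<omega>)}"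
    let ?B2 = "{\<omega>\<in>space M. \<exists>j\<le>n. lam / sqrt n < \<bar>real (obs_count (\<lambda>i. T i \<omega>) n (real j * M0 / n)) / n - G (real j * M0 / n)\<bar>}"
    let ?B3 = "{\<omega>\<in>space M. \<not> inj_on (\<lambda>i. T i \<omega>) {..<n}}"
    note B1 = windows_deviation[OF lam, of n]
    note B2 = grid_deviation[OF lam n, of "\<lambda>j. real j * M0 / n"]
    note B3 = ties_null[OF G_no_atoms, of n]
    have sub: "{\<omega>\<in>space M. \<epsilon> < \<bar>?D n \<omega>\<bar>} \<subseteq> ?B1 \<union> ?B2 \<union> ?B3"
    proof
      fix \<omega> assume \<omega>: "\<omega> \<in> {\<omega>\<in>space M. \<epsilon> < \<bar>?D n \<omega>\<bar>}"
      show "\<omega> \<in> ?B1 \<union> ?B2 \<union> ?B3"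
      proof (rule ccontr)
        assume nb: "\<omega> \<notin> ?B1 \<union> ?B2 \<union> ?B3"
        then have ok: "good_sample lam n \<omega>" using \<omega> unfolding good_sample_def by (auto simp: not_less)
        let ?S = "LINT u|lborel. f0 u * rescaled_kernel k (bw c n) (t - u)"
        have "\<bar>est (bw c n) n \<omega> - ?S - linear_term (bw c n) n \<omega>\<bar> \<le> rb n"
          unfolding rb_def
          by (rule lin[OF n hh elim(5) elim(4) lam[unfolded lam_def] refl elim(6-9) ok[unfolded lam_def]])
        then have "real n powr (2 / 7) * \<bar>est (bw c n) n \<omega> - ?S - linear_term (bw c n) n \<omega>\<bar> \<le> real n powr (2 / 7) * rb n"
          by (intro mult_left_mono) auto
        moreover have "?D n \<omega> = real n powr (2 / 7) * (est (bw c n) n \<omega> - ?S - linear_term (bw c n) n \<omega>) + (bias n - smle_mean k f0 t c)"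
          by (simp add: bias_def algebra_simps)
        then have "\<bar>?D n \<omega>\<bar> \<le> real n powr (2 / 7) * \<bar>est (bw c n) n \<omega> - ?S - linear_term (bw c n) n \<omega>\<bar> + \<bar>bias n - smle_mean k f0 t c\<bar>"
          using abs_triangle_ineq[of "real n powr (2 / 7) * (est (bw c n) n \<omega> - ?S - linear_term (bw c n) n \<omega>)" "bias n - smle_mean k f0 t c"]
          by (simp add: abs_mult)
        ultimately show False using elim(1,2) \<omega> unfolding mem_Collect_eq by linarith
      qed
    qed
    have "prob {\<omega>\<in>space M. \<epsilon> < \<bar>?D n \<omega>\<bar>} \<le> prob (?B1 \<union> ?B2 \<union> ?B3)"
      by (rule finite_measure_mono[OF sub]) (intro sets.Un B1(1) B2(1) B3(1))
    also have "\<dots> \<le> prob (?B1 \<union> ?B2) + prob ?B3"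
      by (rule measure_Un_le) (intro sets.Un B1(1) B2(1) B3(1))+
    also have "\<dots> \<le> prob ?B1 + prob ?B2 + prob ?B3"
      by (intro add_right_mono measure_Un_le B1(1) B2(1))
    also have "\<dots> \<le> (real n + 1)\<^sup>2 * (2 * exp (- 2 * lam\<^sup>2)) + (real n + 1) * (2 * exp (- 2 * lam\<^sup>2))"
      using B1(2) B2(2) B3(2) by linarith
    finally show ?case unfolding lam_def .
  qed
  then show "(\<lambda>n. prob {\<omega>\<in>space M. \<epsilon> < \<bar>?D n \<omega>\<bar>}) \<longlonglongrightarrow> 0"
    by (rule tendsto_sandwich[OF always_eventually _ tendsto_const deviation_probability_tendsto_0, rotated]) simp
qed

lemma optimal_bandwidth_constant:
  shows "0 < smle_opt_const k F0 f0 g t"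
    and "\<And>c. 0 < c \<Longrightarrow> c \<noteq> smle_opt_const k F0 f0 g t \<Longrightarrow>
        smle_amse k F0 f0 g t (smle_opt_const k F0 f0 g t) < smle_amse k F0 f0 g t c"
proof -
  define A where "A = (1 / 2 * second_moment k * deriv (deriv f0) t)\<^sup>2"
  define B where "B = F0 t * (1 - F0 t) / g t * (LINT u|lborel. (deriv k u)\<^sup>2)"
  have A: "0 < A" using second_moment_pos f0''_nonzero by (simp add: A_def)
  have B: "0 < B" using smle_var_pos[OF zero_less_one] by (simp add: smle_var_def B_def)
  have amse: "smle_amse k F0 f0 g t c = A * c ^ 4 + B / c ^ 3" for c
    unfolding smle_amse_def smle_mean_def smle_var_def A_def B_def
    by (simp add: power_mult_distrib power2_eq_square power4_eq_xxxx ac_simps)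
  let ?c0 = "smle_opt_const k F0 f0 g t"
  have c0: "?c0 = (3 * B) powr (1 / 7) * (4 * A) powr (- (1 / 7))"
    unfolding smle_opt_const_def A_def B_def
    by (simp add: power_mult_distrib power_divide mult.assoc)
  show pos: "0 < ?c0" unfolding c0 using A B by simp
  have c0_7: "?c0 ^ 7 = 3 * B / (4 * A)"
  proof -
    have e1: "((3 * B) powr (1 / 7)) ^ 7 = 3 * B" using B by (simp add: powr_powr flip: powr_numeral)
    have e2: "((4 * A) powr (- (1 / 7))) ^ 7 = inverse (4 * A)"
    proof -
      have "((4 * A) powr (- (1 / 7))) ^ 7 = (4 * A) powr (real 7 * (- (1 / 7)))"
        by (rule powr_power) (use A in simp)
      also have "\<dots> = inverse (4 * A)" using A by (simp add: powr_minus)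
      finally show ?thesis .
    qed
    show ?thesis unfolding c0 power_mult_distrib e1 e2 by (rule divide_inverse[symmetric])
  qed
  show "smle_amse k F0 f0 g t ?c0 < smle_amse k F0 f0 g t c" if "0 < c" "c \<noteq> ?c0" for c
    unfolding amse by (rule power_sum_unique_minimum[OF A B pos c0_7 that])
qed

end

theorem theorem4p3:
  fixes M :: "'a measure" and X T :: "nat \<Rightarrow> 'a \<Rightarrow> real"
    and F0 f0 G g g' k :: "real \<Rightarrow> real" and M0 t :: real
  assumes model: "current_status_model M X T F0 G"
    and kernel: "smooth_kernel k"
    and F_support: "df_support F0 = {0..M0}"
    and F_strict: "strict_mono_on {0..M0} F0"
    and F_density: "has_density F0 f0"
    and F_away: "\<exists>\<epsilon>>0. \<forall>x\<in>{0..M0}. \<epsilon> \<le> f0 x"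
    and G_support: "df_support G = {0..}"
    and G_strict: "strict_mono_on {0..M0} G"
    and G_density: "has_density G g"
    and G_away: "\<exists>\<epsilon>>0. \<forall>x\<in>{0..M0}. \<epsilon> \<le> g x"
    and g_deriv: "\<forall>x\<in>{0..M0}. (g has_real_derivative g' x) (at x within {0..M0})"
    and g'_bounded: "bounded (g' ` {0..M0})"
    and t_pos: "0 < t"
    and f0_twice_diff: "\<forall>\<^sub>F x in nhds t. f0 differentiable (at x) \<and> deriv f0 differentiable (at x)"
    and f0''_cont: "isCont (deriv (deriv f0)) t"
    and f0''_nonzero: "deriv (deriv f0) t \<noteq> 0"
  shows
    "(\<forall>c>0. conv_in_distr M
        (\<lambda>n \<omega>. real n powr (2 / 7) *
           (smle_density k (c * real n powr (- (1 / 7))) (\<lambda>i. T i \<omega>) (status X T \<omega>) n t - f0 t))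
        (normal_law (smle_mean k f0 t c) (smle_var k F0 g t c))) \<and>
     0 < smle_opt_const k F0 f0 g t \<and>
     (\<forall>c>0. c \<noteq> smle_opt_const k F0 f0 g t \<longrightarrow>
        smle_amse k F0 f0 g t (smle_opt_const k F0 f0 g t) < smle_amse k F0 f0 g t c)"
proof -
  interpret prob_space M using model by (simp add: current_status_model_def)
  interpret smle_setting M X T F0 G k f0 g g' M0 t
    by unfold_locales
       (fact model kernel F_support F_density F_away G_density G_away g_deriv g'_bounded t_pos
         f0_twice_diff f0''_cont f0''_nonzero)+
  show ?thesis
  proof (intro conjI allI impI)
    fix c :: real assume "0 < c"
    from smle_asymptotic_normality[OF this, unfolded bw_def]
    show "conv_in_distr M
        (\<lambda>n \<omega>. real n powr (2 / 7) *
           (smle_density k (c * real n powr (- (1 / 7))) (\<lambda>i. T i \<omega>) (status X T \<omega>) n t - f0 t))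
        (normal_law (smle_mean k f0 t c) (smle_var k F0 g t c))" .
  qed (fact optimal_bandwidth_constant)+
qed

end
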